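(* Let $M$ be a complex finite Galois extension of $\mathbb{Q}$ (i.e. $M$ is Galois over $\mathbb{Q}$ and not totally real), let $p$ be a prime number, and let $\Gamma$ be a non-empty subset of the set of prime ideals of $\mathcal{O}_M$ above $p$. Let $\Delta_\Gamma$, $Y$, $\overline{\Delta_\Gamma(Y)}$, $S_p$ and $t=\min_{c\in C}\{t_c\}$ be as defined in the context, and let $r=\operatorname{rank}_{\mathbb{Z}}\mathcal{O}_M^*$. Assume the $p$-adic Schanuel Conjecture (stated in the context). Then \[\operatorname{rank}_{\mathbb{Z}_p}\bigl(\overline{\Delta_\Gamma(Y)}\bigr)\geq r-(t-1)^+.\]
   Context: Notation. $\mathcal{O}_M$ is the ring of integers of $M$, $\mathcal{O}_M^*$ its unit group, $G=\operatorname{Gal}(M/\mathbb{Q})$. For a prime $\mathfrak{p}$ of $\mathcal{O}_M$ above $p$: $M_\mathfrak{p}$ is the completion of $M$ at $\mathfrak{p}$, $\mathcal{O}_\mathfrak{p}$ its ring of integers, $\pi$ a uniformizer, $\mathcal{O}_{\mathfrak{p}}^*$ the group of local units and $\mathcal{O}_{\mathfrak{p},1}^*=1+\pi\mathcal{O}_\mathfrak{p}$ the group of principal local units (a $\mathbb{Z}_p$-module under exponentiation). $\mathbb{C}_p$ is the completion of an algebraic closure of $\mathbb{Q}_p$. For $x\in\mathbb{R}$, $x^+=x$ if $x\ge 0$ and $x^+=0$ if $x<0$. $\Delta_\Gamma:\mathcal{O}_M^*\to\prod_{\mathfrak{p}\in\Gamma}\mathcal{O}_\mathfrak{p}^*$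 is the diagonal embedding $u\mapsto(u,\dots,u)$; $Y:=\Delta_\Gamma^{-1}\bigl(\prod_{\mathfrak{p}\in\Gamma}\mathcal{O}_{\mathfrak{p},1}^*\bigr)$; $\overline{\Delta_\Gamma(Y)}$ is the topological closure of $\Delta_\Gamma(Y)$ in $\prod_{\mathfrak{p}\in\Gamma}\mathcal{O}_{\mathfrak{p},1}^*$ (a $\mathbb{Z}_p$-submodule). $E$ and $E_p$ are the sets of all field embeddings $M\to\mathbb{C}$ and $M\to\mathbb{C}_p$ respectively. Fix $\mathfrak{p}_0\in\Gamma$ and let $\sigma_0\in E_p$ be the composite $M\to M_{\mathfrak{p}_0}\to\mathbb{C}_p$ for a fixed continuous embedding $M_{\mathfrak{p}_0}\to\mathbb{C}_p$. Every element of $E_p$ is $\sigma_0 g=\sigma_0\circ g$ for a unique $g\in G$, and $S_p:=\{\sigma_0 g : g\in G,\ g^{-1}\mathfrak{p}_0\in\Gamma\}$. For $\tau\in E$, $\overline{\tau}\in E$ is $\overline{\tau}(m)=\overline{\tau(m)}$. $C\subset G$ is the set of elements induced by complex conjugation, i.e. of $c\in G$ with $\overline{\tau}=\tau\circ c$ for some $\tau\in E$. Pick $\sigma\in E_p$, write $E_p\smallsetminus S_p=\{\sigma g_1,\dots,\sigma g_k\}$ with distinct $g_i\in G$, and put $J_\sigma=\{g_1,\dots,g_k\}$. For $c\in C$, $t_c$ is the number of right cosets $\{g,cg\}$ of $\{\mathrm{id},c\}$ contained in $J_\sigma$; $t=\min_{c\in C}\{t_c\}$ (this is independent of the choice of $\sigma$).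 $\log_p:\mathbb{C}_p^*\to\mathbb{C}_p$ is the $p$-adic logarithm, given by the usual power series on $|x-1|_p<1$ and extended to $\mathbb{C}_p^*$ by $\log_p(ab)=\log_p(a)+\log_p(b)$ and $\log_p(\zeta p^s)=0$ for all roots of unity $\zeta$ and $s\in\mathbb{Z}$. $p$-adic Schanuel Conjecture (logarithmic formulation): let non-zero $\alpha_1,\dots,\alpha_n$ be algebraic over $\mathbb{Q}$ and contained in an extension of $\mathbb{Q}_p$ (inside $\mathbb{C}_p$). If $\log_p\alpha_1,\dots,\log_p\alpha_n$ are linearly independent over $\mathbb{Q}$, then they are algebraically independent over $\mathbb{Q}$. *)

theory Defs
  imports
    "HOL-Analysis.Analysis"
    "HOL-Library.Poly_Mapping"
    "HOL-Algebra.Algebra"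
    "HOL-Algebra.Algebraic_Closure_Type"
begin

section \<open>Number fields\<close>

text \<open>A number field is a type of class \<open>field_char_0\<close> which is finite-dimensional over the rationals.
  Fields given by types are regarded as rings with carrier via \<^const>\<open>ring_of_type_algebra\<close>.\<close>

definition embeddings :: "('a::field \<Rightarrow> 'b::field) set" where
  "embeddings = ring_hom ring_of_type_algebra ring_of_type_algebra"

definition galois_group :: "('a::field \<Rightarrow> 'a) set" where
  "galois_group = ring_iso ring_of_type_algebra ring_of_type_algebra"

definition galois_number_field :: "'a::field_char_0 itself \<Rightarrow> bool" where
  "galois_number_field T \<longleftrightarrow>
     (\<exists>B::'a set. finite B \<and> Modules.module.span (\<lambda>(q::rat) x. of_rat q * x) B = UNIV) \<and>
     {x::'a. \<forall>g\<in>galois_group. g x = x} = \<rat>"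

definition totally_real :: "'a::field_char_0 itself \<Rightarrow> bool" where
  "totally_real T \<longleftrightarrow> (\<forall>\<tau>\<in>(embeddings :: ('a \<Rightarrow> complex) set). range \<tau> \<subseteq> \<real>)"

definition ring_of_integers :: "'a::field_char_0 ring" where
  "ring_of_integers = ring_of_type_algebra\<lparr>carrier := {x. algebraic_int x}\<rparr>"

definition primes_above :: "nat \<Rightarrow> 'a::field_char_0 set set" where
  "primes_above p = {P. primeideal P (ring_of_integers :: 'a ring) \<and> of_nat p \<in> P}"

section \<open>Completions\<close>

definition cauchy_ring :: "('a::field \<Rightarrow> real) \<Rightarrow> (nat \<Rightarrow> 'a) ring" where
  "cauchy_ring v =
     \<lparr>carrier = {x. \<forall>e>0. \<exists>N. \<forall>m\<ge>N. \<forall>n\<ge>N. v (x m - x n) < e},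
      monoid.mult = (\<lambda>x y n. x n * y n), one = (\<lambda>_. 1),
      ring.zero = (\<lambda>_. 0), add = (\<lambda>x y n. x n + y n)\<rparr>"

definition null_seqs :: "('a::field \<Rightarrow> real) \<Rightarrow> (nat \<Rightarrow> 'a) set" where
  "null_seqs v = {x \<in> carrier (cauchy_ring v). (\<lambda>n. v (x n)) \<longlonglongrightarrow> 0}"

definition completion :: "('a::field \<Rightarrow> real) \<Rightarrow> (nat \<Rightarrow> 'a) set ring" where
  "completion v = cauchy_ring v Quot null_seqs v"

definition completion_embed :: "('a::field \<Rightarrow> real) \<Rightarrow> 'a \<Rightarrow> (nat \<Rightarrow> 'a) set" where
  "completion_embed v a = null_seqs v +>\<^bsub>cauchy_ring v\<^esub> (\<lambda>_. a)"

definition completion_abs :: "('a::field \<Rightarrow> real) \<Rightarrow> (nat \<Rightarrow> 'a) set \<Rightarrow> real" where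
  "completion_abs v A = (THE l. \<exists>x\<in>A. (\<lambda>n. v (x n)) \<longlonglongrightarrow> l)"

section \<open>Local fields at a prime ideal\<close>

definition ideal_ord :: "'a::field_char_0 set \<Rightarrow> 'a \<Rightarrow> nat" where
  "ideal_ord P a = (GREATEST n. a \<in> P [^]\<^bsub>ideals_set ring_of_integers\<^esub> n)"

definition adic_val :: "'a::field_char_0 set \<Rightarrow> 'a \<Rightarrow> int" where
  "adic_val P x = (THE k. \<exists>a b. algebraic_int a \<and> a \<noteq> 0 \<and> algebraic_int b \<and> b \<noteq> 0 \<and>
     x = a / b \<and> k = int (ideal_ord P a) - int (ideal_ord P b))"

text \<open>The base 2 is an arbitrary choice; every base larger than 1 gives the same completion,
  topology and valuation ring.\<close>

definition adic_abs :: "'a::field_char_0 set \<Rightarrow> 'a \<Rightarrow> real" where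
  "adic_abs P x = (if x = 0 then 0 else 2 powi (- adic_val P x))"

definition local_field :: "'a::field_char_0 set \<Rightarrow> (nat \<Rightarrow> 'a) set ring" where
  "local_field P = completion (adic_abs P)"

definition local_embed :: "'a::field_char_0 set \<Rightarrow> 'a \<Rightarrow> (nat \<Rightarrow> 'a) set" where
  "local_embed P = completion_embed (adic_abs P)"

definition local_abs :: "'a::field_char_0 set \<Rightarrow> (nat \<Rightarrow> 'a) set \<Rightarrow> real" where
  "local_abs P = completion_abs (adic_abs P)"

text \<open>The locale \<^locale>\<open>Metric_space\<close> demands a nonnegative symmetric function on the whole type,
  hence the case distinction.\<close>

definition local_dist :: "'a::field_char_0 set \<Rightarrow> (nat \<Rightarrow> 'a) set \<Rightarrow> (nat \<Rightarrow> 'a) set \<Rightarrow> real" where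
  "local_dist P x y =
     (if x \<in> carrier (local_field P) \<and> y \<in> carrier (local_field P)
      then local_abs P (x \<ominus>\<^bsub>local_field P\<^esub> y) else 0)"

definition local_integers :: "'a::field_char_0 set \<Rightarrow> (nat \<Rightarrow> 'a) set ring" where
  "local_integers P =
     (local_field P)\<lparr>carrier := {x \<in> carrier (local_field P). local_abs P x \<le> 1}\<rparr>"

definition uniformizer :: "'a::field_char_0 set \<Rightarrow> (nat \<Rightarrow> 'a) set \<Rightarrow> bool" where
  "uniformizer P \<pi> \<longleftrightarrow> \<pi> \<in> carrier (local_integers P) \<and>
     PIdl\<^bsub>local_integers P\<^esub> \<pi> = {x \<in> carrier (local_field P). local_abs P x < 1}"

text \<open>The set \<open>1 + \<pi>O\<close> does not depend on the uniformizer \<open>\<pi>\<close>.\<close>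

definition principal_units :: "'a::field_char_0 set \<Rightarrow> (nat \<Rightarrow> 'a) set set" where
  "principal_units P =
     {\<one>\<^bsub>local_field P\<^esub> \<oplus>\<^bsub>local_field P\<^esub> \<pi> \<otimes>\<^bsub>local_field P\<^esub> a | \<pi> a.
        uniformizer P \<pi> \<and> a \<in> carrier (local_integers P)}"

section \<open>The p-adic integers and p-adic powers of principal units\<close>

text \<open>\<open>\<rat>\<^sub>p\<close> is the completion of the number field \<^typ>\<open>rat\<close> at the prime ideal generated by \<open>p\<close>.\<close>

definition rat_prime :: "nat \<Rightarrow> rat set" where
  "rat_prime p = PIdl\<^bsub>ring_of_integers\<^esub> (of_nat p)"

definition padic_integers :: "nat \<Rightarrow> (nat \<Rightarrow> rat) set ring" where
  "padic_integers p = local_integers (rat_prime p)"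

text \<open>\<open>u\<^sup>z\<close> is the limit of \<open>u\<^sup>n\<close> as the natural number \<open>n\<close> tends to \<open>z\<close> p-adically.\<close>

definition padic_power ::
    "nat \<Rightarrow> 'a::field_char_0 set \<Rightarrow> (nat \<Rightarrow> 'a) set \<Rightarrow> (nat \<Rightarrow> rat) set \<Rightarrow> (nat \<Rightarrow> 'a) set" where
  "padic_power p P u z =
     (THE w. w \<in> carrier (local_field P) \<and>
        (\<forall>n::nat \<Rightarrow> nat.
           (\<lambda>k. local_dist (rat_prime p) (local_embed (rat_prime p) (of_nat (n k))) z) \<longlonglongrightarrow> 0 \<longrightarrow>
           (\<lambda>k. local_dist P (u [^]\<^bsub>local_field P\<^esub> n k) w) \<longlonglongrightarrow> 0))"

section \<open>Ranks of modules\<close>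

definition indep_subset :: "('r, 's) ring_scheme \<Rightarrow> ('r, 'b, 't) module_scheme \<Rightarrow> 'b set \<Rightarrow> bool" where
  "indep_subset R N S \<longleftrightarrow> finite S \<and> S \<subseteq> carrier N \<and>
     (\<forall>a \<in> S \<rightarrow> carrier R.
        (\<Oplus>\<^bsub>N\<^esub>x\<in>S. a x \<odot>\<^bsub>N\<^esub> x) = \<zero>\<^bsub>N\<^esub> \<longrightarrow> (\<forall>x\<in>S. a x = \<zero>\<^bsub>R\<^esub>))"

definition module_rank :: "('r, 's) ring_scheme \<Rightarrow> ('r, 'b, 't) module_scheme \<Rightarrow> enat" where
  "module_rank R N = (SUP S \<in> {S. indep_subset R N S}. enat (card S))"

text \<open>Unit groups are multiplicative, so the additive operations of a module record of units are the
  multiplicative ones; its fields \<open>mult\<close> and \<open>one\<close> play no role.\<close>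

definition units_module :: "(int, 'a::field_char_0) module" where
  "units_module =
     \<lparr>carrier = Units ring_of_integers, monoid.mult = (*), one = 1,
      ring.zero = 1, add = (*), smult = (\<lambda>k u. u powi k)\<rparr>"

section \<open>The closure of the diagonally embedded units\<close>

definition diag_embed ::
    "'a::field_char_0 set set \<Rightarrow> 'a \<Rightarrow> 'a set \<Rightarrow> (nat \<Rightarrow> 'a) set" where
  "diag_embed \<Gamma> u = (\<lambda>P\<in>\<Gamma>. local_embed P u)"

definition principal_global_units :: "'a::field_char_0 set set \<Rightarrow> 'a set" where
  "principal_global_units \<Gamma> =
     {u \<in> Units ring_of_integers. diag_embed \<Gamma> u \<in> Pi\<^sub>E \<Gamma> principal_units}"

definition diag_closure ::
    "'a::field_char_0 set set \<Rightarrow> ('a set \<Rightarrow> (nat \<Rightarrow> 'a) set) set" where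
  "diag_closure \<Gamma> =
     Abstract_Topology.closure_of
       (product_topology
          (\<lambda>P. Metric_space.mtopology (principal_units P) (local_dist P)) \<Gamma>)
       (diag_embed \<Gamma> ` principal_global_units \<Gamma>)"

definition diag_closure_module ::
    "nat \<Rightarrow> 'a::field_char_0 set set \<Rightarrow>
     ((nat \<Rightarrow> rat) set, 'a set \<Rightarrow> (nat \<Rightarrow> 'a) set) module" where
  "diag_closure_module p \<Gamma> =
     \<lparr>carrier = diag_closure \<Gamma>,
      monoid.mult = (\<lambda>x y. \<lambda>P\<in>\<Gamma>. x P \<otimes>\<^bsub>local_field P\<^esub> y P), one = (\<lambda>P\<in>\<Gamma>. \<one>\<^bsub>local_field P\<^esub>),
      ring.zero = (\<lambda>P\<in>\<Gamma>. \<one>\<^bsub>local_field P\<^esub>), add = (\<lambda>x y. \<lambda>P\<in>\<Gamma>. x P \<otimes>\<^bsub>local_field P\<^esub> y P),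
      smult = (\<lambda>z x. \<lambda>P\<in>\<Gamma>. padic_power p P (x P) z)\<rparr>"

section \<open>The field \<open>\<complex>\<^sub>p\<close>\<close>

text \<open>A complete valued field \<open>C\<close>, with absolute value \<open>dist x 0\<close>, is a completion of an algebraic
  closure \<open>L\<close> of \<open>\<rat>\<^sub>p\<close>.  Here \<open>\<rat>\<^sub>p\<close> is the closure of \<open>\<rat>\<close> in \<open>C\<close>.\<close>

definition padic_complex_field :: "nat \<Rightarrow> 'c::{field_char_0, complete_space} itself \<Rightarrow> bool" where
  "padic_complex_field p T \<longleftrightarrow>
     (\<forall>x y::'c. dist x y = dist (x - y) 0) \<and>
     (\<forall>x y::'c. dist (x * y) 0 = dist x 0 * dist y 0) \<and>
     (\<forall>x y::'c. dist (x + y) 0 \<le> max (dist x 0) (dist y 0)) \<and>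
     dist (of_nat p :: 'c) 0 = 1 / real p \<and>
     (\<exists>L::'c set.
        algebraic_closure (ring_of_type_algebra\<lparr>carrier := L\<rparr>) (closure \<rat>) \<and> closure L = UNIV)"

text \<open>The value at 0 is irrelevant and only fixed to make the function unique.\<close>

definition is_padic_log :: "nat \<Rightarrow> ('c::{field_char_0, complete_space} \<Rightarrow> 'c) \<Rightarrow> bool" where
  "is_padic_log p l \<longleftrightarrow>
     (\<forall>x. dist x 1 < 1 \<longrightarrow> (\<lambda>n. (-1) ^ n * (x - 1) ^ Suc n / of_nat (Suc n)) sums l x) \<and>
     (\<forall>a b. a \<noteq> 0 \<longrightarrow> b \<noteq> 0 \<longrightarrow> l (a * b) = l a + l b) \<and>
     (\<forall>\<zeta> s. (\<exists>n>0. \<zeta> ^ n = 1) \<longrightarrow> l (\<zeta> * of_nat p powi s) = 0) \<and>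
     l 0 = 0"

definition padic_log :: "nat \<Rightarrow> 'c::{field_char_0, complete_space} \<Rightarrow> 'c" where
  "padic_log p = (THE l. is_padic_log p l)"

section \<open>The p-adic Schanuel conjecture\<close>

definition rat_lin_indep :: "nat \<Rightarrow> (nat \<Rightarrow> 'c::field_char_0) \<Rightarrow> bool" where
  "rat_lin_indep n x \<longleftrightarrow>
     (\<forall>q::nat \<Rightarrow> rat. (\<Sum>i<n. of_rat (q i) * x i) = 0 \<longrightarrow> (\<forall>i<n. q i = 0))"

text \<open>Polynomials in the variables \<open>0, \<dots>, n - 1\<close> are finitely supported maps from monomials,
  i.e. finitely supported exponent functions, to coefficients.\<close>

definition rat_alg_indep :: "nat \<Rightarrow> (nat \<Rightarrow> 'c::field_char_0) \<Rightarrow> bool" where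
  "rat_alg_indep n x \<longleftrightarrow>
     (\<forall>f :: (nat \<Rightarrow>\<^sub>0 nat) \<Rightarrow>\<^sub>0 rat.
        (\<forall>m\<in>Poly_Mapping.keys f. Poly_Mapping.keys m \<subseteq> {..<n}) \<longrightarrow>
        (\<Sum>m\<in>Poly_Mapping.keys f. of_rat (Poly_Mapping.lookup f m) *
           (\<Prod>i<n. x i ^ Poly_Mapping.lookup m i)) = 0 \<longrightarrow> f = 0)"

definition padic_schanuel :: "nat \<Rightarrow> 'c::{field_char_0, complete_space} itself \<Rightarrow> bool" where
  "padic_schanuel p T \<longleftrightarrow>
     (\<forall>n. \<forall>\<alpha>::nat \<Rightarrow> 'c. (\<forall>i<n. \<alpha> i \<noteq> 0 \<and> Polynomial.algebraic (\<alpha> i)) \<longrightarrow>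
        rat_lin_indep n (\<lambda>i. padic_log p (\<alpha> i)) \<longrightarrow>
        rat_alg_indep n (\<lambda>i. padic_log p (\<alpha> i)))"

section \<open>Complex conjugations and the number \<open>t\<close>\<close>

definition complex_conjugations :: "('a::field \<Rightarrow> 'a) set" where
  "complex_conjugations =
     {c \<in> galois_group. \<exists>\<tau>\<in>(embeddings :: ('a \<Rightarrow> complex) set). cnj \<circ> \<tau> = \<tau> \<circ> c}"

text \<open>\<open>g -` P\<close> is the prime ideal \<open>g\<inverse>P\<close>.\<close>

definition embeddings_over ::
    "'a::field_char_0 set set \<Rightarrow> 'a set \<Rightarrow> ('a \<Rightarrow> 'c::field) \<Rightarrow> ('a \<Rightarrow> 'c) set" where
  "embeddings_over \<Gamma> P \<sigma>\<^sub>0 = {\<sigma>\<^sub>0 \<circ> g | g. g \<in> galois_group \<and> g -` P \<in> \<Gamma>}"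

definition complement_indices ::
    "('a::field \<Rightarrow> 'c::field) set \<Rightarrow> ('a \<Rightarrow> 'c) \<Rightarrow> ('a \<Rightarrow> 'a) set" where
  "complement_indices S \<sigma> = {g \<in> galois_group. \<sigma> \<circ> g \<in> embeddings - S}"

definition coset_count :: "('a::field \<Rightarrow> 'a) set \<Rightarrow> ('a \<Rightarrow> 'a) \<Rightarrow> nat" where
  "coset_count J c = card {A. \<exists>g\<in>galois_group. A = {g, c \<circ> g} \<and> A \<subseteq> J}"

definition min_coset_count :: "('a::field \<Rightarrow> 'a) set \<Rightarrow> nat" where
  "min_coset_count J = Min (coset_count J ` complex_conjugations)"

end

theory Submission
  imports Defs
begin

text \<open>A prime \<open>P\<close> above \<open>p\<close> is \<open>{x. \<bar>\<tau> x\<bar> < 1}\<close> for an embedding \<open>\<tau>\<close> into \<open>\<complex>\<^sub>p\<close>, and its local field is the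
  closure of the range of \<open>\<tau>\<close>.  Taking \<open>log\<^sub>p\<close> of a relation with p-adic exponents \<open>\<zeta>\<^sub>v\<close> between units \<open>v\<close> in
  the closure therefore gives \<open>\<Sum>\<^sub>v \<zeta>\<^sub>v log\<^sub>p(\<sigma> (h v)) = 0\<close> for all \<open>h \<notin> J\<close>, and it suffices to bound the rank
  of the matrix \<open>log\<^sub>p(\<sigma> (h v))\<close> with rows \<open>h \<notin> J\<close> from below.  By the Schanuel conjecture, sending
  \<open>log\<^sub>p(\<sigma> u)\<close> to \<open>ln \<bar>\<tau> u\<bar>\<close> for a complex embedding \<open>\<tau>\<close> extends to a well-defined specialisation of the ring they
  generate, so this rank is at least that of the matrix \<open>ln \<bar>\<tau> (h v)\<bar>\<close> with the same rows.  With all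
  rows \<open>h \<in> G\<close> the real matrix has independent columns.  Its rows at \<open>h\<close> and \<open>c h\<close> agree and all rows sum to
  zero, so it loses at most \<open>(t\<^sub>c - 1)\<^sup>+\<close> in rank when the rows in \<open>J\<close> are deleted.\<close>

section \<open>Algebraic integers\<close>

text \<open>The exponents of a relation in the closure are p-adic integers, about which Schanuel's
  conjecture, a statement over the rationals, says nothing directly. Independence of columns is
  therefore sought with arbitrary coefficients in C_p, where it depends on nonvanishing minors, that
  is, on rational polynomials in logarithms. Only logarithms of multiplicatively independent units
  can be fed into the conjecture, and the conjugates of independent units are in general dependent.
  Hence a maximal independent set among all conjugates provides the variables; all other logarithms
  are rational linear forms in them, with the same coefficients on the real and the p-adic side.
  Specialisation can only lower the rank, which is the direction required. The embedding \<tau> is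
  chosen to realise a conjugation c that attains the minimum t. The -1 in t - 1 comes from the
  product formula, which recovers one deleted coset for free. Passing from all units to principal
  units costs no rank: a common power N takes finitely many units into Y and multiplies their
  logarithms by N.\<close>

abbreviation ipoly :: "int poly \<Rightarrow> 'a::field_char_0 \<Rightarrow> 'a" where
  "ipoly f x \<equiv> poly (map_poly of_int f) x"

lemma ipoly_eq_sum:
  assumes "Polynomial.degree f \<le> n"
  shows "ipoly f x = (\<Sum>i\<le>n. of_int (Polynomial.coeff f i) * x ^ i)"
proof -
  have "ipoly f x = (\<Sum>i\<le>Polynomial.degree f. of_int (Polynomial.coeff f i) * x ^ i)"
    by (simp add: poly_altdef degree_map_poly coeff_map_poly)
  also have "\<dots> = (\<Sum>i\<le>n. of_int (Polynomial.coeff f i) * x ^ i)"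
    using assms by (intro sum.mono_neutral_left) (auto simp: coeff_eq_0)
  finally show ?thesis .
qed

lemma ipoly_add: "ipoly (f + g) x = ipoly f x + ipoly g x"
proof -
  have "(map_poly of_int (f + g) :: 'a poly) = map_poly of_int f + map_poly of_int g"
    by (rule poly_eqI) (simp add: coeff_map_poly)
  then show ?thesis
    by simp
qed

lemma ipoly_diff: "ipoly (f - g) x = ipoly f x - ipoly g x"
  using ipoly_add[of "f - g" g x] by simp

lemma ipoly_smult: "ipoly (Polynomial.smult c f) x = of_int c * ipoly f x"
  by (simp add: map_poly_smult)

lemma ipoly_mult: "ipoly (f * g) x = ipoly f x * ipoly g x"
  by (induction f) (auto simp: map_poly_pCons ipoly_add ipoly_smult algebra_simps)

lemma ipoly_hom:
  fixes h :: "'a::field_char_0 \<Rightarrow> 'b::field_char_0"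
  assumes "h 0 = 0" "\<And>x y. h (x + y) = h x + h y" "\<And>x y. h (x * y) = h x * h y"
    and "\<And>k. h (of_int k) = of_int k"
  shows "ipoly f (h x) = h (ipoly f x)"
  by (induction f) (auto simp: map_poly_pCons assms)

text \<open>Fraction-free elimination takes the place of the determinant in the Cayley-Hamilton
  argument. Crossing out row and column \<open>k\<close> replaces each entry by the 2-by-2 minor
  \<open>M'\<close>. If the diagonal is monic of degree \<open>d\<close> and all other entries have
  smaller degree, the same holds for \<open>M'\<close> with \<open>d + d\<close>. In the end a
  single monic equation at \<open>j\<^sub>0\<close> is left.\<close>

lemma monic_annihilator:
  fixes x :: "'a::field_char_0" and M :: "'i \<Rightarrow> 'i \<Rightarrow> int poly"
  assumes "finite T" "j\<^sub>0 \<notin> T"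
    and "\<And>i. i \<in> insert j\<^sub>0 T \<Longrightarrow> Polynomial.degree (M i i) \<le> d \<and> Polynomial.coeff (M i i) d = 1"
    and "\<And>i j. \<lbrakk>i \<in> insert j\<^sub>0 T; j \<in> insert j\<^sub>0 T; i \<noteq> j\<rbrakk> \<Longrightarrow> Polynomial.degree (M i j) < d"
    and "\<And>i. i \<in> insert j\<^sub>0 T \<Longrightarrow> (\<Sum>j\<in>insert j\<^sub>0 T. ipoly (M i j) x * v j) = 0"
  shows "\<exists>f. Polynomial.lead_coeff f = 1 \<and> ipoly f x * v j\<^sub>0 = 0"
  using assms
proof (induction T arbitrary: M d rule: finite_induct)
  case empty
  have d: "Polynomial.degree (M j\<^sub>0 j\<^sub>0) \<le> d" "Polynomial.coeff (M j\<^sub>0 j\<^sub>0) d = 1"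
    using empty.prems(2) by auto
  then have "Polynomial.degree (M j\<^sub>0 j\<^sub>0) = d"
    by (metis le_antisym le_degree zero_neq_one)
  with d empty.prems(4) show ?case
    by (intro exI[of _ "M j\<^sub>0 j\<^sub>0"]) auto
next
  case (insert k T)
  note deg = insert.prems(2) and off = insert.prems(3) and eq = insert.prems(4)
  let ?S = "insert j\<^sub>0 T"
  define M' where "M' i j = M k k * M i j - M i k * M k j" for i j
  have k: "k \<notin> ?S" and fin: "finite ?S"
    using insert by auto
  have ins: "insert j\<^sub>0 (insert k T) = insert k ?S"
    by auto
  have dk: "Polynomial.degree (M k k) \<le> d" "Polynomial.coeff (M k k) d = 1"
    using deg[of k] by auto
  have dik: "Polynomial.degree (M i k) < d" "Polynomial.degree (M k i) < d" if "i \<in> ?S" for i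
    using that k by (auto intro!: off)
  have low: "Polynomial.degree (M i k * M k j) < d + d" if "i \<in> ?S" "j \<in> ?S" for i j
  proof -
    have "Polynomial.degree (M i k * M k j) \<le> Polynomial.degree (M i k) + Polynomial.degree (M k j)"
      by (rule degree_mult_le)
    then show ?thesis
      using dik(1)[OF that(1)] dik(2)[OF that(2)] by linarith
  qed
  show ?case
  proof (rule insert.IH[of M' "d + d"])
    show "j\<^sub>0 \<notin> T"
      using insert by auto
    fix i assume i: "i \<in> ?S"
    have di: "Polynomial.degree (M i i) \<le> d" "Polynomial.coeff (M i i) d = 1"
      using deg[of i] i by auto
    have "Polynomial.degree (M k k * M i i) \<le> d + d"
      using degree_mult_le[of "M k k" "M i i"] dk(1) di(1) by linarith
    moreover have "Polynomial.coeff (M k k * M i i) (d + d) = 1"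
    proof -
      have "Polynomial.degree (M k k) = d" "Polynomial.degree (M i i) = d"
        using dk di by (metis le_antisym le_degree zero_neq_one)+
      then show ?thesis
        using coeff_mult_degree_sum[of "M k k" "M i i"] dk di by simp
    qed
    ultimately show "Polynomial.degree (M' i i) \<le> d + d \<and> Polynomial.coeff (M' i i) (d + d) = 1"
      using low[OF i i] by (auto simp: M'_def coeff_eq_0 intro!: degree_diff_le)
    show "Polynomial.degree (M' i j) < d + d" if j: "j \<in> ?S" and ij: "i \<noteq> j" for j
    proof -
      have "Polynomial.degree (M k k * M i j) \<le> Polynomial.degree (M k k) + Polynomial.degree (M i j)"
        by (rule degree_mult_le)
      also have "\<dots> < d + d"
        using dk(1) off[of i j] i j ij by auto
      finally show ?thesis
        unfolding M'_def using low[OF i j] by (intro degree_diff_less)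
    qed
    \<comment> \<open>Equations \<open>i\<close> and \<open>k\<close> are each solved for their term
      at \<open>k\<close>; in the combination that forms \<open>M'\<close> these two terms
      cancel.\<close>
    have S: "(\<Sum>j\<in>?S. ipoly (M l j) x * v j) = - (ipoly (M l k) x * v k)" if "l \<in> insert k ?S" for l
      using eq[of l] that k fin unfolding ins by (subst (asm) sum.insert) (auto simp: eq_neg_iff_add_eq_0 add.commute)
    have "(\<Sum>j\<in>?S. ipoly (M' i j) x * v j)
        = ipoly (M k k) x * (\<Sum>j\<in>?S. ipoly (M i j) x * v j)
          - ipoly (M i k) x * (\<Sum>j\<in>?S. ipoly (M k j) x * v j)"
      unfolding sum_distrib_left sum_subtractf[symmetric]
      by (intro sum.cong) (auto simp: M'_def ipoly_diff ipoly_mult algebra_simps)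
    also have "\<dots> = 0"
      using S[of i] S[of k] i by simp
    finally show "(\<Sum>j\<in>?S. ipoly (M' i j) x * v j) = 0" .
  qed
qed

section \<open>Lattices stable under multiplication, and the ring of algebraic integers\<close>

definition zspan :: "'i set \<Rightarrow> ('i \<Rightarrow> 'a::field_char_0) \<Rightarrow> 'a set" where
  "zspan S v = {\<Sum>j\<in>S. of_int (A j) * v j | A. True}"

lemma zspanI: "a = (\<Sum>j\<in>S. of_int (A j) * v j) \<Longrightarrow> a \<in> zspan S v"
  unfolding zspan_def by blast

lemma zspan_base:
  assumes "finite S" "j \<in> S"
  shows "v j \<in> zspan S v"
proof (rule zspanI)
  have "(\<Sum>i\<in>S. of_int (if i = j then 1 else 0) * v i) = (\<Sum>i\<in>S. if i = j then v i else 0)"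
    by (intro sum.cong) auto
  then show "v j = (\<Sum>i\<in>S. of_int (if i = j then 1 else 0) * v i)"
    using assms by simp
qed

lemma zspan_0: "0 \<in> zspan S v"
  unfolding zspan_def by (intro CollectI exI[of _ "\<lambda>_. 0"]) simp

lemma zspan_add: "a \<in> zspan S v \<Longrightarrow> b \<in> zspan S v \<Longrightarrow> a + b \<in> zspan S v"
  unfolding zspan_def
proof safe
  fix A B
  show "\<exists>C. (\<Sum>j\<in>S. of_int (A j) * v j) + (\<Sum>j\<in>S. of_int (B j) * v j) = (\<Sum>j\<in>S. of_int (C j) * v j) \<and> True"
    by (intro exI[of _ "\<lambda>j. A j + B j"]) (simp add: sum.distrib algebra_simps)
qed

lemma zspan_int_mult: "a \<in> zspan S v \<Longrightarrow> of_int k * a \<in> zspan S v"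
  unfolding zspan_def
proof safe
  fix A
  show "\<exists>C. of_int k * (\<Sum>j\<in>S. of_int (A j) * v j) = (\<Sum>j\<in>S. of_int (C j) * v j) \<and> True"
    by (intro exI[of _ "\<lambda>j. k * A j"]) (simp add: sum_distrib_left algebra_simps)
qed

lemma zspan_sum: "(\<And>i. i \<in> I \<Longrightarrow> a i \<in> zspan S v) \<Longrightarrow> (\<Sum>i\<in>I. of_int (k i) * a i) \<in> zspan S v"
  by (induction I rule: infinite_finite_induct) (auto intro: zspan_0 zspan_add zspan_int_mult)

definition zstable :: "'i set \<Rightarrow> ('i \<Rightarrow> 'a::field_char_0) \<Rightarrow> 'a \<Rightarrow> bool" where
  "zstable S v x \<longleftrightarrow> (\<forall>i\<in>S. x * v i \<in> zspan S v)"

lemma zstable_span: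
  assumes "zstable S v x" "a \<in> zspan S v" shows "x * a \<in> zspan S v"
proof -
  from assms(2) obtain A where a: "a = (\<Sum>j\<in>S. of_int (A j) * v j)"
    unfolding zspan_def by blast
  have "x * a = (\<Sum>j\<in>S. of_int (A j) * (x * v j))"
    unfolding a sum_distrib_left by (simp add: mult_ac)
  also have "\<dots> \<in> zspan S v"
    using assms(1) by (intro zspan_sum) (auto simp: zstable_def)
  finally show ?thesis .
qed

lemma zstable_add: "zstable S v x \<Longrightarrow> zstable S v y \<Longrightarrow> zstable S v (x + y)"
  by (auto simp: zstable_def distrib_right intro: zspan_add)

lemma zstable_mult: "zstable S v x \<Longrightarrow> zstable S v y \<Longrightarrow> zstable S v (x * y)"
  using zstable_span[of S v x] by (auto simp: zstable_def mult.assoc)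

text \<open>\<open>v\<close> is an eigenvector with eigenvalue \<open>x\<close> of the integer
  matrix \<open>A\<close> of multiplication by \<open>x\<close>. The polynomial matrix X - A has the
  shape required by \<open>monic_annihilator\<close> with \<open>d = 1\<close>, and the nonzero
  factor \<open>v j\<^sub>0\<close> can be cancelled.\<close>

lemma algebraic_int_if_zstable:
  fixes x :: "'a::field_char_0"
  assumes S: "finite S" "j\<^sub>0 \<in> S" "v j\<^sub>0 \<noteq> 0" and st: "zstable S v x"
  shows "algebraic_int x"
proof -
  from st have "\<forall>i\<in>S. \<exists>A. x * v i = (\<Sum>j\<in>S. of_int (A j) * v j)"
    unfolding zstable_def zspan_def by blast
  then obtain A where A: "\<And>i. i \<in> S \<Longrightarrow> x * v i = (\<Sum>j\<in>S. of_int (A i j) * v j)"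
    by metis
  define M where "M i j = (if i = j then [:- A i j, 1:] else [:- A i j:])" for i j
  have S': "insert j\<^sub>0 (S - {j\<^sub>0}) = S"
    using S by auto
  have "\<exists>f. Polynomial.lead_coeff f = 1 \<and> ipoly f x * v j\<^sub>0 = 0"
  proof (rule monic_annihilator[where T = "S - {j\<^sub>0}" and M = M and d = 1])
    fix i assume i: "i \<in> insert j\<^sub>0 (S - {j\<^sub>0})"
    have "ipoly (M i j) x * v j = (if i = j then x * v j else 0) - of_int (A i j) * v j" for j
      by (auto simp: M_def map_poly_pCons algebra_simps)
    then have "(\<Sum>j\<in>S. ipoly (M i j) x * v j) = x * v i - (\<Sum>j\<in>S. of_int (A i j) * v j)"
      using S i by (auto simp: sum_subtractf)
    with A[of i] i show "(\<Sum>j\<in>insert j\<^sub>0 (S - {j\<^sub>0}). ipoly (M i j) x * v j) = 0"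
      unfolding S' by simp
  qed (use S in \<open>auto simp: M_def\<close>)
  with S(3) show ?thesis
    unfolding algebraic_int_altdef_ipoly by auto
qed

lemma algebraic_int_powers:
  fixes x :: "'a::field_char_0"
  assumes "algebraic_int x"
  obtains n where "n > 0" "x ^ n \<in> zspan {..<n} (\<lambda>i. x ^ i)"
proof -
  from assms obtain f where f: "ipoly f x = 0" "Polynomial.lead_coeff f = 1"
    unfolding algebraic_int_altdef_ipoly by blast
  define n where "n = Polynomial.degree f"
  have "n > 0"
  proof (rule ccontr)
    assume "\<not> n > 0"
    then obtain c where "f = [:c:]"
      using degree_eq_zeroE[of f] by (auto simp: n_def)
    with f show False by (auto simp: map_poly_pCons)
  qed
  have "0 = (\<Sum>i\<le>n. of_int (Polynomial.coeff f i) * x ^ i)"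
    using f(1) ipoly_eq_sum[of f n x] by (simp add: n_def)
  also have "\<dots> = (\<Sum>i<n. of_int (Polynomial.coeff f i) * x ^ i) + x ^ n"
    using f(2) by (simp add: lessThan_Suc_atMost[symmetric] n_def)
  finally have "x ^ n = (\<Sum>i<n. of_int (- Polynomial.coeff f i) * x ^ i)"
    by (simp add: sum_negf eq_neg_iff_add_eq_0 add.commute)
  then show ?thesis
    by (intro that[OF \<open>n > 0\<close>] zspanI)
qed

text \<open>Multiplication by \<open>x\<close> only raises \<open>i\<close>; at i = n - 1 the
  integral equation folds \<open>x ^ n\<close> back into lower powers.\<close>

lemma zstable_product:
  fixes x y :: "'a::field_char_0"
  assumes "x ^ n \<in> zspan {..<n} (\<lambda>i. x ^ i)"
  shows "zstable ({..<n} \<times> {..<m}) (\<lambda>(i, j). x ^ i * y ^ j) x"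
  unfolding zstable_def
proof safe
  fix i j assume ij: "i < n" "j < m"
  let ?Z = "zspan ({..<n} \<times> {..<m}) (\<lambda>(i, j). x ^ i * y ^ j)"
  have base: "x ^ k * y ^ j \<in> ?Z" if "k < n" for k
    using zspan_base[of "{..<n} \<times> {..<m}" "(k, j)" "\<lambda>(i, j). x ^ i * y ^ j"] that ij by auto
  have "x ^ Suc i * y ^ j \<in> ?Z"
  proof (cases "Suc i < n")
    case False
    with ij have "Suc i = n" by auto
    from assms obtain A where "x ^ n = (\<Sum>k<n. of_int (A k) * x ^ k)"
      unfolding zspan_def by blast
    then have "x ^ Suc i * y ^ j = (\<Sum>k<n. of_int (A k) * (x ^ k * y ^ j))"
      using \<open>Suc i = n\<close> by (simp add: sum_distrib_right mult.assoc)
    also have "\<dots> \<in> ?Z"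
      using base by (intro zspan_sum) auto
    finally show ?thesis .
  qed (use base[of "Suc i"] in auto)
  then show "x * (x ^ i * y ^ j) \<in> ?Z"
    by (simp add: mult_ac)
qed

lemma zstable_cong_bij:
  assumes "bij_betw f S T" "\<And>i. i \<in> S \<Longrightarrow> v i = w (f i)" "zstable S v x"
  shows "zstable T w x"
proof -
  have "zspan S v \<subseteq> zspan T w"
  proof
    fix a assume "a \<in> zspan S v"
    then obtain A where a: "a = (\<Sum>j\<in>S. of_int (A j) * v j)"
      unfolding zspan_def by blast
    have "a = (\<Sum>j\<in>S. of_int (A (inv_into S f (f j))) * w (f j))"
      using assms unfolding a by (intro sum.cong) (auto simp: bij_betw_def)
    also have "\<dots> = (\<Sum>j\<in>T. of_int (A (inv_into S f j)) * w j)"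
      using sum.reindex_bij_betw[OF assms(1), of "\<lambda>j. of_int (A (inv_into S f j)) * w j"] by simp
    finally show "a \<in> zspan T w"
      by (rule zspanI)
  qed
  with assms show ?thesis
    unfolding zstable_def bij_betw_def by (auto 4 3)
qed

text \<open>The lattice spanned by the products x^i y^j is stable under \<open>x\<close> and under
  \<open>y\<close>, hence under their sum and product; its generator at the index (0, 0) is 1, which
  is nonzero.\<close>

lemma algebraic_int_add_mult:
  fixes x y :: "'a::field_char_0"
  assumes "algebraic_int x" "algebraic_int y"
  shows "algebraic_int (x + y)" "algebraic_int (x * y)"
proof -
  from assms obtain n m where
    n: "n > 0" "x ^ n \<in> zspan {..<n} (\<lambda>i. x ^ i)" and m: "m > 0" "y ^ m \<in> zspan {..<m} (\<lambda>i. y ^ i)"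
    by (metis algebraic_int_powers)
  let ?S = "{..<n} \<times> {..<m}" and ?v = "\<lambda>(i, j). x ^ i * y ^ j"
  have x: "zstable ?S ?v x"
    using n by (intro zstable_product)
  have y: "zstable ?S ?v y"
  proof (rule zstable_cong_bij)
    show "zstable ({..<m} \<times> {..<n}) (\<lambda>(i, j). y ^ i * x ^ j) y"
      using m by (intro zstable_product)
    show "bij_betw prod.swap ({..<m} \<times> {..<n}) ({..<n} \<times> {..<m})"
      by (auto simp: bij_betw_def)
  qed (auto simp: mult.commute)
  show "algebraic_int (x + y)"
    using n m by (intro algebraic_int_if_zstable[of ?S "(0, 0)" ?v]) (auto intro: zstable_add x y)
  show "algebraic_int (x * y)"
    using n m by (intro algebraic_int_if_zstable[of ?S "(0, 0)" ?v]) (auto intro: zstable_mult x y)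
qed

lemmas algebraic_int_add = algebraic_int_add_mult(1)
lemmas algebraic_int_mult = algebraic_int_add_mult(2)

lemma algebraic_int_diff:
  "algebraic_int x \<Longrightarrow> algebraic_int y \<Longrightarrow> algebraic_int (x - y :: 'a::field_char_0)"
  using algebraic_int_add[of x "- y"] by simp

lemma algebraic_int_power: "algebraic_int x \<Longrightarrow> algebraic_int (x ^ n :: 'a::field_char_0)"
  by (induction n) (simp_all add: algebraic_int_mult)

lemma algebraic_int_sum:
  "(\<And>i. i \<in> I \<Longrightarrow> algebraic_int (f i)) \<Longrightarrow> algebraic_int (sum f I :: 'a::field_char_0)"
  by (induction I rule: infinite_finite_induct) (simp_all add: algebraic_int_add)

lemma algebraic_int_prod:
  "(\<And>i. i \<in> I \<Longrightarrow> algebraic_int (f i)) \<Longrightarrow> algebraic_int (prod f I :: 'a::field_char_0)"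
  by (induction I rule: infinite_finite_induct) (simp_all add: algebraic_int_mult)

text \<open>The truncations of an integral equation \<open>f(x) = 0\<close> are integral although \<open>x\<close> need not be:
  multiplication by them preserves the lattice spanned by \<open>1, x, \<dots>, x\<^sup>d\<^sup>-\<^sup>1\<close>.\<close>

lemma algebraic_int_truncation:
  fixes x :: "'a::field_char_0"
  assumes f: "ipoly f x = 0" and d: "Polynomial.degree f = d" and k: "k < d"
  shows "algebraic_int (\<Sum>i\<le>k. of_int (Polynomial.coeff f (d - k + i)) * x ^ i)" (is "algebraic_int ?b")
proof (rule algebraic_int_if_zstable[of "{..<d}" 0 "\<lambda>i. x ^ i"])
  let ?a = "Polynomial.coeff f"
  \<comment> \<open>By f(x) = 0 the upper part of the equation is minus its lower part; products
    whose degree would reach \<open>d\<close> are folded back with this.\<close>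
  have split: "?b * x ^ (d - k) = - (\<Sum>i<d - k. of_int (?a i) * x ^ i)"
  proof -
    have "0 = (\<Sum>i\<le>d. of_int (?a i) * x ^ i)"
      using f ipoly_eq_sum[of f d x] d by simp
    also have "{..d} = {..<d - k} \<union> {d - k..d}"
      by auto
    also have "(\<Sum>i\<in>\<dots>. of_int (?a i) * x ^ i)
        = (\<Sum>i<d - k. of_int (?a i) * x ^ i) + (\<Sum>i=d - k..d. of_int (?a i) * x ^ i)"
      by (rule sum.union_disjoint) auto
    also have "(\<Sum>i=d - k..d. of_int (?a i) * x ^ i) = (\<Sum>i\<le>k. of_int (?a (d - k + i)) * x ^ (d - k + i))"
      using k by (intro sum.reindex_bij_witness[of _ "\<lambda>i. d - k + i" "\<lambda>i. i - (d - k)"]) auto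
    also have "\<dots> = ?b * x ^ (d - k)"
      unfolding sum_distrib_right by (intro sum.cong refl) (simp only: power_add mult_ac)
    finally show ?thesis
      by (simp add: eq_neg_iff_add_eq_0 add.commute)
  qed
  show "zstable {..<d} (\<lambda>i. x ^ i) ?b"
    unfolding zstable_def
  proof safe
    fix i assume i: "i < d"
    let ?Z = "zspan {..<d} (\<lambda>i. x ^ i)"
    have base: "x ^ l \<in> ?Z" if "l < d" for l
      using zspan_base[of "{..<d}" l "\<lambda>i. x ^ i"] that by auto
    show "?b * x ^ i \<in> ?Z"
    proof (cases "i + k < d")
      case True
      have "?b * x ^ i = (\<Sum>l\<le>k. of_int (?a (d - k + l)) * x ^ (l + i))"
        unfolding sum_distrib_right by (intro sum.cong refl) (simp only: power_add mult_ac)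
      also have "\<dots> \<in> ?Z"
        using True by (intro zspan_sum base) auto
      finally show ?thesis .
    next
      case False
      define e where "e = i - (d - k)"
      have e: "i = (d - k) + e"
        using False k by (simp add: e_def)
      have "?b * x ^ i = (?b * x ^ (d - k)) * x ^ e"
        unfolding mult.assoc[of ?b] power_add[symmetric] e[symmetric] by (rule refl)
      also have "\<dots> = (\<Sum>l<d - k. of_int (- ?a l) * x ^ (l + e))"
        unfolding split mult_minus_left of_int_minus sum_negf by (simp only: sum_distrib_right) (simp only: power_add mult_ac)
      also have "\<dots> \<in> ?Z"
        using i by (intro zspan_sum base) (simp add: e)
      finally show ?thesis .
    qed
  qed
qed (use k in auto)

section \<open>The valued field \<open>\<complex>\<^sub>p\<close>\<close>

lemma ring_of_type_algebra_simps [simp]: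
  "carrier ring_of_type_algebra = UNIV"
  "x \<otimes>\<^bsub>ring_of_type_algebra\<^esub> y = x * y"
  "x \<oplus>\<^bsub>ring_of_type_algebra\<^esub> y = x + y"
  "\<one>\<^bsub>ring_of_type_algebra\<^esub> = 1"
  "\<zero>\<^bsub>ring_of_type_algebra\<^esub> = 0"
  by (simp_all add: ring_of_type_algebra_def)

text \<open>The type class of C_p supplies a metric but no norm; the absolute value is read off as
  the distance from 0.\<close>

definition nm :: "'c::{zero,metric_space} \<Rightarrow> real" where
  "nm x = dist x 0"

locale padic_complex =
  fixes p :: nat and T :: "'c::{field_char_0, complete_space} itself"
  assumes prime_p: "Factorial_Ring.prime p" and padic: "padic_complex_field p T"
begin

section \<open>Arithmetic of the ultrametric absolute value\<close>

lemma dist_eq_nm: "dist x y = nm (x - y)" for x y :: 'c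
  using padic unfolding padic_complex_field_def nm_def by blast

lemma nm_mult: "nm (x * y) = nm x * nm y" for x y :: 'c
  using padic unfolding padic_complex_field_def nm_def by blast

lemma nm_add: "nm (x + y) \<le> max (nm x) (nm y)" for x y :: 'c
  using padic unfolding padic_complex_field_def nm_def by blast

lemma nm_p: "nm (of_nat p :: 'c) = 1 / real p"
  using padic unfolding padic_complex_field_def nm_def by blast

lemma nm_nonneg [simp]: "nm x \<ge> 0" for x :: 'c
  by (simp add: nm_def)

lemma nm_0 [simp]: "nm (0 :: 'c) = 0"
  by (simp add: nm_def)

lemma nm_eq_0 [simp]: "nm x = 0 \<longleftrightarrow> x = 0" for x :: 'c
  by (simp add: nm_def)

lemma nm_pos [simp]: "nm x > 0 \<longleftrightarrow> x \<noteq> 0" for x :: 'c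
  by (simp add: nm_def)

lemma nm_le_0 [simp]: "nm x \<le> 0 \<longleftrightarrow> x = 0" for x :: 'c
  by (simp add: nm_def)

lemma nm_1 [simp]: "nm (1 :: 'c) = 1"
  using nm_mult[of 1 1] nm_pos[of 1] by simp

lemma nm_power: "nm (x ^ n) = nm x ^ n" for x :: 'c
  by (induction n) (auto simp: nm_mult)

lemma nm_minus [simp]: "nm (- x) = nm x" for x :: 'c
proof -
  have "nm (- 1 :: 'c) ^ 2 = 1"
    unfolding nm_power[symmetric] by simp
  then have "nm (- 1 :: 'c) = 1"
    using nm_nonneg[of "- 1"] by (simp add: power2_eq_1_iff)
  then show ?thesis
    using nm_mult[of "- 1" x] by simp
qed

lemma nm_minus_commute: "nm (x - y) = nm (y - x)" for x y :: 'c
  using nm_minus[of "x - y"] by simp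

lemma nm_diff: "nm (x - y) \<le> max (nm x) (nm y)" for x y :: 'c
  using nm_add[of x "- y"] by simp

lemma nm_inverse: "nm (inverse x) = inverse (nm x)" for x :: 'c
proof (cases "x = 0")
  case False
  then have "nm x * nm (inverse x) = 1"
    unfolding nm_mult[symmetric] by simp
  then show ?thesis
    by (simp add: inverse_eq_divide eq_divide_eq mult.commute split: if_splits)
qed simp

lemma nm_divide: "nm (x / y) = nm x / nm y" for x y :: 'c
  by (simp add: divide_inverse nm_mult nm_inverse)

lemma nm_powi: "nm (x powi k) = nm x powi k" for x :: 'c
  by (simp add: power_int_def nm_power nm_inverse)

lemma nm_prod: "nm (prod f A :: 'c) = (\<Prod>i\<in>A. nm (f i))"
  by (induction A rule: infinite_finite_induct) (auto simp: nm_mult)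

lemma nm_sum_le:
  assumes "\<And>i. i \<in> A \<Longrightarrow> nm (f i :: 'c) \<le> B" "B \<ge> 0"
  shows "nm (sum f A) \<le> B"
  using assms(1)
proof (induction A rule: infinite_finite_induct)
  case (insert x A)
  then have "nm (f x) \<le> B" "nm (sum f A) \<le> B"
    by auto
  then show ?case
    using insert.hyps nm_add[of "f x" "sum f A"] by simp
qed (use assms(2) in auto)

lemma nm_sum_less:
  assumes "\<And>i. i \<in> A \<Longrightarrow> nm (f i :: 'c) < B" "B > 0"
  shows "nm (sum f A) < B"
  using assms(1)
proof (induction A rule: infinite_finite_induct)
  case (insert x A)
  then have "nm (f x) < B" "nm (sum f A) < B"
    by auto
  then show ?case
    using insert.hyps nm_add[of "f x" "sum f A"] by simp
qed (use assms(2) in auto)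

lemma nm_add_less: "nm x < B \<Longrightarrow> nm y < B \<Longrightarrow> nm (x + y) < B" for x y :: 'c
  using nm_add[of x y] by simp

lemma nm_diff_less: "nm x < B \<Longrightarrow> nm y < B \<Longrightarrow> nm (x - y) < B" for x y :: 'c
  using nm_diff[of x y] by simp

text \<open>Isosceles principle: \<open>x\<close> is the difference of \<open>x + y\<close> and
  \<open>y\<close>, and the latter is too small to account for its size.\<close>

lemma nm_add_eq: "nm y < nm x \<Longrightarrow> nm (x + y) = nm x" for x y :: 'c
  using nm_add[of x y] nm_diff[of "x + y" y] by simp

lemma nm_diff_eq: "nm (x - y) < nm x \<Longrightarrow> nm y = nm x" for x y :: 'c
  using nm_add_eq[of "y - x" x] by (simp add: nm_minus_commute)

lemma nm_of_nat_le: "nm (of_nat n :: 'c) \<le> 1"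
proof (induction n)
  case (Suc n)
  then show ?case
    using nm_add[of 1 "of_nat n"] by simp
qed simp

lemma nm_of_int_le: "nm (of_int n :: 'c) \<le> 1"
proof (cases "n \<ge> 0")
  case True
  then show ?thesis
    using nm_of_nat_le[of "nat n"] by simp
next
  case False
  then show ?thesis
    using nm_of_nat_le[of "nat (- n)"] nm_minus[of "of_int n"] by simp
qed

lemma p_gt_1: "p > 1"
  using prime_p by (rule prime_gt_1_nat)

lemma nm_p_less_1: "nm (of_nat p :: 'c) < 1"
  using p_gt_1 by (simp add: nm_p)

text \<open>If \<open>p\<close> does not divide \<open>n\<close>, a Bezout identity expresses 1
  through \<open>p\<close> and \<open>n\<close>; were both small, 1 would be small.\<close>

lemma nm_of_int_dvd: "int p dvd n \<longleftrightarrow> nm (of_int n :: 'c) < 1"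
proof
  assume "int p dvd n"
  then obtain m where m: "n = int p * m" ..
  have "nm (of_int n :: 'c) = nm (of_nat p :: 'c) * nm (of_int m :: 'c)"
    unfolding m by (simp add: nm_mult)
  also have "\<dots> \<le> nm (of_nat p :: 'c) * 1"
    using nm_of_int_le by (intro mult_left_mono) auto
  finally show "nm (of_int n :: 'c) < 1"
    using nm_p_less_1 by simp
next
  assume small: "nm (of_int n :: 'c) < 1"
  show "int p dvd n"
  proof (rule ccontr)
    assume "\<not> int p dvd n"
    then have "Rings.coprime (int p) n"
      using prime_p by (simp add: prime_imp_coprime)
    then obtain a b where ab: "a * int p + b * n = 1"
      using bezout_int[of "int p" n] by (auto simp: coprime_iff_gcd_eq_1)
    have "(1 :: 'c) = of_int (a * int p + b * n)"
      unfolding ab by simp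
    then have "1 = nm (of_int a * of_nat p + of_int b * of_int n :: 'c)"
      using nm_1 by simp
    also have "\<dots> \<le> max (nm (of_int a * of_nat p :: 'c)) (nm (of_int b * of_int n :: 'c))"
      by (rule nm_add)
    also have "\<dots> < 1"
    proof -
      have "nm (of_int a * of_nat p :: 'c) \<le> 1 * nm (of_nat p :: 'c)"
        unfolding nm_mult using nm_of_int_le by (intro mult_right_mono) auto
      moreover have "nm (of_int b * of_int n :: 'c) \<le> 1 * nm (of_int n :: 'c)"
        unfolding nm_mult using nm_of_int_le by (intro mult_right_mono) auto
      ultimately show ?thesis
        using nm_p_less_1 small by simp
    qed
    finally show False by simp
  qed
qed

lemma nm_of_int_eq_1: "\<not> int p dvd n \<Longrightarrow> nm (of_int n :: 'c) = 1"
  using nm_of_int_dvd[of n] nm_of_int_le[of n] by simp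

lemma nm_of_int_power_dvd: "int p ^ N dvd n \<Longrightarrow> nm (of_int n :: 'c) \<le> (1 / real p) ^ N"
proof -
  assume "int p ^ N dvd n"
  then obtain m where m: "n = int p ^ N * m" ..
  have "nm (of_int n :: 'c) = (1 / real p) ^ N * nm (of_int m :: 'c)"
    unfolding m by (simp add: nm_mult nm_power nm_p)
  also have "\<dots> \<le> (1 / real p) ^ N * 1"
    using nm_of_int_le by (intro mult_left_mono) auto
  finally show ?thesis
    by simp
qed

lemma nm_of_int_value: "n \<noteq> 0 \<Longrightarrow> \<exists>k::nat. nm (of_int n :: 'c) = (1 / real p) ^ k"
proof -
  assume "n \<noteq> 0"
  define k where "k = multiplicity (int p) n"
  obtain m where m: "n = int p ^ k * m" "\<not> int p dvd m"
    using multiplicity_decompose'[of n "int p"] \<open>n \<noteq> 0\<close> p_gt_1 unfolding k_def by auto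
  have "nm (of_int n :: 'c) = (1 / real p) ^ k"
    using nm_of_int_eq_1[OF m(2)] by (simp add: m(1) nm_mult nm_power nm_p)
  then show ?thesis ..
qed

lemma nm_of_rat_value:
  assumes "q \<noteq> 0" shows "\<exists>k::int. nm (of_rat q :: 'c) = real p powi k"
proof -
  obtain a b where ab: "q = of_int a / of_int b" "b \<noteq> 0"
    by (cases q) (auto simp: Fract_of_int_quotient)
  with assms have "a \<noteq> 0" by auto
  with ab(2) obtain k l :: nat where
    "nm (of_int a :: 'c) = (1 / real p) ^ k" "nm (of_int b :: 'c) = (1 / real p) ^ l"
    using nm_of_int_value by metis
  then have "nm (of_rat q :: 'c) = (1 / real p) ^ k / (1 / real p) ^ l"
    by (simp add: ab(1) of_rat_divide nm_divide)
  also have "\<dots> = real p powi (int l - int k)"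
    using p_gt_1 by (simp add: power_int_diff field_simps power_one_over)
  finally show ?thesis ..
qed

text \<open>In lowest terms the denominator \<open>b\<close> is prime to \<open>p\<close>, so it has
  an inverse \<open>u\<close> modulo p^N, and the residue of \<open>u * a\<close> modulo p^N
  approximates a / b.\<close>

lemma rat_approx_nat:
  assumes "nm (of_rat q :: 'c) \<le> 1"
  shows "\<exists>c. c < p ^ N \<and> nm (of_rat q - of_nat c :: 'c) \<le> (1 / real p) ^ N"
proof -
  obtain a b where ab: "q = of_int a / of_int b" "b > 0" "Rings.coprime a b"
    by (metis Rat_cases Fract_of_int_quotient)
  have qab: "of_rat q = (of_int a / of_int b :: 'c)"
    by (simp add: ab(1) of_rat_divide)
  have pb: "\<not> int p dvd b"
  proof
    assume b: "int p dvd b"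
    then have "\<not> int p dvd a"
      using ab(3) prime_p by (meson not_coprimeI not_prime_unit prime_nat_int_transfer)
    then have "nm (of_int a :: 'c) = 1"
      by (rule nm_of_int_eq_1)
    moreover have "nm (of_int b :: 'c) < 1"
      using b nm_of_int_dvd by blast
    ultimately have "nm (of_rat q :: 'c) > 1"
      using ab(2) by (simp add: qab nm_divide)
    with assms show False by simp
  qed
  then have "Rings.coprime (int p) b"
    using prime_p by (simp add: prime_imp_coprime)
  then have "Rings.coprime b (int p ^ N)"
    by (simp add: coprime_commute)
  then obtain u v where uv: "u * b + v * int p ^ N = 1"
    using bezout_int[of b "int p ^ N"] by (auto simp: coprime_iff_gcd_eq_1)
  define c where "c = nat (u * a mod int p ^ N)"
  have pN: "int p ^ N > 0"
    using p_gt_1 by simp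
  have c: "int c = u * a mod int p ^ N"
    using pN by (simp add: c_def)
  have "c < p ^ N"
    using pN c by (metis of_nat_less_iff of_nat_power pos_mod_bound)
  moreover have "nm (of_rat q - of_nat c :: 'c) \<le> (1 / real p) ^ N"
  proof -
    have "int p ^ N dvd u * a - int c"
      by (simp add: c mod_eq_dvd_iff[symmetric])
    moreover have "a - b * int c = b * (u * a - int c) + int p ^ N * (v * a)"
    proof -
      have "b * (u * a - int c) + int p ^ N * (v * a) = (u * b + v * int p ^ N) * a - b * int c"
        by (simp add: algebra_simps)
      then show ?thesis
        by (simp add: uv)
    qed
    ultimately have "int p ^ N dvd a - b * int c"
      by simp
    then have "nm (of_int (a - b * int c) :: 'c) \<le> (1 / real p) ^ N"
      by (rule nm_of_int_power_dvd)
    moreover have "of_rat q - of_nat c = (of_int (a - b * int c) / of_int b :: 'c)"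
      using ab(2) by (simp add: qab field_simps)
    ultimately show ?thesis
      using nm_of_int_eq_1[OF pb] by (simp add: nm_divide)
  qed
  ultimately show ?thesis
    by blast
qed

lemma rat_approx_digit:
  assumes "nm (of_rat q :: 'c) \<le> 1"
  shows "\<exists>c. c < p \<and> nm (of_rat q - of_nat c :: 'c) < 1"
proof -
  obtain c where "c < p ^ 1" "nm (of_rat q - of_nat c :: 'c) \<le> (1 / real p) ^ 1"
    using rat_approx_nat[OF assms] by blast
  then show ?thesis
    using nm_p_less_1 unfolding nm_p by (intro exI[of _ c]) (auto intro: le_less_trans)
qed

lemma closure_rat_approx:
  assumes "a \<in> closure (\<rat> :: 'c set)" "e > 0"
  obtains q where "nm (a - of_rat q) < e"
proof -
  from assms obtain y :: 'c where "y \<in> \<rat>" "dist y a < e"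
    unfolding closure_approachable by blast
  then obtain q where "y = of_rat q"
    by (auto elim: Rats_cases)
  with \<open>dist y a < e\<close> show ?thesis
    by (intro that[of q]) (simp add: dist_eq_nm nm_minus_commute)
qed

text \<open>The absolute value is locally constant away from 0, so passing from the rationals to
  their closure Q_p creates no new values.\<close>

lemma closure_rat_value:
  assumes "a \<in> closure (\<rat> :: 'c set)" "a \<noteq> 0"
  shows "\<exists>k::int. nm a = real p powi k"
proof -
  obtain q where q: "nm (a - of_rat q) < nm a"
    using assms closure_rat_approx[of a "nm a"] by auto
  then have "nm (of_rat q :: 'c) = nm a"
    by (rule nm_diff_eq)
  moreover from this have "q \<noteq> 0"
    using assms by auto
  ultimately show ?thesis
    using nm_of_rat_value[of q] by auto
qed

text \<open>\<open>padic_complex_field\<close> only asserts that a dense algebraic closure of Q_p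
  exists; one is fixed here.\<close>

definition L :: "'c set" where
  "L = (SOME L. algebraic_closure (ring_of_type_algebra\<lparr>carrier := L\<rparr>) (closure \<rat>) \<and> closure L = UNIV)"

lemma L: "algebraic_closure (ring_of_type_algebra\<lparr>carrier := L\<rparr>) (closure \<rat>)" "closure L = UNIV"
proof -
  have "\<exists>L::'c set. algebraic_closure (ring_of_type_algebra\<lparr>carrier := L\<rparr>) (closure \<rat>) \<and> closure L = UNIV"
    using padic unfolding padic_complex_field_def by blast
  from someI_ex[OF this]
  show "algebraic_closure (ring_of_type_algebra\<lparr>carrier := L\<rparr>) (closure \<rat>)" "closure L = UNIV"
    unfolding L_def by blast+
qed

abbreviation "RL \<equiv> (ring_of_type_algebra\<lparr>carrier := L\<rparr> :: 'c ring)"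

lemma RL_simps: "carrier RL = L" "x \<otimes>\<^bsub>RL\<^esub> y = x * y" "x \<oplus>\<^bsub>RL\<^esub> y = x + y" "\<one>\<^bsub>RL\<^esub> = 1" "\<zero>\<^bsub>RL\<^esub> = 0"
  by simp_all

lemma RL_pow: "x [^]\<^bsub>RL\<^esub> (n::nat) = x ^ n"
proof (induction n)
  case 0
  show ?case
    by (simp add: nat_pow_def RL_simps)
next
  case (Suc n)
  then show ?case
    by (simp add: nat_pow_def RL_simps)
qed

lemma L_mult: "x \<in> L \<Longrightarrow> y \<in> L \<Longrightarrow> x * y \<in> L"
proof -
  assume "x \<in> L" "y \<in> L"
  interpret A: algebraic_closure RL "closure \<rat>"
    by (rule L)
  show ?thesis
    using monoid.m_closed[OF A.is_monoid, of x y] \<open>x \<in> L\<close> \<open>y \<in> L\<close> by (simp add: RL_simps)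
qed

lemma L_power: "x \<in> L \<Longrightarrow> x ^ n \<in> L"
proof -
  assume "x \<in> L"
  interpret A: algebraic_closure RL "closure \<rat>"
    by (rule L)
  show ?thesis
    using A.nat_pow_closed[of x n] \<open>x \<in> L\<close> by (simp add: RL_simps RL_pow)
qed

lemma L_rat: "of_rat q \<in> L"
proof -
  interpret A: algebraic_closure RL "closure \<rat>"
    by (rule L)
  have "(of_rat q :: 'c) \<in> closure \<rat>"
    using closure_subset[of "\<rat> :: 'c set"] by auto
  then show ?thesis
    using A.subset by (auto simp: RL_simps)
qed

lemma L_algebraic:
  assumes "x \<in> L"
  obtains n a where "\<And>i. i \<le> n \<Longrightarrow> a i \<in> closure \<rat>" "\<exists>i\<le>n. a i \<noteq> 0" "(\<Sum>i\<le>n. a i * x ^ i) = 0"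
proof -
  interpret A: algebraic_closure RL "closure \<rat>"
    by (rule L)
  have "(A.algebraic over (closure \<rat>)) x"
    using assms by (intro A.algebraic_extension) (simp add: RL_simps)
  then obtain f where f: "f \<in> carrier ((closure \<rat>)[X]\<^bsub>RL\<^esub>)" "f \<noteq> []" "A.eval f x = \<zero>\<^bsub>RL\<^esub>"
    using A.algebraicE[of "closure \<rat>" x] assms A.subring_axioms by (auto simp: RL_simps)
  \<comment> \<open>Polynomials over \<open>RL\<close> are coefficient lists with the leading
    coefficient first, so the coefficient of x^i sits at position i of the reversed list.\<close>
  have eval: "A.eval g x = (\<Sum>i<length g. rev g ! i * x ^ i)" for g
  proof (induction g)
    case (Cons c g)
    have "A.eval (c # g) x = c * x ^ length g + A.eval g x"
      by (simp add: RL_simps RL_pow)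
    also have "\<dots> = (\<Sum>i<length g. rev (c # g) ! i * x ^ i) + rev (c # g) ! length g * x ^ length g"
      by (simp add: Cons.IH nth_append)
    finally show ?case
      by simp
  qed (simp add: RL_simps)
  define n where "n = length f - 1"
  have len: "{..<length f} = {..n}"
    using f(2) by (cases f) (auto simp: n_def)
  have poly: "set f \<subseteq> closure \<rat>" "hd f \<noteq> 0"
    using f(1,2) by (auto simp: univ_poly_def polynomial_def RL_simps)
  show ?thesis
  proof (rule that)
    show "(\<Sum>i\<le>n. rev f ! i * x ^ i) = 0"
      using eval[of f] f(3) len by (simp add: RL_simps)
    have "rev f ! n = hd f"
      using f(2) by (simp add: n_def rev_nth hd_conv_nth)
    then show "\<exists>i\<le>n. rev f ! i \<noteq> 0"
      using poly by auto
    fix i assume "i \<le> n"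
    then have "rev f ! i \<in> set f"
      using len by (metis atMost_iff length_rev lessThan_iff nth_mem set_rev)
    then show "rev f ! i \<in> closure \<rat>"
      using poly by auto
  qed
qed

text \<open>A unique largest term could not be cancelled by the remaining ones. This is the Newton
  polygon argument in its simplest form.\<close>

lemma vanishing_sum_two_maximal:
  assumes "finite A" "sum f A = (0 :: 'c)" "i\<^sub>0 \<in> A" "f i\<^sub>0 \<noteq> 0"
  obtains i j where "i \<in> A" "j \<in> A" "i \<noteq> j" "f i \<noteq> 0" "nm (f i) = nm (f j)"
proof -
  have "Max ((\<lambda>i. nm (f i)) ` A) \<in> (\<lambda>i. nm (f i)) ` A"
    using assms by (intro Max_in) auto
  then obtain i where i: "i \<in> A" "nm (f i) = Max ((\<lambda>i. nm (f i)) ` A)"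
    by force
  have max: "nm (f j) \<le> nm (f i)" if "j \<in> A" for j
    using that assms(1) by (simp add: i(2))
  then have nz: "f i \<noteq> 0"
    using assms(3,4) by fastforce
  have "\<exists>j\<in>A - {i}. nm (f j) = nm (f i)"
  proof (rule ccontr)
    assume "\<not> ?thesis"
    then have "nm (sum f (A - {i})) < nm (f i)"
      using max nz by (intro nm_sum_less) (auto simp: less_le)
    moreover have "sum f (A - {i}) = - f i"
      using assms(1,2) i(1) by (simp add: sum_diff1)
    ultimately show False
      by simp
  qed
  then obtain j where "j \<in> A" "j \<noteq> i" "nm (f j) = nm (f i)"
    by auto
  then show ?thesis
    using that[of i j] i(1) nz by simp
qed

text \<open>In an algebraic equation for \<open>x\<close> over Q_p two terms have the same size, so
  |x|^(j - i) is a quotient of absolute values of coefficients.\<close>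

lemma L_value:
  assumes "x \<in> L" "x \<noteq> 0"
  shows "\<exists>b>0. \<exists>k::int. nm x ^ b = real p powi k"
proof -
  obtain n a where a: "\<And>i. i \<le> n \<Longrightarrow> a i \<in> closure \<rat>" "\<exists>i\<le>n. a i \<noteq> 0" "(\<Sum>i\<le>n. a i * x ^ i) = 0"
    using assms L_algebraic by blast
  then obtain i\<^sub>0 where "i\<^sub>0 \<in> {..n}" "a i\<^sub>0 * x ^ i\<^sub>0 \<noteq> 0"
    using assms by auto
  then obtain i j where "i \<le> n" "j \<le> n" "i \<noteq> j" "a i * x ^ i \<noteq> 0" "nm (a i * x ^ i) = nm (a j * x ^ j)"
    using vanishing_sum_two_maximal[of "{..n}" "\<lambda>i. a i * x ^ i"] a(3) by auto
  then obtain i j where ij: "i \<le> n" "j \<le> n" "i < j" "a i * x ^ i \<noteq> 0" "a j * x ^ j \<noteq> 0"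
    "nm (a i * x ^ i) = nm (a j * x ^ j)"
  proof (cases "i < j")
    case False
    with \<open>i \<noteq> j\<close> have "j < i" by simp
    then show ?thesis
      using that[of j i] \<open>i \<le> n\<close> \<open>j \<le> n\<close> \<open>a i * x ^ i \<noteq> 0\<close> \<open>nm _ = _\<close> nm_eq_0 by metis
  qed (metis nm_eq_0 that)
  obtain k l where kl: "nm (a i) = real p powi k" "nm (a j) = real p powi l"
    using a(1) ij closure_rat_value by (metis mult_zero_left)
  have "nm x ^ (j - i) = real p powi (k - l)"
  proof -
    have "nm (a i) * nm x ^ i = nm (a j) * nm x ^ (j - i) * nm x ^ i"
      using ij(3,6) by (simp add: nm_mult nm_power mult.assoc flip: power_add)
    then have "nm (a i) = nm (a j) * nm x ^ (j - i)"
      using assms by simp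
    then show ?thesis
      using p_gt_1 by (simp add: kl power_int_diff field_simps)
  qed
  then show ?thesis
    using ij(3) by (metis zero_less_diff)
qed

text \<open>The residue field of the algebraic closure is algebraic over the field with p elements,
  so the residue of \<open>z\<close> has finite multiplicative order. The argument is carried out on
  representatives: an equation for \<open>z\<close> is reduced to digits below \<open>p\<close>, the
  powers of \<open>z\<close> then fall into finitely many residue classes, and two of them share a
  class.\<close>

lemma L_unit_power:
  assumes "z \<in> L" "nm z = 1"
  shows "\<exists>m>0. nm (z ^ m - 1) < 1"
proof -
  obtain n a where a: "\<And>i. i \<le> n \<Longrightarrow> a i \<in> closure \<rat>" "\<exists>i\<le>n. a i \<noteq> 0" "(\<Sum>i\<le>n. a i * z ^ i) = 0"
    using assms L_algebraic by blast
  \<comment> \<open>A coefficient of maximal absolute value is singled out; dividing by it makes all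
    coefficients integral and this one a unit.\<close>
  have "Max ((\<lambda>i. nm (a i)) ` {..n}) \<in> (\<lambda>i. nm (a i)) ` {..n}"
    by (intro Max_in) auto
  then obtain l where l: "l \<le> n" "nm (a l) = Max ((\<lambda>i. nm (a i)) ` {..n})"
    by force
  have max: "nm (a i) \<le> nm (a l)" if "i \<le> n" for i
    using that by (simp add: l(2))
  obtain i where "i \<le> n" "a i \<noteq> 0"
    using a(2) by blast
  then have "nm (a l) > 0"
    using max[of i] nm_pos[of "a i"] by linarith
  have "\<exists>q. nm (a i - of_rat q) < nm (a l)" if "i \<le> n" for i
    using closure_rat_approx[OF a(1)[OF that] \<open>nm (a l) > 0\<close>] by blast
  then obtain q where q: "\<And>i. i \<le> n \<Longrightarrow> nm (a i - of_rat (q i)) < nm (a l)"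
    by metis
  have ql: "nm (of_rat (q l) :: 'c) = nm (a l)"
    using nm_diff_eq[OF q[OF l(1)]] .
  have q_le: "nm (of_rat (q i) :: 'c) \<le> nm (a l)" if "i \<le> n" for i
    using nm_diff[of "a i" "a i - of_rat (q i)"] q[OF that] max[OF that] by simp
  have "\<exists>c. c < p \<and> nm (of_rat (q i / q l) - of_nat c :: 'c) < 1" if "i \<le> n" for i
    using q_le[OF that] \<open>nm (a l) > 0\<close>
    by (intro rat_approx_digit) (simp add: of_rat_divide nm_divide ql divide_le_eq)
  then obtain c where c: "\<And>i. i \<le> n \<Longrightarrow> c i < p \<and> nm (of_rat (q i / q l) - of_nat (c i) :: 'c) < 1"
    by metis
  have ql0: "(of_rat (q l) :: 'c) \<noteq> 0"
    using ql \<open>nm (a l) > 0\<close> nm_eq_0 by (metis less_irrefl)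
  \<comment> \<open>At \<open>l\<close> the quotient is 1, which is not close to 0; so the reduced
    equation is nontrivial.\<close>
  have cl: "c l \<noteq> 0"
  proof
    assume "c l = 0"
    then show False
      using c[OF l(1)] ql0 by (simp add: of_rat_divide)
  qed
  have zi: "nm (z ^ i) = 1" for i
    by (simp add: nm_power assms)
  have small: "nm (\<Sum>i\<le>n. of_nat (c i) * z ^ i) < 1"
  proof -
    have "(\<Sum>i\<le>n. of_nat (c i) * z ^ i) = (\<Sum>i\<le>n. of_rat (q i / q l) * z ^ i)
        - (\<Sum>i\<le>n. (of_rat (q i / q l) - of_nat (c i)) * z ^ i)"
      by (simp add: sum_subtractf algebra_simps)
    moreover have "nm (\<Sum>i\<le>n. (of_rat (q i / q l) - of_nat (c i)) * z ^ i) < 1"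
      using c by (intro nm_sum_less) (auto simp: nm_mult zi)
    moreover have "(\<Sum>i\<le>n. of_rat (q i / q l) * z ^ i) = - (\<Sum>i\<le>n. (a i - of_rat (q i)) * z ^ i) / of_rat (q l)"
      using a(3) by (simp add: algebra_simps sum_subtractf sum_divide_distrib of_rat_divide)
    moreover have "nm (\<Sum>i\<le>n. (a i - of_rat (q i)) * z ^ i) < nm (a l)"
      using q \<open>nm (a l) > 0\<close> by (intro nm_sum_less) (auto simp: nm_mult zi)
    then have "nm (- (\<Sum>i\<le>n. (a i - of_rat (q i)) * z ^ i) / of_rat (q l)) < 1"
      using \<open>nm (a l) > 0\<close> by (simp add: nm_divide ql)
    ultimately show ?thesis
      by (simp add: nm_diff_less)
  qed
  \<comment> \<open>The degree of the equation after reduction modulo \<open>p\<close>, which may be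
    smaller than \<open>n\<close>.\<close>
  define d where "d = Max {i. i \<le> n \<and> c i \<noteq> 0}"
  have fin: "finite {i. i \<le> n \<and> c i \<noteq> 0}"
    by simp
  have "d \<in> {i. i \<le> n \<and> c i \<noteq> 0}"
    unfolding d_def using l(1) cl by (intro Max_in) auto
  then have d: "d \<le> n" "c d \<noteq> 0"
    by auto
  have above: "c i = 0" if "d < i" "i \<le> n" for i
    using that Max_ge[OF fin, of i] unfolding d_def[symmetric] by (cases "c i = 0") auto
  have sum_d: "(\<Sum>i\<le>n. of_nat (c i) * z ^ i) = (\<Sum>i<d. of_nat (c i) * z ^ i) + of_nat (c d) * z ^ d"
  proof -
    have "(\<Sum>i\<le>n. of_nat (c i) * z ^ i) = (\<Sum>i\<le>d. of_nat (c i) * z ^ i)"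
      using d above by (intro sum.mono_neutral_right) auto
    then show ?thesis
      by (simp add: lessThan_Suc_atMost[symmetric])
  qed
  have ncd: "nm (of_nat (c d) :: 'c) = 1"
  proof -
    have "\<not> int p dvd int (c d)"
      using d c by (simp add: nat_dvd_not_less)
    then show ?thesis
      using nm_of_int_eq_1[of "int (c d)"] by simp
  qed
  \<comment> \<open>Representatives for the residues of all integral polynomial expressions in
    \<open>z\<close> of degree below \<open>d\<close>; there are finitely many since each
    coefficient is a digit.\<close>
  define R where "R = (\<lambda>e. \<Sum>i<d. of_nat (e i) * z ^ i) ` (PiE {..<d} (\<lambda>_. {..<p}))"
  have finR: "finite R"
    unfolding R_def by (intro finite_imageI finite_PiE) auto
  have R_approx: "\<exists>r\<in>R. nm ((\<Sum>i<d. of_rat (f i) * z ^ i) - r) < 1" if f: "\<And>i. i < d \<Longrightarrow> nm (of_rat (f i) :: 'c) \<le> 1" for f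
  proof -
    have "\<exists>e. e < p \<and> nm (of_rat (f i) - of_nat e :: 'c) < 1" if "i < d" for i
      using f[OF that] by (rule rat_approx_digit)
    then obtain e where e: "\<And>i. i < d \<Longrightarrow> e i < p \<and> nm (of_rat (f i) - of_nat (e i) :: 'c) < 1"
      by metis
    define e' where "e' = restrict e {..<d}"
    have "e' \<in> PiE {..<d} (\<lambda>_. {..<p})"
      unfolding e'_def using e by (simp add: restrict_PiE_iff)
    then have inR: "(\<Sum>i<d. of_nat (e' i) * z ^ i) \<in> R"
      unfolding R_def by (rule imageI)
    have "(\<Sum>i<d. of_rat (f i) * z ^ i) - (\<Sum>i<d. of_nat (e' i) * z ^ i)
        = (\<Sum>i<d. (of_rat (f i) - of_nat (e i)) * z ^ i)"
      by (simp add: e'_def sum_subtractf algebra_simps)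
    moreover have "nm (\<Sum>i<d. (of_rat (f i) - of_nat (e i)) * z ^ i) < 1"
      using e by (intro nm_sum_less) (auto simp: nm_mult zi)
    ultimately have "nm ((\<Sum>i<d. of_rat (f i) * z ^ i) - (\<Sum>i<d. of_nat (e' i) * z ^ i)) < 1"
      by (simp only:)
    with inR show ?thesis
      by (rule rev_bexI)
  qed
  have reduce: "\<exists>r\<in>R. nm (z ^ k - r) < 1" for k
  proof (induction k)
    case 0
    show ?case
    proof (cases "d = 0")
      case True
      with sum_d small ncd show ?thesis
        by simp
    next
      case False
      have "(\<Sum>i<d. of_rat (if i = 0 then 1 else 0) * z ^ i) = (\<Sum>i<d. if i = 0 then 1 else 0 :: 'c)"
        by (intro sum.cong) auto
      also have "\<dots> = 1"
        using False by simp
      finally show ?thesis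
        using R_approx[of "\<lambda>i. if i = 0 then 1 else 0"] by auto
    qed
  next
    case (Suc k)
    then obtain r where r: "r \<in> R" "nm (z ^ k - r) < 1"
      by blast
    then obtain e where e: "e \<in> PiE {..<d} (\<lambda>_. {..<p})" "r = (\<Sum>i<d. of_nat (e i) * z ^ i)"
      unfolding R_def by blast
    show ?case
    proof (cases d)
      case 0
      with sum_d small ncd show ?thesis
        by simp
    next
      case (Suc d')
      let ?S = "(\<Sum>i\<le>n. of_nat (c i) * z ^ i)"
      \<comment> \<open>Polynomial division by the reduced equation: \<open>u\<close> is the top
        digit over the leading coefficient \<open>c d\<close>, and subtracting \<open>u\<close>
        times the equation from the shifted expression leaves the integral coefficients
        \<open>f\<close> in degrees below \<open>d\<close>.\<close>
      define u where "u = rat_of_nat (e d') / rat_of_nat (c d)"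
      define f where "f i = (if i = 0 then 0 else rat_of_nat (e (i - 1))) - u * rat_of_nat (c i)" for i
      have u1: "nm (of_rat u :: 'c) \<le> 1"
        using nm_of_nat_le[of "e d'"] by (simp add: u_def of_rat_divide nm_divide ncd)
      have "nm (of_rat (f i) :: 'c) \<le> 1" for i
      proof -
        have "nm (of_rat u * of_nat (c i) :: 'c) \<le> 1 * 1"
          unfolding nm_mult using u1 nm_of_nat_le by (intro mult_mono) auto
        moreover have "nm (of_rat (if i = 0 then 0 else rat_of_nat (e (i - 1))) :: 'c) \<le> 1"
          using nm_of_nat_le by auto
        ultimately show ?thesis
          using nm_diff[of "of_rat (if i = 0 then 0 else rat_of_nat (e (i - 1)))" "of_rat u * of_nat (c i) :: 'c"]
          by (simp add: f_def of_rat_diff of_rat_mult)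
      qed
      then obtain r' where r': "r' \<in> R" "nm ((\<Sum>i<d. of_rat (f i) * z ^ i) - r') < 1"
        using R_approx[of f] by blast
      have cd: "(of_nat (c d) :: 'c) \<noteq> 0"
        using d by simp
      have shift: "z * r = (\<Sum>i<d. of_rat (if i = 0 then 0 else rat_of_nat (e (i - 1))) * z ^ i) + of_nat (e d') * z ^ d"
      proof -
        have "z * r = (\<Sum>i<d. of_nat (e i) * z ^ Suc i)"
          by (simp add: e(2) sum_distrib_left mult_ac)
        also have "\<dots> = (\<Sum>i<Suc d. of_rat (if i = 0 then 0 else rat_of_nat (e (i - 1))) * z ^ i)"
          by (subst sum.lessThan_Suc_shift) simp
        finally show ?thesis
          by (simp add: Suc)
      qed
      have "z * r = (\<Sum>i<d. of_rat (f i) * z ^ i) + of_rat u * ?S"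
      proof -
        have "of_rat u * ?S = (\<Sum>i<d. of_rat (u * rat_of_nat (c i)) * z ^ i) + of_nat (e d') * z ^ d"
          unfolding sum_d using cd
          by (simp add: u_def of_rat_divide of_rat_mult distrib_left sum_distrib_left mult.assoc)
        moreover have "(\<Sum>i<d. of_rat (f i) * z ^ i) = (\<Sum>i<d. of_rat (if i = 0 then 0 else rat_of_nat (e (i - 1))) * z ^ i)
            - (\<Sum>i<d. of_rat (u * rat_of_nat (c i)) * z ^ i)"
          unfolding sum_subtractf[symmetric] by (intro sum.cong) (auto simp: f_def of_rat_diff algebra_simps)
        ultimately show ?thesis
          unfolding shift by simp
      qed
      then have eq: "z ^ Suc k - r' = z * (z ^ k - r) + ((\<Sum>i<d. of_rat (f i) * z ^ i) - r') + of_rat u * ?S"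
        by (simp add: algebra_simps)
      have "nm (z * (z ^ k - r)) < 1"
        using r by (simp add: nm_mult assms)
      moreover have "nm (of_rat u * ?S) < 1"
        unfolding nm_mult using u1 small mult_right_mono[OF u1, of "nm ?S"] by simp
      ultimately have "nm (z ^ Suc k - r') < 1"
        unfolding eq using r'(2) by (intro nm_add_less)
      with r'(1) show ?thesis
        by blast
    qed
  qed
  then obtain g where g: "\<And>k. g k \<in> R \<and> nm (z ^ k - g k) < 1"
    by metis
  \<comment> \<open>Pigeonhole: finitely many representatives for infinitely many exponents.\<close>
  have "\<not> inj g"
    using finR g by (metis finite_imageD finite_subset image_subsetI infinite_UNIV_nat)
  then obtain i j where ij: "g i = g j" "i < j"
    by (metis injI linorder_neqE_nat)
  have "nm ((z ^ j - g j) - (z ^ i - g i)) < 1"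
    using g by (simp add: nm_diff_less)
  moreover have "(z ^ j - g j) - (z ^ i - g i) = z ^ i * (z ^ (j - i) - 1)"
  proof -
    have "z ^ j = z ^ i * z ^ (j - i)"
      using ij(2) by (simp flip: power_add)
    then show ?thesis
      using ij(1) by (simp add: algebra_simps)
  qed
  ultimately have "nm (z ^ i * (z ^ (j - i) - 1)) < 1"
    by (simp only:)
  then show ?thesis
    using ij(2) by (intro exI[of _ "j - i"]) (simp add: nm_mult zi)
qed

section \<open>Principal units of C_p\<close>

lemma nm_power_close:
  fixes x :: 'c
  assumes "nm (x - 1) < 1" shows "nm (x ^ n - 1) < 1"
proof (induction n)
  case (Suc n)
  have "nm x = 1"
    using nm_diff_eq[of 1 x] assms by (simp add: nm_minus_commute)
  then have "nm (x * (x ^ n - 1)) < 1"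
    using Suc by (simp add: nm_mult)
  moreover have "x ^ Suc n - 1 = x * (x ^ n - 1) + (x - 1)"
    by (simp add: algebra_simps)
  ultimately show ?case
    using assms by (simp only: nm_add_less)
qed simp

lemma nm_mult_close:
  fixes x y :: 'c
  assumes "nm (x - 1) < 1" "nm (y - 1) < 1" shows "nm (x * y - 1) < 1"
proof -
  have "nm x = 1"
    using nm_diff_eq[of 1 x] assms by (simp add: nm_minus_commute)
  then have "nm (x * (y - 1)) < 1"
    using assms by (simp add: nm_mult)
  moreover have "x * y - 1 = x * (y - 1) + (x - 1)"
    by (simp add: algebra_simps)
  ultimately show ?thesis
    using assms by (simp only: nm_add_less)
qed

lemma nm_close_1: "nm (x - 1) < 1 \<Longrightarrow> nm x = 1" for x :: 'c
  using nm_diff_eq[of 1 x] by (simp add: nm_minus_commute)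

text \<open>By density \<open>x\<close> may be replaced by an algebraic \<open>y\<close> such that
  \<open>x / y\<close> is a principal unit. Some power of \<open>y\<close> has the absolute value of
  a power of \<open>p\<close>; once that is divided out, a further power makes the residue equal to
  1.\<close>

lemma ex_power_close:
  assumes "x \<noteq> (0 :: 'c)"
  obtains m k where "m > 0" "nm (x ^ m * of_nat p powi k - 1) < 1"
proof -
  obtain y where y: "y \<in> L" "nm (x - y) < nm x"
  proof -
    have "x \<in> closure L"
      using L(2) by simp
    then obtain y where "y \<in> L" "dist y x < nm x"
      unfolding closure_approachable using assms by (metis nm_pos)
    then show ?thesis
      using that by (simp add: dist_eq_nm nm_minus_commute)
  qed
  have ny: "nm y = nm x" "y \<noteq> 0"
    using nm_diff_eq[OF y(2)] assms by auto
  obtain b k where b: "b > 0" "nm y ^ b = real p powi k"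
    using L_value[OF y(1) ny(2)] by blast
  define z where "z = y ^ b * of_nat p powi k"
  have pk: "(of_nat p :: 'c) powi k = of_rat (of_nat p powi k)"
    by (simp add: power_int_def of_rat_power of_rat_inverse)
  have "z \<in> L"
    unfolding z_def pk using y(1) by (intro L_mult L_power L_rat)
  moreover have "nm z = 1"
    using p_gt_1 by (simp add: z_def nm_mult nm_power nm_powi b(2) nm_p power_int_one_over)
  ultimately obtain m where m: "m > 0" "nm (z ^ m - 1) < 1"
    using L_unit_power by blast
  have "x / y - 1 = (x - y) / y"
    using ny by (simp add: field_simps)
  then have "nm (x / y - 1) < 1"
    using y(2) ny assms by (simp add: nm_divide)
  then have "nm ((x / y) ^ (b * m) * z ^ m - 1) < 1"
    using m(2) nm_power_close by (intro nm_mult_close) auto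
  moreover have "(x / y) ^ (b * m) * z ^ m = x ^ (b * m) * of_nat p powi (k * int m)"
  proof -
    have "z ^ m = y ^ (b * m) * of_nat p powi (k * int m)"
      by (simp add: z_def power_mult_distrib power_mult power_int_mult)
    then show ?thesis
      using ny(2) by (simp add: power_divide)
  qed
  ultimately show ?thesis
    using that[of "b * m" "k * int m"] b(1) m(1) by simp
qed

end

context padic_complex
begin

section \<open>The p-adic logarithm\<close>

lemma tendsto_iff_nm: "(f \<longlongrightarrow> l) F \<longleftrightarrow> ((\<lambda>n. nm (f n - l)) \<longlongrightarrow> 0) F" for l :: 'c
  using tendsto_dist_iff[of f l F] by (simp add: dist_eq_nm)

lemma tendsto_nm: "(f \<longlongrightarrow> l) F \<Longrightarrow> ((\<lambda>n. nm (f n)) \<longlongrightarrow> nm l) F" for l :: 'c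
  unfolding nm_def by (intro tendsto_dist tendsto_const)

text \<open>As a type \<open>'c\<close> is a field and a metric space without any link between the
  two, so continuity of the field operations is derived from the laws of the absolute value.\<close>

lemma tendsto_add_nm:
  fixes a b :: 'c
  assumes "(f \<longlongrightarrow> a) F" "(g \<longlongrightarrow> b) F"
  shows "((\<lambda>n. f n + g n) \<longlongrightarrow> a + b) F"
  unfolding tendsto_iff_nm
proof (rule tendsto_sandwich[OF _ _ tendsto_const])
  show "((\<lambda>n. nm (f n - a) + nm (g n - b)) \<longlongrightarrow> 0) F"
    using assms unfolding tendsto_iff_nm by (rule tendsto_add_zero)
  have "nm (f n + g n - (a + b)) \<le> nm (f n - a) + nm (g n - b)" for n
  proof -
    have "nm ((f n - a) + (g n - b)) \<le> nm (f n - a) + nm (g n - b)"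
      using nm_add[of "f n - a" "g n - b"] nm_nonneg[of "f n - a"] nm_nonneg[of "g n - b"] by linarith
    then show ?thesis
      by (simp add: algebra_simps)
  qed
  then show "\<forall>\<^sub>F n in F. nm (f n + g n - (a + b)) \<le> nm (f n - a) + nm (g n - b)"
    by simp
qed simp

lemma tendsto_mult_nm:
  fixes a b :: 'c
  assumes "(f \<longlongrightarrow> a) F" "(g \<longlongrightarrow> b) F"
  shows "((\<lambda>n. f n * g n) \<longlongrightarrow> a * b) F"
  unfolding tendsto_iff_nm
proof (rule tendsto_sandwich[OF _ _ tendsto_const])
  have f: "((\<lambda>n. nm (f n - a)) \<longlongrightarrow> 0) F" and g: "((\<lambda>n. nm (g n - b)) \<longlongrightarrow> 0) F"
    using assms unfolding tendsto_iff_nm by auto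
  have "((\<lambda>n. nm (f n) * nm (g n - b) + nm b * nm (f n - a)) \<longlongrightarrow> nm a * 0 + nm b * 0) F"
    by (intro tendsto_add tendsto_mult tendsto_const f g tendsto_nm assms)
  then show "((\<lambda>n. nm (f n) * nm (g n - b) + nm b * nm (f n - a)) \<longlongrightarrow> 0) F"
    by simp
  have "nm (f n * g n - a * b) \<le> nm (f n) * nm (g n - b) + nm b * nm (f n - a)" for n
  proof -
    have "f n * g n - a * b = f n * (g n - b) + b * (f n - a)"
      by (simp add: algebra_simps)
    then have "nm (f n * g n - a * b) \<le> max (nm (f n) * nm (g n - b)) (nm b * nm (f n - a))"
      using nm_add[of "f n * (g n - b)" "b * (f n - a)"] by (simp only: nm_mult)
    also have "\<dots> \<le> nm (f n) * nm (g n - b) + nm b * nm (f n - a)"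
      by simp
    finally show ?thesis .
  qed
  then show "\<forall>\<^sub>F n in F. nm (f n * g n - a * b) \<le> nm (f n) * nm (g n - b) + nm b * nm (f n - a)"
    by simp
qed simp

lemma tendsto_sum_nm:
  "(\<And>i. i \<in> A \<Longrightarrow> (f i \<longlongrightarrow> (a i :: 'c)) F) \<Longrightarrow> ((\<lambda>n. \<Sum>i\<in>A. f i n) \<longlongrightarrow> (\<Sum>i\<in>A. a i)) F"
  by (induction A rule: infinite_finite_induct) (auto intro: tendsto_add_nm)

lemma tendsto_prod_nm:
  "(\<And>i. i \<in> A \<Longrightarrow> (f i \<longlongrightarrow> (a i :: 'c)) F) \<Longrightarrow> ((\<lambda>n. \<Prod>i\<in>A. f i n) \<longlongrightarrow> (\<Prod>i\<in>A. a i)) F"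
  by (induction A rule: infinite_finite_induct) (auto intro: tendsto_mult_nm)

lemma tendsto_diff_nm:
  fixes a b :: 'c
  assumes "(f \<longlongrightarrow> a) F" "(g \<longlongrightarrow> b) F"
  shows "((\<lambda>n. f n - g n) \<longlongrightarrow> a - b) F"
  using tendsto_add_nm[OF assms(1) tendsto_mult_nm[OF tendsto_const assms(2), of "- 1"]] by simp

lemma nm_limit_le:
  fixes l :: 'c
  assumes "f \<longlonglongrightarrow> l" "\<And>n. n \<ge> N \<Longrightarrow> nm (f n) \<le> B"
  shows "nm l \<le> B"
  using assms(2) by (intro LIMSEQ_le_const2[OF tendsto_nm[OF assms(1)]]) auto

text \<open>Any block of terms is bounded by its largest member, so the partial sums are
  Cauchy.\<close>

lemma summable_if_nm_tendsto_0:
  fixes f :: "nat \<Rightarrow> 'c"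
  assumes "(\<lambda>n. nm (f n)) \<longlonglongrightarrow> 0"
  shows "summable f"
proof -
  have "Cauchy (\<lambda>n. sum f {..<n})"
  proof (rule metric_CauchyI)
    fix e :: real assume "e > 0"
    then obtain N where N: "\<And>n. n \<ge> N \<Longrightarrow> nm (f n) < e"
      using order_tendstoD(2)[OF assms] unfolding eventually_sequentially by metis
    have *: "dist (sum f {..<n}) (sum f {..<m}) < e" if "N \<le> m" "m \<le> n" for m n
    proof -
      have "{..<n} = {..<m} \<union> {m..<n}"
        using that by auto
      then have "sum f {..<n} = sum f {..<m} + sum f {m..<n}"
        by (simp add: sum.union_disjoint ivl_disj_int)
      moreover have "nm (sum f {m..<n}) < e"
        using N that \<open>e > 0\<close> by (intro nm_sum_less) auto
      ultimately show ?thesis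
        by (simp add: dist_eq_nm)
    qed
    show "\<exists>M. \<forall>m\<ge>M. \<forall>n\<ge>M. dist (sum f {..<m}) (sum f {..<n}) < e"
    proof (intro exI allI impI)
      fix m n assume "N \<le> m" "N \<le> n"
      then show "dist (sum f {..<m}) (sum f {..<n}) < e"
        using *[of m n] *[of n m] by (cases "m \<le> n") (auto simp: dist_commute)
    qed
  qed
  then show ?thesis
    unfolding summable_iff_convergent by (rule Cauchy_convergent)
qed

text \<open>The power of \<open>p\<close> dividing \<open>n\<close> is at most \<open>n\<close>. The
  denominators of the logarithm series thus contribute at most a linear factor, which the geometric
  decay of the powers of x - 1 absorbs.\<close>

lemma nm_of_nat_ge:
  assumes "n > 0" shows "nm (of_nat n :: 'c) \<ge> 1 / real n"
proof -
  obtain m where m: "n = p ^ multiplicity p n * m" "\<not> p dvd m"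
    using multiplicity_decompose'[of n p] assms p_gt_1 by auto
  define k where "k = multiplicity p n"
  have "nm (of_nat m :: 'c) = 1"
    using nm_of_int_eq_1[of "int m"] m(2) by simp
  then have "nm (of_nat n :: 'c) = (1 / real p) ^ k"
    using m(1) unfolding k_def[symmetric] by (simp add: nm_mult nm_power nm_p)
  moreover have "p ^ k \<le> n"
    using m(1) assms unfolding k_def[symmetric] by (metis dvd_imp_le dvd_triv_left)
  then have "real p ^ k \<le> real n"
    by (metis of_nat_le_iff of_nat_power)
  then have "1 / real n \<le> 1 / real p ^ k"
    using p_gt_1 assms by (intro divide_left_mono) auto
  ultimately show ?thesis
    by (simp add: power_one_over)
qed

lemma nm_divide_of_nat_le: "nm (x / of_nat (Suc n)) \<le> real (Suc n) * nm x" for x :: 'c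
proof -
  have "nm x / nm (of_nat (Suc n) :: 'c) \<le> nm x / (1 / real (Suc n))"
    using nm_of_nat_ge[of "Suc n"] nm_pos[of "of_nat (Suc n)"]
    by (intro divide_left_mono mult_pos_pos) (auto simp del: of_nat_Suc)
  then show ?thesis
    by (simp add: nm_divide mult.commute del: of_nat_Suc)
qed

section \<open>The logarithm series on principal units\<close>

definition log_term :: "'c \<Rightarrow> nat \<Rightarrow> 'c" where
  "log_term x n = (-1) ^ n * (x - 1) ^ Suc n / of_nat (Suc n)"

lemma nm_log_term: "nm (log_term x n) = nm ((x - 1) ^ Suc n / of_nat (Suc n))"
  by (simp add: log_term_def nm_divide nm_mult nm_power del: of_nat_Suc power_Suc)

lemma log_power_tendsto_0:
  assumes "nm z < 1"
  shows "(\<lambda>n. nm (z ^ Suc n / of_nat (Suc n) :: 'c)) \<longlonglongrightarrow> 0"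
proof (rule tendsto_sandwich[OF _ _ tendsto_const])
  have "(\<lambda>n. real n * nm z ^ n) \<longlonglongrightarrow> 0"
    using assms by (intro powser_times_n_limit_0) simp
  then show "(\<lambda>n. real (Suc n) * nm z ^ Suc n) \<longlonglongrightarrow> 0"
    by (rule LIMSEQ_Suc)
  show "\<forall>\<^sub>F n in sequentially. nm (z ^ Suc n / of_nat (Suc n)) \<le> real (Suc n) * nm z ^ Suc n"
    using nm_divide_of_nat_le by (intro always_eventually allI) (metis nm_power)
qed simp

lemma log_term_summable: "nm (x - 1) < 1 \<Longrightarrow> summable (log_term x)"
  by (rule summable_if_nm_tendsto_0) (simp only: nm_log_term log_power_tendsto_0)

definition ln1 :: "'c \<Rightarrow> 'c" where
  "ln1 x = suminf (log_term x)"

lemma ln1_sums: "nm (x - 1) < 1 \<Longrightarrow> log_term x sums ln1 x"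
  unfolding ln1_def by (intro summable_sums log_term_summable)

text \<open>By Pascal's rule two consecutive binomials add up to (p^m choose k + 1), which equals
  p^m / (k + 1) times an integer and is p-adically small; so the values alternate between nearly 1
  and nearly -1.\<close>

lemma binomial_prime_power_close:
  "nm (of_nat (p ^ m - 1 choose k) - (-1) ^ k :: 'c) \<le> real k * (1 / real p) ^ m"
proof (induction k)
  case (Suc k)
  let ?C = "\<lambda>k. of_nat (p ^ m - 1 choose k) :: 'c"
  have pm: "p ^ m = Suc (p ^ m - 1)"
    using p_gt_1 by simp
  have "(p ^ m choose Suc k) = (p ^ m - 1 choose k) + (p ^ m - 1 choose Suc k)"
    by (subst pm) (simp del: power_Suc)
  then have eq: "?C (Suc k) - (-1) ^ Suc k = of_nat (p ^ m choose Suc k) - (?C k - (-1) ^ k)"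
    by simp
  have "nm (of_nat (p ^ m choose Suc k) :: 'c) \<le> real (Suc k) * (1 / real p) ^ m"
  proof -
    have "Suc k * (p ^ m choose Suc k) = p ^ m * (p ^ m - 1 choose k)"
      using Suc_times_binomial_eq[of "p ^ m - 1" k] unfolding pm[symmetric] by (simp only: mult.commute)
    then have "of_nat (Suc k) * of_nat (p ^ m choose Suc k) = (of_nat p ^ m * ?C k)"
      unfolding of_nat_mult[symmetric] of_nat_power[symmetric] by (simp only:)
    then have "of_nat (p ^ m choose Suc k) = (of_nat p ^ m * ?C k) / of_nat (Suc k)"
      by (simp add: field_simps del: of_nat_Suc)
    then have "nm (of_nat (p ^ m choose Suc k) :: 'c) \<le> real (Suc k) * nm (of_nat p ^ m * ?C k)"
      using nm_divide_of_nat_le by metis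
    also have "\<dots> \<le> real (Suc k) * ((1 / real p) ^ m * 1)"
      unfolding nm_mult nm_power nm_p using nm_of_nat_le by (intro mult_left_mono) auto
    finally show ?thesis
      by simp
  qed
  moreover have "real k * (1 / real p) ^ m \<le> real (Suc k) * (1 / real p) ^ m"
    by (intro mult_right_mono) auto
  ultimately show ?case
    unfolding eq using nm_diff[of "of_nat (p ^ m choose Suc k)" "?C k - (-1) ^ k"] Suc.IH by linarith
qed simp

lemma p_power_tendsto_0: "(\<lambda>m. (1 / real p) ^ m) \<longlonglongrightarrow> 0"
  using p_gt_1 by (intro LIMSEQ_realpow_zero) auto

lemma binomial_quotient:
  "((1 + z) ^ (p ^ m) - 1) / of_nat p ^ m
     = (\<Sum>k<p ^ m. of_nat (p ^ m - 1 choose k) * (z ^ Suc k / of_nat (Suc k)))" for z :: 'c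
proof -
  have pm: "p ^ m = Suc (p ^ m - 1)"
    using p_gt_1 by simp
  have "(1 + z) ^ (p ^ m) = (\<Sum>k\<le>p ^ m. of_nat (p ^ m choose k) * z ^ k)"
    using binomial_ring[of z 1 "p ^ m"] by (simp add: add.commute)
  also have "\<dots> = (\<Sum>k<Suc (p ^ m). of_nat (p ^ m choose k) * z ^ k)"
    by (simp only: lessThan_Suc_atMost)
  also have "\<dots> = 1 + (\<Sum>k<p ^ m. of_nat (p ^ m choose Suc k) * z ^ Suc k)"
    by (subst sum.lessThan_Suc_shift) simp
  finally have "((1 + z) ^ (p ^ m) - 1) / of_nat p ^ m
      = (\<Sum>k<p ^ m. of_nat (p ^ m choose Suc k) * z ^ Suc k / of_nat p ^ m)"
    by (simp add: sum_divide_distrib)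
  also have "\<dots> = (\<Sum>k<p ^ m. of_nat (p ^ m - 1 choose k) * (z ^ Suc k / of_nat (Suc k)))"
  proof (intro sum.cong refl)
    fix k
    have "Suc k * (p ^ m choose Suc k) = p ^ m * (p ^ m - 1 choose k)"
      using Suc_times_binomial_eq[of "p ^ m - 1" k] unfolding pm[symmetric] by (simp only: mult.commute)
    then have "of_nat (Suc k) * of_nat (p ^ m choose Suc k) = (of_nat p ^ m * of_nat (p ^ m - 1 choose k) :: 'c)"
      unfolding of_nat_mult[symmetric] of_nat_power[symmetric] by (simp only:)
    then have "of_nat (p ^ m choose Suc k) = (of_nat p ^ m * of_nat (p ^ m - 1 choose k)) / (of_nat (Suc k) :: 'c)"
      by (simp add: field_simps del: of_nat_Suc)
    then show "of_nat (p ^ m choose Suc k) * z ^ Suc k / of_nat p ^ m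
        = of_nat (p ^ m - 1 choose k) * (z ^ Suc k / of_nat (Suc k))"
      using p_gt_1 by (simp add: field_simps del: of_nat_Suc power_Suc)
  qed
  finally show ?thesis .
qed

text \<open>The binomial expansion of (x^(p^m) - 1) / p^m has coefficients tending to those of the
  logarithm series. In this form of the logarithm, additivity is a matter of one algebraic
  identity.\<close>

lemma ln1_limit:
  assumes x: "nm (x - 1) < 1"
  shows "(\<lambda>m. (x ^ (p ^ m) - 1) / of_nat p ^ m) \<longlonglongrightarrow> ln1 x"
proof -
  define z where "z = x - 1"
  let ?a = "\<lambda>k. z ^ Suc k / of_nat (Suc k)"
  let ?d = "\<lambda>m. \<Sum>k<p ^ m. (of_nat (p ^ m - 1 choose k) - (-1) ^ k) * ?a k"
  have z: "nm z < 1" "x = 1 + z"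
    using x by (simp_all add: z_def)
  have "?d \<longlonglongrightarrow> 0"
    unfolding tendsto_iff_nm diff_0_right
  proof (rule LIMSEQ_I)
    fix e :: real assume e: "e > 0"
    \<comment> \<open>Terms from \<open>K\<close> on are small uniformly in \<open>m\<close>,
      because the differences of coefficients have absolute value at most 1; for the finitely many
      terms before \<open>K\<close> these differences tend to 0.\<close>
    obtain K where K: "\<And>k. k \<ge> K \<Longrightarrow> nm (?a k) < e"
      using order_tendstoD(2)[OF log_power_tendsto_0[OF z(1)] e] unfolding eventually_sequentially by metis
    have "(\<lambda>m. real K * (1 / real p) ^ m * real K) \<longlonglongrightarrow> real K * 0 * real K"
      by (intro tendsto_intros p_power_tendsto_0)
    then have "\<forall>\<^sub>F m in sequentially. real K * (1 / real p) ^ m * real K < e"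
      using e by (intro order_tendstoD(2)) auto
    then obtain M where M: "\<And>m. m \<ge> M \<Longrightarrow> real K * (1 / real p) ^ m * real K < e"
      unfolding eventually_sequentially by blast
    have "norm (nm (?d m) - 0) < e" if "m \<ge> M" for m
    proof -
      have "nm (?d m) < e"
      proof (rule nm_sum_less)
        fix k
        show "nm ((of_nat (p ^ m - 1 choose k) - (-1) ^ k) * ?a k) < e"
        proof (cases "k < K")
          case True
          have "nm (?a k) \<le> real (Suc k) * nm (z ^ Suc k)"
            by (rule nm_divide_of_nat_le)
          also have "\<dots> \<le> real K * 1"
            using True z(1) nm_nonneg[of z] unfolding nm_power by (intro mult_mono power_le_one) auto
          finally have "nm (?a k) \<le> real K"
            by simp
          moreover have "nm (of_nat (p ^ m - 1 choose k) - (-1) ^ k :: 'c) \<le> real K * (1 / real p) ^ m"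
          proof -
            have "real k * (1 / real p) ^ m \<le> real K * (1 / real p) ^ m"
              using True by (intro mult_right_mono) auto
            then show ?thesis
              using binomial_prime_power_close[of m k] by linarith
          qed
          ultimately have "nm ((of_nat (p ^ m - 1 choose k) - (-1) ^ k) * ?a k) \<le> real K * (1 / real p) ^ m * real K"
            unfolding nm_mult by (intro mult_mono) auto
          then show ?thesis
            using M[OF that] by linarith
        next
          case False
          have "nm (of_nat (p ^ m - 1 choose k) - (-1) ^ k :: 'c) \<le> 1"
            using nm_diff[of "of_nat (p ^ m - 1 choose k)" "(-1) ^ k"] nm_of_nat_le[of "p ^ m - 1 choose k"]
            by (simp add: nm_power)
          then have "nm ((of_nat (p ^ m - 1 choose k) - (-1) ^ k) * ?a k) \<le> 1 * nm (?a k)"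
            unfolding nm_mult by (intro mult_right_mono) auto
          then show ?thesis
            using K[of k] False by simp
        qed
      qed (rule e)
      then show ?thesis
        by simp
    qed
    then show "\<exists>M. \<forall>m\<ge>M. norm (nm (?d m) - 0) < e"
      by blast
  qed
  moreover have "(\<lambda>m. \<Sum>k<p ^ m. log_term x k) \<longlonglongrightarrow> ln1 x"
  proof -
    have "strict_mono (\<lambda>m. p ^ m)"
      using p_gt_1 by (simp add: strict_mono_def power_strict_increasing)
    then show ?thesis
      using LIMSEQ_subseq_LIMSEQ[OF ln1_sums[OF x, unfolded sums_def]] by (simp add: o_def)
  qed
  ultimately have "(\<lambda>m. ?d m + (\<Sum>k<p ^ m. log_term x k)) \<longlonglongrightarrow> 0 + ln1 x"
    by (rule tendsto_add_nm)
  moreover have "?d m + (\<Sum>k<p ^ m. log_term x k) = (x ^ (p ^ m) - 1) / of_nat p ^ m" for m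
  proof -
    have lt: "log_term x k = (-1) ^ k * ?a k" for k
      by (simp add: log_term_def z_def del: of_nat_Suc power_Suc)
    have "(a - b) * c + b * c = a * c" for a b c :: 'c
      by (simp add: algebra_simps)
    then show ?thesis
      unfolding z(2) binomial_quotient sum.distrib[symmetric] lt[unfolded z(2)] by (simp only:)
  qed
  ultimately show ?thesis
    by simp
qed

lemma p_power_tendsto_0_nm: "(\<lambda>m. of_nat p ^ m :: 'c) \<longlonglongrightarrow> 0"
  unfolding tendsto_iff_nm using p_power_tendsto_0 by (simp add: nm_power nm_p)

lemma power_p_power_tendsto_1:
  assumes "nm (x - 1) < 1"
  shows "(\<lambda>m. x ^ (p ^ m) - 1) \<longlonglongrightarrow> (0 :: 'c)"
proof -
  have "(\<lambda>m. (x ^ (p ^ m) - 1) / of_nat p ^ m * of_nat p ^ m) \<longlonglongrightarrow> ln1 x * 0"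
    by (intro tendsto_mult_nm ln1_limit assms p_power_tendsto_0_nm)
  then show ?thesis
    using p_gt_1 by simp
qed

text \<open>With a = x^(p^m) and b = y^(p^m), ab - 1 = (a - 1)(b - 1) + (a - 1) + (b - 1). After
  division by p^m the mixed term still contains the factor b - 1, which tends to 0.\<close>

lemma ln1_mult:
  assumes x: "nm (x - 1) < 1" and y: "nm (y - 1) < 1"
  shows "ln1 (x * y) = ln1 x + ln1 y"
proof (rule LIMSEQ_unique)
  let ?u = "\<lambda>x m. (x ^ (p ^ m) - 1) / of_nat p ^ m"
  show "?u (x * y) \<longlonglongrightarrow> ln1 (x * y)"
    by (intro ln1_limit nm_mult_close x y)
  have "(\<lambda>m. ?u x m * (y ^ (p ^ m) - 1) + (?u x m + ?u y m)) \<longlonglongrightarrow> ln1 x * 0 + (ln1 x + ln1 y)"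
    by (intro tendsto_add_nm tendsto_mult_nm ln1_limit power_p_power_tendsto_1 x y)
  moreover have "?u x m * (y ^ (p ^ m) - 1) + (?u x m + ?u y m) = ?u (x * y) m" for m
    using p_gt_1 by (simp add: field_simps power_mult_distrib)
  ultimately show "?u (x * y) \<longlonglongrightarrow> ln1 x + ln1 y"
    by simp
qed

lemma ln1_1: "ln1 1 = 0"
  using ln1_mult[of 1 1] by simp

lemma ln1_power: "nm (x - 1) < 1 \<Longrightarrow> ln1 (x ^ n) = of_nat n * ln1 x"
  by (induction n) (simp_all add: ln1_1 ln1_mult nm_power_close distrib_right)

text \<open>The linear term dominates. The radius 1/4 serves every \<open>p\<close>: by |1/n| \<le>
  n, the term of degree n + 2 is at most (n + 2) / 4^(n + 1) \<le> 1/2 times |x - 1|.\<close>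

lemma nm_ln1_small:
  assumes "nm (x - 1) \<le> 1 / 4"
  shows "nm (ln1 x) = nm (x - 1)"
proof (cases "x = 1")
  case False
  define z where "z = x - 1"
  have z: "nm z \<le> 1 / 4" "z \<noteq> 0"
    using assms False by (auto simp: z_def)
  have "nm (log_term x (Suc n)) \<le> nm z / 2" for n
  proof -
    have "nm (log_term x (Suc n)) \<le> real (Suc (Suc n)) * nm (z ^ Suc (Suc n))"
      unfolding nm_log_term z_def by (rule nm_divide_of_nat_le)
    also have "\<dots> = real (Suc (Suc n)) * nm z ^ Suc n * nm z"
      by (simp add: nm_mult nm_power)
    also have "\<dots> \<le> real (Suc (Suc n)) * (1 / 4) ^ Suc n * nm z"
      using z(1) by (intro mult_right_mono mult_left_mono power_mono) auto
    also have "\<dots> \<le> 1 / 2 * nm z"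
    proof (intro mult_right_mono)
      have "n + 2 \<le> 2 * 4 ^ n"
        by (induction n) auto
      then have "real (n + 2) \<le> real (2 * 4 ^ n)"
        by (rule of_nat_mono)
      then show "real (Suc (Suc n)) * (1 / 4) ^ Suc n \<le> 1 / 2"
        by (simp add: power_one_over field_simps)
    qed simp
    finally show ?thesis
      by simp
  qed
  then have "nm (\<Sum>k<n. log_term x (Suc k)) \<le> nm z / 2" for n
    by (intro nm_sum_le) auto
  then have "nm ((\<Sum>k<Suc n. log_term x k) - z) \<le> nm z / 2" for n
    unfolding sum.lessThan_Suc_shift by (simp add: log_term_def[of x 0] z_def)
  note bound = this
  have lim: "(\<lambda>n. (\<Sum>k<Suc n. log_term x k) - z) \<longlonglongrightarrow> ln1 x - z"
  proof -
    have "(\<lambda>n. \<Sum>k<n. log_term x k) \<longlonglongrightarrow> ln1 x"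
      using ln1_sums[of x] assms by (simp add: sums_def)
    from tendsto_diff_nm[OF LIMSEQ_Suc[OF this] tendsto_const] show ?thesis .
  qed
  from lim bound have "nm (ln1 x - z) \<le> nm z / 2"
    by (rule nm_limit_le)
  also have "\<dots> < nm z"
    using z(2) by simp
  finally have "nm (ln1 x) = nm z"
    using nm_diff_eq[of z "ln1 x"] by (simp add: nm_minus_commute)
  then show ?thesis
    by (simp add: z_def)
qed (simp add: ln1_1)

text \<open>A power with exponent p^m moves \<open>x\<close> into the disc on which the logarithm
  has absolute value |x - 1|, and there its only zero is 1.\<close>

lemma ln1_eq_0:
  assumes x: "nm (x - 1) < 1" and "ln1 x = 0"
  shows "\<exists>n>0. x ^ n = 1"
proof -
  have "\<forall>\<^sub>F m in sequentially. nm (x ^ (p ^ m) - 1) < 1 / 4"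
    using tendsto_nm[OF power_p_power_tendsto_1[OF x]] by (intro order_tendstoD(2)) auto
  then obtain m where m: "nm (x ^ (p ^ m) - 1) < 1 / 4"
    by (auto simp: eventually_sequentially)
  have "ln1 (x ^ (p ^ m)) = 0"
    using assms by (simp add: ln1_power)
  then have "x ^ (p ^ m) = 1"
    using nm_ln1_small[of "x ^ (p ^ m)"] m by simp
  then show ?thesis
    using p_gt_1 by (intro exI[of _ "p ^ m"]) auto
qed

lemma p_powi_eq_1:
  assumes "(1 / real p) powi k = 1" shows "k = 0"
proof -
  have *: "n = 0" if "(1 / real p) ^ n = 1" for n
  proof -
    have "real p ^ n = real p ^ 0"
      using that p_gt_1 by (simp add: power_one_over)
    then show ?thesis
      using p_gt_1 by (subst (asm) power_inject_exp) auto
  qed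
  show ?thesis
  proof (cases "k \<ge> 0")
    case True
    then show ?thesis
      using assms *[of "nat k"] by (simp add: power_int_def)
  next
    case False
    have "(1 / real p) ^ nat (- k) = 1"
      using assms False by (simp add: power_int_def power_one_over)
    then show ?thesis
      using *[of "nat (- k)"] False by simp
  qed
qed

section \<open>Extension of the logarithm to all of C_p\<close>

definition plog :: "'c \<Rightarrow> 'c" where
  "plog x = (if x = 0 then 0 else
     (SOME l. \<exists>m k. m > 0 \<and> nm (x ^ m * of_nat p powi k - 1) < 1 \<and> l = ln1 (x ^ m * of_nat p powi k) / of_nat m))"

text \<open>Additivity and log p = 0 force m log x = log(x^m p^k) whenever x^m p^k is a principal
  unit, which is the origin of the formula for \<open>plog\<close>. It remains to see that the value
  does not depend on \<open>m\<close> and \<open>k\<close>.\<close>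

lemma plog_eq:
  assumes x: "x \<noteq> 0" and m: "m > 0" "nm (x ^ m * of_nat p powi k - 1) < 1"
  shows "plog x = ln1 (x ^ m * of_nat p powi k) / of_nat m"
proof -
  have p0: "(of_nat p :: 'c) \<noteq> 0"
    using p_gt_1 by simp
  have uniq: "ln1 (x ^ m * of_nat p powi k) / of_nat m = ln1 (x ^ n * of_nat p powi l) / of_nat n"
    if n: "n > 0" "nm (x ^ n * of_nat p powi l - 1) < 1" for n l
  proof -
    \<comment> \<open>Raised to the powers \<open>n\<close> and \<open>m\<close>, the two admissible
      elements differ by a power of \<open>p\<close> only; both have absolute value 1, so they
      agree.\<close>
    let ?a = "x ^ m * of_nat p powi k" and ?b = "x ^ n * of_nat p powi l"
    have "nm ?a = 1" "nm ?b = 1"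
      using nm_close_1[OF m(2)] nm_close_1[OF n(2)] by auto
    then have nm_ab: "nm (?a ^ n / ?b ^ m) = 1"
      by (simp add: nm_power nm_divide)
    have a: "?a ^ n = x ^ (m * n) * of_nat p powi (k * int n)"
      by (simp add: power_mult_distrib power_int_mult power_mult)
    have b: "?b ^ m = x ^ (m * n) * of_nat p powi (l * int m)"
      unfolding mult.commute[of m n] by (simp add: power_mult_distrib power_int_mult power_mult)
    have "?a ^ n / ?b ^ m = of_nat p powi (k * int n - l * int m)"
      unfolding a b using x p0 by (simp add: power_int_diff)
    with nm_ab have "(1 / real p) powi (k * int n - l * int m) = 1"
      by (simp only: nm_powi nm_p)
    then have "k * int n - l * int m = 0"
      by (rule p_powi_eq_1)
    then have "?a ^ n = ?b ^ m"
      unfolding a b by simp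
    then have "of_nat n * ln1 ?a = of_nat m * ln1 ?b"
      unfolding ln1_power[OF m(2), symmetric] ln1_power[OF n(2), symmetric] by (rule arg_cong)
    then show ?thesis
      using m(1) n(1) by (subst frac_eq_eq) (simp_all only: of_nat_eq_0_iff mult.commute neq0_conv)
  qed
  show ?thesis
    unfolding plog_def if_not_P[OF x]
  proof (rule some_equality)
    show "\<exists>m' k'. m' > 0 \<and> nm (x ^ m' * of_nat p powi k' - 1) < 1 \<and>
        ln1 (x ^ m * of_nat p powi k) / of_nat m = ln1 (x ^ m' * of_nat p powi k') / of_nat m'"
      by (intro exI[of _ m] exI[of _ k] conjI m refl)
    fix w assume "\<exists>n k'. n > 0 \<and> nm (x ^ n * of_nat p powi k' - 1) < 1 \<and> w = ln1 (x ^ n * of_nat p powi k') / of_nat n"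
    then obtain n k' where "n > 0" "nm (x ^ n * of_nat p powi k' - 1) < 1" "w = ln1 (x ^ n * of_nat p powi k') / of_nat n"
      by blast
    then show "w = ln1 (x ^ m * of_nat p powi k) / of_nat m"
      by (simp only: uniq)
  qed
qed

lemma unit_power_close:
  assumes "nm (x :: 'c) = 1" shows "\<exists>m>0. nm (x ^ m - 1) < 1"
proof -
  have "x \<noteq> 0"
    using assms by auto
  obtain m k where m: "m > 0" "nm (x ^ m * of_nat p powi k - 1) < 1"
    using ex_power_close[OF \<open>x \<noteq> 0\<close>] .
  have "nm (of_nat p powi k :: 'c) = 1"
    using nm_close_1[OF m(2)] assms by (simp add: nm_mult nm_power)
  then have "k = 0"
    by (intro p_powi_eq_1) (simp add: nm_powi nm_p)
  with m show ?thesis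
    by auto
qed

lemma plog_mult:
  assumes "a \<noteq> 0" "b \<noteq> 0" shows "plog (a * b) = plog a + plog b"
proof -
  have p0: "(of_nat p :: 'c) \<noteq> 0"
    using p_gt_1 by simp
  obtain m k where m: "m > 0" "nm (a ^ m * of_nat p powi k - 1) < 1"
    using ex_power_close[OF assms(1)] .
  obtain n l where n: "n > 0" "nm (b ^ n * of_nat p powi l - 1) < 1"
    using ex_power_close[OF assms(2)] .
  let ?a = "a ^ m * of_nat p powi k" and ?b = "b ^ n * of_nat p powi l"
  have eq: "(a * b) ^ (m * n) * of_nat p powi (k * int n + l * int m) = ?a ^ n * ?b ^ m"
  proof -
    have "?a ^ n = a ^ (m * n) * of_nat p powi (k * int n)"
      by (simp add: power_mult_distrib power_int_mult power_mult)
    moreover have "?b ^ m = b ^ (m * n) * of_nat p powi (l * int m)"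
      unfolding mult.commute[of m n] by (simp add: power_mult_distrib power_int_mult power_mult)
    moreover have "(of_nat p :: 'c) powi (k * int n + l * int m) = of_nat p powi (k * int n) * of_nat p powi (l * int m)"
      using p0 by (simp add: power_int_add)
    ultimately show ?thesis
      by (simp only: power_mult_distrib mult_ac)
  qed
  have close: "nm (?a ^ n * ?b ^ m - 1) < 1"
    by (intro nm_mult_close nm_power_close m n)
  have "plog (a * b) = ln1 (?a ^ n * ?b ^ m) / of_nat (m * n)"
    using plog_eq[of "a * b" "m * n" "k * int n + l * int m"] assms m(1) n(1) close unfolding eq by simp
  also have "ln1 (?a ^ n * ?b ^ m) = of_nat n * ln1 ?a + of_nat m * ln1 ?b"
    using m n by (simp add: ln1_mult ln1_power nm_power_close)
  also have "\<dots> / of_nat (m * n) = ln1 ?a / of_nat m + ln1 ?b / of_nat n"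
    using m(1) n(1) by (simp add: field_simps)
  also have "\<dots> = plog a + plog b"
    using plog_eq[OF assms(1) m] plog_eq[OF assms(2) n] by simp
  finally show ?thesis .
qed

lemma plog_root_of_unity:
  assumes "n > 0" "\<zeta> ^ n = 1" shows "plog (\<zeta> * of_nat p powi s) = 0"
proof -
  have "\<zeta> \<noteq> 0"
    using assms by (auto simp: power_0_left)
  have eq: "(\<zeta> * of_nat p powi s) ^ n * of_nat p powi (- s * int n) = 1"
    using assms p_gt_1 by (simp add: power_mult_distrib power_int_minus power_int_mult)
  have "plog (\<zeta> * of_nat p powi s) = ln1 1 / of_nat n"
    using plog_eq[of "\<zeta> * of_nat p powi s" n "- s * int n"] \<open>\<zeta> \<noteq> 0\<close> p_gt_1 assms(1) unfolding eq by simp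
  then show ?thesis
    by (simp add: ln1_1)
qed

lemma plog_close_1: "nm (x - 1) < 1 \<Longrightarrow> plog x = ln1 x"
  using plog_eq[of x 1 0] nm_close_1[of x] nm_0 by force

lemma is_padic_log_plog: "is_padic_log p plog"
  unfolding is_padic_log_def
proof (intro conjI allI impI)
  fix x :: 'c assume "dist x 1 < 1"
  then have "nm (x - 1) < 1"
    by (simp add: dist_eq_nm)
  then show "(\<lambda>n. (-1) ^ n * (x - 1) ^ Suc n / of_nat (Suc n)) sums plog x"
    using ln1_sums[of x] plog_close_1[of x] unfolding log_term_def by simp
qed (auto simp: plog_mult plog_root_of_unity plog_def[of 0])

lemma is_padic_log_unique:
  assumes l: "is_padic_log p l" shows "l = plog"
proof
  fix x :: 'c
  have mult: "l (a * b) = l a + l b" if "a \<noteq> 0" "b \<noteq> 0" for a b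
    using l that unfolding is_padic_log_def by blast
  have ppow: "l (of_nat p powi k) = 0" for k
  proof -
    have "l (1 * of_nat p powi k) = 0"
      using l unfolding is_padic_log_def by (metis power_one zero_less_one)
    then show ?thesis
      by simp
  qed
  show "l x = plog x"
  proof (cases "x = 0")
    case True
    then show ?thesis
      using l by (simp add: is_padic_log_def plog_def)
  next
    case False
    obtain m k where m: "m > 0" "nm (x ^ m * of_nat p powi k - 1) < 1"
      using ex_power_close[OF False] .
    have pow: "l (x ^ n) = of_nat n * l x" for n
    proof (induction n)
      case 0
      then show ?case
        using mult[of 1 1] by simp
    qed (use False in \<open>simp_all add: mult distrib_right\<close>)
    have "log_term (x ^ m * of_nat p powi k) sums l (x ^ m * of_nat p powi k)"
      using l m(2) unfolding is_padic_log_def log_term_def dist_eq_nm by simp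
    then have "l (x ^ m * of_nat p powi k) = ln1 (x ^ m * of_nat p powi k)"
      using ln1_sums[OF m(2)] by (rule sums_unique2)
    moreover have "l (x ^ m * of_nat p powi k) = of_nat m * l x"
      using False p_gt_1 by (simp add: mult pow ppow)
    ultimately have "of_nat m * l x = of_nat m * plog x"
      using plog_eq[OF False m] m(1) by simp
    then show ?thesis
      using m(1) by simp
  qed
qed

lemma padic_log_eq: "padic_log p = plog"
  unfolding padic_log_def using is_padic_log_plog is_padic_log_unique by (rule the_equality)

lemma plog_1 [simp]: "plog 1 = 0"
  using plog_mult[of 1 1] by simp

lemma plog_power: "x \<noteq> 0 \<Longrightarrow> plog (x ^ n) = of_nat n * plog x"
  by (induction n) (simp_all add: plog_mult distrib_right)

lemma plog_prod:
  "(\<And>i. i \<in> A \<Longrightarrow> f i \<noteq> 0) \<Longrightarrow> plog (prod f A) = (\<Sum>i\<in>A. plog (f i))"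
  by (induction A rule: infinite_finite_induct) (simp_all add: plog_mult)

text \<open>On elements of absolute value 1 a power alone, without a factor from \<open>p\<close>,
  leads into the principal units, and there the kernel of the logarithm is torsion.\<close>

lemma plog_eq_0:
  assumes "nm x = 1" "plog x = 0" shows "\<exists>n>0. x ^ n = 1"
proof -
  have "x \<noteq> 0"
    using assms(1) by auto
  obtain m where m: "m > 0" "nm (x ^ m - 1) < 1"
    using unit_power_close[OF assms(1)] by blast
  then have "plog x = ln1 (x ^ m) / of_nat m"
    using plog_eq[OF \<open>x \<noteq> 0\<close>, of m 0] by simp
  then have "ln1 (x ^ m) = 0"
    using assms(2) m(1) by simp
  then obtain n where "n > 0" "(x ^ m) ^ n = 1"
    using ln1_eq_0[OF m(2)] by blast
  then show ?thesis
    using m(1) by (intro exI[of _ "m * n"]) (simp add: power_mult)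
qed

lemma plog_tendsto_0:
  assumes "f \<longlonglongrightarrow> (1 :: 'c)" shows "(\<lambda>n. plog (f n)) \<longlonglongrightarrow> 0"
proof -
  have lim: "(\<lambda>n. nm (f n - 1)) \<longlonglongrightarrow> 0"
    using assms unfolding tendsto_iff_nm .
  have "\<forall>\<^sub>F n in sequentially. nm (f n - 1) < 1 / 4"
    using lim by (rule order_tendstoD(2)) simp
  then have "\<forall>\<^sub>F n in sequentially. nm (f n - 1) = nm (plog (f n))"
    by eventually_elim (simp add: nm_ln1_small plog_close_1)
  from Lim_transform_eventually[OF lim this] show ?thesis
    unfolding tendsto_iff_nm by simp
qed

end

section \<open>Embeddings and their valuations\<close>

locale field_embedding =
  fixes \<tau> :: "'a::field_char_0 \<Rightarrow> 'b::field_char_0"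
  assumes hom_1 [simp]: "\<tau> 1 = 1"
    and hom_add: "\<tau> (x + y) = \<tau> x + \<tau> y"
    and hom_mult: "\<tau> (x * y) = \<tau> x * \<tau> y"
begin

lemma hom_0 [simp]: "\<tau> 0 = 0"
  using hom_add[of 0 0] by simp

lemma hom_minus: "\<tau> (- x) = - \<tau> x"
  using hom_add[of x "- x"] by (simp add: eq_neg_iff_add_eq_0 add.commute)

lemma hom_diff: "\<tau> (x - y) = \<tau> x - \<tau> y"
  using hom_add[of x "- y"] by (simp add: hom_minus)

lemma hom_power: "\<tau> (x ^ n) = \<tau> x ^ n"
  by (induction n) (simp_all add: hom_mult)

lemma hom_eq_0 [simp]: "\<tau> x = 0 \<longleftrightarrow> x = 0"
proof
  assume "\<tau> x = 0"
  then have "\<tau> (x * inverse x) = 0"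
    by (simp add: hom_mult)
  then show "x = 0"
    by (cases "x = 0") auto
qed simp

lemma hom_eq [simp]: "\<tau> x = \<tau> y \<longleftrightarrow> x = y"
  using hom_eq_0[of "x - y"] by (simp add: hom_diff)

lemma inj: "inj \<tau>"
  by (simp add: inj_def)

lemma hom_inverse: "\<tau> (inverse x) = inverse (\<tau> x)"
proof (cases "x = 0")
  case False
  then have "\<tau> x * \<tau> (inverse x) = 1"
    unfolding hom_mult[symmetric] by simp
  then show ?thesis
    by (metis inverse_unique)
qed simp

lemma hom_divide: "\<tau> (x / y) = \<tau> x / \<tau> y"
  by (simp add: divide_inverse hom_mult hom_inverse)

lemma hom_powi: "\<tau> (x powi k) = \<tau> x powi k"
  by (simp add: power_int_def hom_power hom_inverse)

lemma hom_of_nat [simp]: "\<tau> (of_nat n) = of_nat n"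
  by (induction n) (simp_all add: hom_add)

lemma hom_of_int [simp]: "\<tau> (of_int k) = of_int k"
  by (cases k rule: int_cases2) (simp_all add: hom_minus)

lemma hom_of_rat [simp]: "\<tau> (of_rat q) = of_rat q"
  by (cases q) (simp add: Fract_of_int_quotient of_rat_divide hom_divide)

lemma hom_sum: "\<tau> (sum f A) = (\<Sum>i\<in>A. \<tau> (f i))"
  by (induction A rule: infinite_finite_induct) (simp_all add: hom_add)

lemma hom_prod: "\<tau> (prod f A) = (\<Prod>i\<in>A. \<tau> (f i))"
  by (induction A rule: infinite_finite_induct) (simp_all add: hom_mult)

lemma hom_ipoly: "ipoly f (\<tau> x) = \<tau> (ipoly f x)"
  by (rule ipoly_hom) (simp_all add: hom_add hom_mult)

lemma hom_algebraic_int: "algebraic_int (\<tau> x) \<longleftrightarrow> algebraic_int x"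
  unfolding algebraic_int_altdef_ipoly by (simp add: hom_ipoly)

end

lemma embeddings_iff: "\<tau> \<in> embeddings \<longleftrightarrow> field_embedding \<tau>"
  by (auto simp: embeddings_def ring_hom_def field_embedding_def)

lemma galois_group_iff: "g \<in> galois_group \<longleftrightarrow> field_embedding g \<and> bij g"
  by (auto simp: galois_group_def ring_iso_def ring_hom_def field_embedding_def)

lemma field_embedding_comp: "field_embedding \<tau> \<Longrightarrow> field_embedding \<rho> \<Longrightarrow> field_embedding (\<tau> \<circ> \<rho>)"
  by (simp add: field_embedding_def)

lemma ring_of_integers_simps [simp]:
  "carrier ring_of_integers = {x. algebraic_int x}"
  "x \<otimes>\<^bsub>ring_of_integers\<^esub> y = x * y"
  "x \<oplus>\<^bsub>ring_of_integers\<^esub> y = x + y"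
  "\<one>\<^bsub>ring_of_integers\<^esub> = 1"
  "\<zero>\<^bsub>ring_of_integers\<^esub> = 0"
  by (simp_all add: ring_of_integers_def)

definition val_ideal :: "('a::field_char_0 \<Rightarrow> 'c::{zero,metric_space}) \<Rightarrow> 'a set" where
  "val_ideal \<tau> = {x. algebraic_int x \<and> nm (\<tau> x) < 1}"

text \<open>Finiteness of the number field enters as a uniform bound \<open>D\<close> on the degrees
  of its elements; it makes the value group discrete. The instance \<open>of_rat\<close> with bound
  1 yields Q_p itself.\<close>

locale padic_embedding = padic_complex p T + field_embedding \<tau>
  for p :: nat and T :: "'c::{field_char_0, complete_space} itself" and \<tau> :: "'a::field_char_0 \<Rightarrow> 'c" +
  fixes D :: nat
  assumes bounded_degree: "\<exists>f::int poly. f \<noteq> 0 \<and> Polynomial.degree f \<le> D \<and> ipoly f (x :: 'a) = 0"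
begin

abbreviation av :: "'a \<Rightarrow> real" where
  "av x \<equiv> nm (\<tau> x)"

abbreviation Q :: "'a set" where
  "Q \<equiv> val_ideal \<tau>"

lemma av_mult: "av (x * y) = av x * av y"
  by (simp add: hom_mult nm_mult)

lemma av_add: "av (x + y) \<le> max (av x) (av y)"
  by (simp add: hom_add nm_add)

lemma av_le_1: assumes "algebraic_int x" shows "av x \<le> 1"
proof (rule ccontr)
  assume large: "\<not> av x \<le> 1"
  obtain n where n: "n > 0" "x ^ n \<in> zspan {..<n} (\<lambda>i. x ^ i)"
    using algebraic_int_powers[OF assms] .
  then obtain A where A: "x ^ n = (\<Sum>i<n. of_int (A i) * x ^ i)"
    unfolding zspan_def by blast
  have "nm (\<Sum>i<n. of_int (A i) * \<tau> x ^ i) \<le> av x ^ (n - 1)"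
  proof (rule nm_sum_le)
    fix i assume "i \<in> {..<n}"
    then have "av x ^ i \<le> av x ^ (n - 1)"
      using large by (intro power_increasing) auto
    moreover have "nm (of_int (A i) * \<tau> x ^ i) \<le> 1 * av x ^ i"
      unfolding nm_mult nm_power using nm_of_int_le by (intro mult_right_mono) auto
    ultimately show "nm (of_int (A i) * \<tau> x ^ i) \<le> av x ^ (n - 1)"
      by simp
  qed simp
  also have "(\<Sum>i<n. of_int (A i) * \<tau> x ^ i) = \<tau> (x ^ n)"
    unfolding A by (simp add: hom_sum hom_mult hom_power)
  finally have "av x ^ n \<le> av x ^ (n - 1)"
    by (simp add: hom_power nm_power)
  moreover have "av x ^ (n - 1) < av x ^ n"
    using large n(1) by (intro power_strict_increasing) auto
  ultimately show False
    by simp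
qed

text \<open>As in \<open>L_value\<close>, two terms of equal size in an integer equation determine
  |x|^(j - i). Here j - i is at most \<open>D\<close>, so the single exponent \<open>fact D\<close>
  serves all \<open>x\<close>.\<close>

lemma av_power_value:
  assumes "x \<noteq> 0" shows "\<exists>k::int. av x ^ fact D = real p powi k"
proof -
  obtain f :: "int poly" where f: "f \<noteq> 0" "Polynomial.degree f \<le> D" "ipoly f x = 0"
    using bounded_degree by blast
  let ?t = "\<lambda>i. of_int (Polynomial.coeff f i) * \<tau> x ^ i"
  have "(\<Sum>i\<le>D. ?t i) = 0"
    using f(3) hom_ipoly[of f x] ipoly_eq_sum[OF f(2), of "\<tau> x"] by simp
  moreover obtain i\<^sub>0 where "i\<^sub>0 \<le> D" "?t i\<^sub>0 \<noteq> 0"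
  proof
    show "Polynomial.degree f \<le> D" "?t (Polynomial.degree f) \<noteq> 0"
      using f assms by auto
  qed
  ultimately obtain i j where ij: "i \<le> D" "j \<le> D" "i \<noteq> j" "?t i \<noteq> 0" "nm (?t i) = nm (?t j)"
    using vanishing_sum_two_maximal[of "{..D}" ?t i\<^sub>0] by auto
  have main: "\<exists>k. av x ^ fact D = real p powi k"
    if ij: "i < j" "j \<le> D" "?t i \<noteq> 0" "?t j \<noteq> 0" "nm (?t i) = nm (?t j)" for i j
  proof -
    have "Polynomial.coeff f i \<noteq> 0" "Polynomial.coeff f j \<noteq> 0"
      using ij by auto
    then obtain k l :: nat where kl: "nm (of_int (Polynomial.coeff f i) :: 'c) = (1 / real p) ^ k"
      "nm (of_int (Polynomial.coeff f j) :: 'c) = (1 / real p) ^ l"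
      using nm_of_int_value by metis
    have "(1 / real p) ^ k * av x ^ i = (1 / real p) ^ l * av x ^ (j - i) * av x ^ i"
      using ij(1,5) by (simp add: nm_mult nm_power kl mult.assoc flip: power_add)
    then have "(1 / real p) ^ k = (1 / real p) ^ l * av x ^ (j - i)"
      using assms by simp
    then have "av x ^ (j - i) = real p powi (int l - int k)"
      using p_gt_1 by (simp add: power_int_diff power_one_over field_simps)
    moreover have "j - i dvd fact D"
      using ij by (intro dvd_fact) auto
    then obtain m where "fact D = (j - i) * m" ..
    ultimately have "av x ^ fact D = real p powi ((int l - int k) * int m)"
      by (simp add: power_mult power_int_mult)
    then show ?thesis ..
  qed
  show ?thesis
  proof (cases "i < j")
    case True
    then show ?thesis
      using main[of i j] ij nm_eq_0 by metis
  next
    case False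
    then show ?thesis
      using main[of j i] ij nm_eq_0 by (metis linorder_neqE_nat)
  qed
qed

definition uniformizing :: "'a \<Rightarrow> bool" where
  "uniformizing \<pi> \<longleftrightarrow> \<pi> \<noteq> 0 \<and> av \<pi> < 1 \<and> (\<forall>x. x \<noteq> 0 \<longrightarrow> (\<exists>j::int. av x = av \<pi> powi j))"

lemma ex_uniformizing: "\<exists>\<pi>. uniformizing \<pi>"
proof -
  define N :: nat where "N = fact D"
  have N: "N > 0" "\<And>x. x \<noteq> 0 \<Longrightarrow> \<exists>k::int. av x ^ N = real p powi k"
    using av_power_value by (simp_all add: N_def)
  \<comment> \<open>The k for which p^(-k) is the N-th power of an absolute value. An element
    realising the least such k generates the value group, by division with remainder of the
    exponents.\<close>
  define P where "P k \<longleftrightarrow> k > 0 \<and> (\<exists>x. x \<noteq> 0 \<and> av x ^ N = real p powi (- int k))" for k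
  have "P N"
    unfolding P_def
  proof (intro conjI exI[of _ "of_nat p"])
    show "av (of_nat p) ^ N = real p powi (- int N)"
      by (simp add: nm_p power_int_minus power_one_over inverse_eq_divide)
  qed (use p_gt_1 N in auto)
  define e where "e = (LEAST k. P k)"
  have "P e"
    unfolding e_def using \<open>P N\<close> by (rule LeastI)
  then obtain \<pi> where e: "e > 0" and \<pi>: "\<pi> \<noteq> 0" "av \<pi> ^ N = real p powi (- int e)"
    unfolding P_def by blast
  have least: "\<not> P k" if "k < e" for k
    using that not_less_Least unfolding e_def by blast
  have "uniformizing \<pi>"
    unfolding uniformizing_def
  proof (intro conjI allI impI)
    show "\<pi> \<noteq> 0" by fact
    have "real p powi (- int e) < 1"
      using e p_gt_1 by (simp add: power_int_minus inverse_less_1_iff one_less_power)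
    then show "av \<pi> < 1"
      using \<pi>(2) by (metis linorder_not_less one_le_power)
    fix x :: 'a assume x: "x \<noteq> 0"
    obtain k where k: "av x ^ N = real p powi k"
      using N(2)[OF x] by blast
    define q where "q = (- k) div int e"
    define r where "r = (- k) mod int e"
    have qr: "- k = int e * q + r" "0 \<le> r" "r < int e"
      using e by (simp_all add: q_def r_def)
    define y where "y = x / \<pi> powi q"
    have y: "y \<noteq> 0"
      using x \<pi>(1) by (simp add: y_def)
    have "av y ^ N = av x ^ N / (av \<pi> ^ N) powi q"
      by (simp add: y_def hom_divide hom_powi nm_divide nm_powi power_divide power_int_power power_int_power' mult.commute)
    also have "\<dots> = real p powi (k - (- int e * q))"
      unfolding k \<pi>(2) power_int_mult[symmetric] using p_gt_1 by (subst power_int_diff) auto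
    also have "k - (- int e * q) = - int (nat r)"
      using qr by simp
    finally have avy: "av y ^ N = real p powi (- int (nat r))" .
    have "nat r = 0"
    proof (rule ccontr)
      assume "nat r \<noteq> 0"
      then have "P (nat r)"
        using avy y unfolding P_def by blast
      then show False
        using least[of "nat r"] qr by simp
    qed
    then have "av y ^ N = 1"
      using avy by simp
    then have "av y = 1"
      using power_eq_1_iff[of "av y" N] N(1) by simp
    then have "av x = av \<pi> powi q"
      using \<pi>(1) by (simp add: y_def hom_divide hom_powi nm_divide nm_powi divide_eq_eq)
    then show "\<exists>j::int. av x = av \<pi> powi j" ..
  qed
  then show ?thesis ..
qed

text \<open>The truncations \<open>b k\<close> of a primitive equation of \<open>x\<close> are
  integral, \<open>b (Suc k)\<close> and \<open>x * b k\<close> differ by a coefficient, and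
  \<open>b d\<close> is 0. If no \<open>b k\<close> were a unit at \<tau>, every coefficient would
  be divisible by \<open>p\<close>, against primitivity. A unit \<open>b k\<close> is the
  denominator sought.\<close>

lemma ex_integral_fraction:
  assumes "av x \<le> 1"
  obtains c s where "algebraic_int c" "algebraic_int s" "av s = 1" "x = c / s"
proof -
  obtain g :: "int poly" where g: "g \<noteq> 0" "ipoly g x = 0"
    using bounded_degree by blast
  define f where "f = primitive_part g"
  have "g = Polynomial.smult (content g) f"
    by (simp add: f_def)
  then have fx: "ipoly f x = 0"
    using g by (metis content_eq_zero_iff ipoly_smult mult_eq_0_iff of_int_eq_0_iff)
  have f0: "content f = 1"
    using g(1) by (simp add: f_def)
  define d where "d = Polynomial.degree f"
  let ?a = "Polynomial.coeff f"
  define b where "b k = (\<Sum>i\<le>k. of_int (?a (d - k + i)) * x ^ i)" for k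
  have bd: "b d = 0"
    using fx ipoly_eq_sum[of f d x] by (simp add: b_def d_def)
  have bSuc: "b (Suc k) = of_int (?a (d - Suc k)) + x * b k" if "k < d" for k
  proof -
    have "b (Suc k) = of_int (?a (d - Suc k)) + (\<Sum>i\<le>k. of_int (?a (d - Suc k + Suc i)) * x ^ Suc i)"
      unfolding b_def by (subst sum.atMost_Suc_shift) simp
    also have "(\<Sum>i\<le>k. of_int (?a (d - Suc k + Suc i)) * x ^ Suc i) = x * b k"
      unfolding b_def sum_distrib_left
    proof (intro sum.cong refl)
      fix i
      have "d - Suc k + Suc i = d - k + i"
        using that by simp
      then show "of_int (?a (d - Suc k + Suc i)) * x ^ Suc i = x * (of_int (?a (d - k + i)) * x ^ i)"
        by (simp only: power_Suc mult.left_commute)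
    qed
    finally show ?thesis .
  qed
  have b_int: "algebraic_int (b k)" if "k \<le> d" for k
  proof (cases "k = d")
    case False
    then show ?thesis
      using algebraic_int_truncation[OF fx, of d k] that by (simp add: b_def d_def)
  qed (simp add: bd)
  have "\<exists>k<d. av (b k) = 1"
  proof (rule ccontr)
    assume no: "\<not> ?thesis"
    have small: "av (b k) < 1" if "k \<le> d" for k
    proof (cases "k = d")
      case False
      with that have "k < d"
        by simp
      with no have "av (b k) \<noteq> 1"
        by blast
      with av_le_1[OF b_int[OF that]] show ?thesis
        by simp
    qed (simp add: bd)
    have "int p dvd ?a (d - k)" if "k \<le> d" for k
    proof (cases k)
      case 0
      have "b 0 = of_int (?a d)"
        by (simp add: b_def)
      then have "nm (of_int (?a d) :: 'c) < 1"
        using small[of 0] by simp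
      then show ?thesis
        using 0 nm_of_int_dvd by simp
    next
      case (Suc l)
      have "of_int (?a (d - Suc l)) = \<tau> (b (Suc l)) - \<tau> (x * b l)"
        using bSuc[of l] that Suc by (simp add: hom_add)
      moreover have "av (x * b l) < 1"
        using small[of l] assms that Suc mult_right_mono[OF assms, of "av (b l)"] unfolding av_mult by simp
      then have "nm (\<tau> (b (Suc l)) - \<tau> (x * b l)) < 1"
        using small[of "Suc l"] that Suc by (intro nm_diff_less) auto
      ultimately show ?thesis
        unfolding Suc nm_of_int_dvd by simp
    qed
    then have "int p dvd ?a i" for i
    proof (cases "i \<le> d")
      case True
      then show ?thesis
        using \<open>\<And>k. k \<le> d \<Longrightarrow> int p dvd ?a (d - k)\<close>[of "d - i"] by simp
    next
      case False
      then show ?thesis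
        by (simp add: d_def coeff_eq_0)
    qed
    then have "int p dvd content f"
      unfolding const_poly_dvd_iff_dvd_content[symmetric] const_poly_dvd_iff by blast
    then show False
      using f0 p_gt_1 by simp
  qed
  then obtain k where k: "k < d" "av (b k) = 1"
    by blast
  have "x * b k = b (Suc k) - of_int (?a (d - Suc k))"
    using bSuc[OF k(1)] by simp
  then have "algebraic_int (x * b k)"
    using b_int[of "Suc k"] k(1) by (simp add: algebraic_int_diff)
  moreover have "b k \<noteq> 0"
    using k(2) by auto
  ultimately show ?thesis
    using that[of "x * b k" "b k"] b_int[of k] k by simp
qed

lemma ex_integral_uniformizing: "\<exists>\<pi>. uniformizing \<pi> \<and> algebraic_int \<pi>"
proof -
  obtain \<pi> where \<pi>: "uniformizing \<pi>"
    using ex_uniformizing by blast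
  then have "av \<pi> \<le> 1"
    by (simp add: uniformizing_def)
  then obtain c s where cs: "algebraic_int c" "algebraic_int s" "av s = 1" "\<pi> = c / s"
    using ex_integral_fraction by blast
  have "av \<pi> = av c" "c \<noteq> 0"
    using \<pi> cs by (auto simp: hom_divide nm_divide uniformizing_def)
  then have "uniformizing c"
    using \<pi> by (simp add: uniformizing_def)
  then show ?thesis
    using cs by blast
qed

lemma powi_le_iff:
  fixes y :: real
  assumes "0 < y" "y < 1" shows "y powi j \<le> y powi k \<longleftrightarrow> k \<le> j"
proof -
  have *: "y powi j \<le> y powi k \<longleftrightarrow> y powr of_int j \<le> y powr of_int k"
    using assms by (simp add: powr_real_of_int')
  show ?thesis
    unfolding * using assms by (simp add: powr_def)
qed

text \<open>Some power \<open>s ^ m\<close> is congruent to 1, so \<open>s ^ (m - 1)\<close> inverts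
  \<open>s\<close> modulo the ideal.\<close>

lemma inverse_mod_val_ideal:
  assumes "algebraic_int s" "av s = 1"
  obtains t where "algebraic_int t" "1 - s * t \<in> Q"
proof -
  obtain m where m: "m > 0" "nm (\<tau> s ^ m - 1) < 1"
    using unit_power_close[OF assms(2)] by blast
  have "s * s ^ (m - 1) = s ^ m"
    using m(1) by (simp flip: power_Suc)
  moreover have "av (1 - s ^ m) < 1"
    using m(2) by (simp add: hom_diff hom_power nm_minus_commute)
  ultimately show ?thesis
    using that[of "s ^ (m - 1)"] assms(1) by (simp add: val_ideal_def algebraic_int_power algebraic_int_diff)
qed

text \<open>One inclusion is multiplicativity of the absolute value. For the other, a / \<pi>^n is
  written as c / s, where \<open>s\<close> is a unit at \<tau> but in general not in the ring of
  integers, so that \<open>s\<close> has to be inverted modulo the n-th power of the ideal.\<close>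

lemma val_ideal_power:
  assumes unif: "uniformizing \<pi>" and int: "algebraic_int \<pi>"
  shows "Q [^]\<^bsub>ideals_set ring_of_integers\<^esub> (n::nat) = {a. algebraic_int a \<and> av a \<le> av \<pi> ^ n}"
proof -
  have \<pi>: "\<pi> \<noteq> 0" "av \<pi> < 1" "\<And>x. x \<noteq> 0 \<Longrightarrow> \<exists>j::int. av x = av \<pi> powi j" "algebraic_int \<pi>"
    using unif int by (auto simp: uniformizing_def)
  let ?pow = "\<lambda>n. Q [^]\<^bsub>ideals_set ring_of_integers\<^esub> (n::nat)"
  have pow0: "\<one>\<^bsub>ideals_set ring_of_integers\<^esub> = {x :: 'a. algebraic_int x}"
    by (simp add: ideals_set_def)
  have powSuc: "?pow (Suc n) = ideal_prod ring_of_integers (?pow n) Q" for n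
    by (simp add: nat_pow_def ideals_set_def)
  have val_le: "av a \<le> av \<pi>" if "a \<in> Q" for a
  proof (cases "a = 0")
    case False
    then obtain j where j: "av a = av \<pi> powi j"
      using \<pi>(3) by blast
    have "j > 0"
    proof (rule ccontr)
      assume "\<not> j > 0"
      then have "av \<pi> powi 0 \<le> av \<pi> powi j"
        using \<pi>(1,2) by (subst powi_le_iff) auto
      then show False
        using that j by (simp add: val_ideal_def)
    qed
    then have "av \<pi> powi j \<le> av \<pi> powi 1"
      using \<pi>(1,2) by (subst powi_le_iff) auto
    then show ?thesis
      by (simp add: j)
  qed simp
  have sub: "?pow n \<subseteq> {a. algebraic_int a \<and> av a \<le> av \<pi> ^ n}" for n
  proof (induction n)
    case 0
    then show ?case
      using av_le_1 by (auto simp: pow0)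
  next
    case (Suc n)
    show ?case
    proof
      fix a assume "a \<in> ?pow (Suc n)"
      then have "a \<in> ideal_prod ring_of_integers (?pow n) Q"
        by (simp only: powSuc)
      then show "a \<in> {a. algebraic_int a \<and> av a \<le> av \<pi> ^ Suc n}"
      proof (induction a rule: ideal_prod.induct)
        case (prod i j)
        then have "av (i * j) \<le> av \<pi> ^ n * av \<pi>"
          unfolding av_mult using Suc.IH val_le by (intro mult_mono) auto
        then show ?case
          using prod Suc.IH by (auto simp: val_ideal_def mult.commute intro: algebraic_int_mult)
      next
        case (sum s1 s2)
        then show ?case
          using av_add[of s1 s2] by (auto intro: algebraic_int_add)
      qed
    qed
  qed
  have pow_mult: "c * q ^ n \<in> ?pow n" if "algebraic_int c" "q \<in> Q" for c q n
  proof (induction n)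
    case 0
    then show ?case
      using that by (simp add: pow0)
  next
    case (Suc n)
    have "(c * q ^ n) \<otimes>\<^bsub>ring_of_integers\<^esub> q \<in> ?pow (Suc n)"
      unfolding powSuc using Suc that(2) by (rule ideal_prod.prod)
    then show ?case
      by (simp add: mult_ac)
  qed
  have "a \<in> ?pow n" if a: "algebraic_int a" "av a \<le> av \<pi> ^ n" for a
  proof -
    have "av (a / \<pi> ^ n) \<le> 1"
      using a(2) \<pi>(1) by (simp add: hom_divide hom_power nm_divide nm_power divide_le_eq)
    then obtain c s where cs: "algebraic_int c" "algebraic_int s" "av s = 1" "a / \<pi> ^ n = c / s"
      using ex_integral_fraction by blast
    obtain t where t: "algebraic_int t" "1 - s * t \<in> Q"
      using inverse_mod_val_ideal[OF cs(2,3)] .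
    \<comment> \<open>\<open>q\<close> measures the failure of \<open>t\<close> to invert
      \<open>s\<close>. By the geometric series 1 - q^n is a multiple of \<open>s\<close>; thus
      \<open>a\<close> is a multiple of \<pi>^n plus the error a q^n, and both lie in the n-th
      power.\<close>
    define q where "q = 1 - s * t"
    have "s \<noteq> 0"
      using cs(3) by auto
    then have sa: "s * a = c * \<pi> ^ n"
      using cs(4) \<pi>(1) by (simp add: field_simps)
    have "1 - q ^ n = (s * t) * (\<Sum>i<n. q ^ i)"
      unfolding one_diff_power_eq by (simp add: q_def)
    then have "(1 - q ^ n) * a = (s * a) * t * (\<Sum>i<n. q ^ i)"
      by (simp only: mult_ac)
    moreover have "a = (1 - q ^ n) * a + a * q ^ n"
      by (simp add: algebra_simps)
    ultimately have "a = (s * a) * t * (\<Sum>i<n. q ^ i) + a * q ^ n"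
      by (simp only:)
    then have "a = (t * (\<Sum>i<n. q ^ i) * c) * \<pi> ^ n + a * q ^ n"
      unfolding sa by (simp add: mult_ac)
    moreover have "(t * (\<Sum>i<n. q ^ i) * c) * \<pi> ^ n \<in> ?pow n"
    proof (rule pow_mult)
      have "algebraic_int q"
        using t(2) by (simp add: q_def val_ideal_def)
      then show "algebraic_int (t * (\<Sum>i<n. q ^ i) * c)"
        using t cs by (intro algebraic_int_mult algebraic_int_sum algebraic_int_power)
      show "\<pi> \<in> Q"
        using \<pi> by (simp add: val_ideal_def)
    qed
    moreover have "a * q ^ n \<in> ?pow n"
      using a(1) t(2) by (intro pow_mult) (simp_all add: q_def)
    ultimately show ?thesis
    \<comment> \<open>The zeroth power is the unit ideal of \<open>ideals_set\<close>; the positive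
      powers are ideal products, closed under addition by construction.\<close>
    proof (cases n)
      case 0
      then show ?thesis
        using a(1) by (simp add: pow0)
    next
      case (Suc m)
      note mem = \<open>(t * (\<Sum>i<n. q ^ i) * c) * \<pi> ^ n \<in> ?pow n\<close> \<open>a * q ^ n \<in> ?pow n\<close>
      have "(t * (\<Sum>i<n. q ^ i) * c) * \<pi> ^ n \<oplus>\<^bsub>ring_of_integers\<^esub> a * q ^ n \<in> ?pow n"
        using mem unfolding Suc powSuc by (rule ideal_prod.sum)
      then show ?thesis
        using \<open>a = (t * (\<Sum>i<n. q ^ i) * c) * \<pi> ^ n + a * q ^ n\<close> by simp
    qed
  qed
  then show ?thesis
    using sub by blast
qed

text \<open>Both absolute values depend only on the order at the ideal, with bases 2 and 1 /
  |\<pi>|. They therefore have the same Cauchy sequences, null sequences and unit discs.\<close>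

lemma adic_abs_val_ideal:
  obtains \<kappa> where "\<kappa> > 0" "\<And>x. adic_abs Q x = av x powr \<kappa>"
proof -
  obtain \<pi> where unif: "uniformizing \<pi>" "algebraic_int \<pi>"
    using ex_integral_uniformizing by blast
  then have \<pi>: "\<pi> \<noteq> 0" "av \<pi> < 1" "\<And>x. x \<noteq> 0 \<Longrightarrow> \<exists>j::int. av x = av \<pi> powi j"
    by (auto simp: uniformizing_def)
  have pos: "0 < av \<pi>"
    using \<pi>(1) by simp
  have ord: "ideal_ord Q a = k" if a: "algebraic_int a" "av a = av \<pi> ^ k" for a k
  proof -
    have "a \<in> Q [^]\<^bsub>ideals_set ring_of_integers\<^esub> n \<longleftrightarrow> n \<le> k" for n
      using a powi_le_iff[OF pos \<pi>(2), of "int k" "int n"] by (simp add: val_ideal_power[OF unif])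
    then show ?thesis
      unfolding ideal_ord_def by (intro Greatest_equality) auto
  qed
  have ord_ex: "av a = av \<pi> ^ ideal_ord Q a" if a: "algebraic_int a" "a \<noteq> 0" for a
  proof -
    obtain j where j: "av a = av \<pi> powi j"
      using \<pi>(3) a(2) by blast
    have "av \<pi> powi j \<le> av \<pi> powi 0"
      using av_le_1[OF a(1)] j by simp
    then have "j \<ge> 0"
      using powi_le_iff[OF pos \<pi>(2), of j 0] by simp
    then have "av a = av \<pi> ^ nat j"
      using j by (simp add: power_int_def)
    then show ?thesis
      using ord[OF a(1), of "nat j"] by simp
  qed
  have val: "av x = av \<pi> powi (adic_val Q x)" if x: "x \<noteq> 0" for x
  proof -
    obtain j where j: "av x = av \<pi> powi j"
      using \<pi>(3) x by blast
    have frac: "av x = av \<pi> powi (int (ideal_ord Q a) - int (ideal_ord Q b))"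
      if "algebraic_int a" "a \<noteq> 0" "algebraic_int b" "b \<noteq> 0" "x = a / b" for a b
      using that pos by (simp add: hom_divide nm_divide ord_ex power_int_diff)
    have inj: "k = l" if "av \<pi> powi k = av \<pi> powi l" for k l
      using powi_le_iff[OF pos \<pi>(2), of k l] powi_le_iff[OF pos \<pi>(2), of l k] that by simp
    have "\<exists>a b. algebraic_int a \<and> a \<noteq> 0 \<and> algebraic_int b \<and> b \<noteq> 0 \<and> x = a / b"
    proof (cases "av x \<le> 1")
      case True
      then obtain c s where "algebraic_int c" "algebraic_int s" "av s = 1" "x = c / s"
        using ex_integral_fraction by blast
      then show ?thesis
        using x by (intro exI[of _ c] exI[of _ s]) auto
    next
      case False
      then have "av (inverse x) \<le> 1"
        by (simp add: hom_inverse nm_inverse inverse_le_1_iff)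
      then obtain c s where "algebraic_int c" "algebraic_int s" "av s = 1" "inverse x = c / s"
        using ex_integral_fraction by blast
      moreover from this have "x = s / c"
        by (metis inverse_divide inverse_inverse_eq)
      ultimately show ?thesis
        using x by (intro exI[of _ s] exI[of _ c]) auto
    qed
    then obtain a b where ab: "algebraic_int a" "a \<noteq> 0" "algebraic_int b" "b \<noteq> 0" "x = a / b"
      by blast
    have "adic_val Q x = j"
      unfolding adic_val_def
    proof (rule the_equality)
      have "j = int (ideal_ord Q a) - int (ideal_ord Q b)"
        using frac[OF ab] j inj by simp
      then show "\<exists>a b. algebraic_int a \<and> a \<noteq> 0 \<and> algebraic_int b \<and> b \<noteq> 0 \<and> x = a / b \<and>
          j = int (ideal_ord Q a) - int (ideal_ord Q b)"
        using ab by blast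
    next
      fix k
      assume "\<exists>a b. algebraic_int a \<and> a \<noteq> 0 \<and> algebraic_int b \<and> b \<noteq> 0 \<and> x = a / b \<and>
          k = int (ideal_ord Q a) - int (ideal_ord Q b)"
      then show "k = j"
        using frac j inj by metis
    qed
    then show ?thesis
      using j by simp
  qed
  \<comment> \<open>Chosen so that |\<pi>|^\<kappa> = 1/2, the value of \<open>adic_abs\<close> at
    an element of order 1.\<close>
  define \<kappa> where "\<kappa> = - ln 2 / ln (av \<pi>)"
  have "ln (av \<pi>) < 0"
    using pos \<pi>(2) by simp
  then have "\<kappa> > 0" and half: "av \<pi> powr \<kappa> = 1 / 2"
    using pos by (simp_all add: \<kappa>_def powr_def exp_minus divide_neg_neg field_simps)
  show ?thesis
  proof
    show "\<kappa> > 0" by fact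
    fix x
    show "adic_abs Q x = av x powr \<kappa>"
    proof (cases "x = 0")
      case True
      then show ?thesis
        by (simp add: adic_abs_def)
    next
      case False
      let ?k = "adic_val Q x"
      have "av x powr \<kappa> = (av \<pi> powr of_int ?k) powr \<kappa>"
        using val[OF False] pos by (simp add: powr_real_of_int')
      also have "\<dots> = (av \<pi> powr \<kappa>) powr of_int ?k"
        by (simp add: powr_powr mult.commute)
      also have "\<dots> = (1 / 2) powi ?k"
        unfolding half by (simp add: powr_real_of_int')
      also have "\<dots> = 2 powi (- ?k)"
        by (simp add: power_int_minus power_int_one_over inverse_eq_divide)
      finally show ?thesis
        using False by (simp add: adic_abs_def)
    qed
  qed
qed

definition kappa :: real where
  "kappa = (SOME \<kappa>. \<kappa> > 0 \<and> (\<forall>x. adic_abs Q x = av x powr \<kappa>))"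

lemma kappa: "kappa > 0" "adic_abs Q x = av x powr kappa"
proof -
  have "\<exists>\<kappa>. \<kappa> > 0 \<and> (\<forall>x. adic_abs Q x = av x powr \<kappa>)"
    using adic_abs_val_ideal by metis
  from someI_ex[OF this] show "kappa > 0" "adic_abs Q x = av x powr kappa"
    unfolding kappa_def by blast+
qed

end

section \<open>The completion as a closed subfield of \<open>\<complex>\<^sub>p\<close>\<close>

text \<open>The coset of the Cauchy sequences whose image under \<open>\<tau>\<close> tends to \<open>l\<close>; this identifies the
  completion with the closure of the range of \<open>\<tau>\<close>.\<close>

definition cls :: "('a \<Rightarrow> 'c::topological_space) \<Rightarrow> 'c \<Rightarrow> (nat \<Rightarrow> 'a) set" where
  "cls \<tau> l = {x. (\<lambda>n. \<tau> (x n)) \<longlonglongrightarrow> l}"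

context padic_embedding
begin

lemma powr_kappa_tendsto_0_iff:
  fixes f :: "nat \<Rightarrow> 'c"
  shows "(\<lambda>n. nm (f n) powr kappa) \<longlonglongrightarrow> 0 \<longleftrightarrow> (\<lambda>n. nm (f n)) \<longlonglongrightarrow> 0"
proof
  assume "(\<lambda>n. nm (f n) powr kappa) \<longlonglongrightarrow> 0"
  then have "(\<lambda>n. (nm (f n) powr kappa) powr (1 / kappa)) \<longlonglongrightarrow> 0 powr (1 / kappa)"
    using kappa(1) by (intro tendsto_powr') auto
  then show "(\<lambda>n. nm (f n)) \<longlonglongrightarrow> 0"
    using kappa(1) by (simp add: powr_powr)
next
  assume "(\<lambda>n. nm (f n)) \<longlonglongrightarrow> 0"
  then have "(\<lambda>n. nm (f n) powr kappa) \<longlonglongrightarrow> 0 powr kappa"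
    using kappa(1) by (intro tendsto_powr') auto
  then show "(\<lambda>n. nm (f n) powr kappa) \<longlonglongrightarrow> 0"
    by simp
qed

lemma powr_kappa_tendsto:
  fixes f :: "nat \<Rightarrow> 'c"
  assumes "f \<longlonglongrightarrow> l" shows "(\<lambda>n. nm (f n) powr kappa) \<longlonglongrightarrow> nm l powr kappa"
  using tendsto_nm[OF assms] kappa(1) by (intro tendsto_powr') auto

abbreviation K :: "'c set" where
  "K \<equiv> closure (range \<tau>)"

lemma K_iff: "l \<in> K \<longleftrightarrow> (\<exists>x. (\<lambda>n. \<tau> (x n)) \<longlonglongrightarrow> l)"
proof
  assume "l \<in> K"
  then obtain y where y: "\<And>n. y n \<in> range \<tau>" "y \<longlonglongrightarrow> l"
    unfolding closure_sequential by blast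
  then have "\<exists>x. y n = \<tau> x" for n
    by blast
  then obtain x where "\<And>n. y n = \<tau> (x n)"
    by metis
  then have "y = (\<lambda>n. \<tau> (x n))"
    by (rule ext)
  with y(2) show "\<exists>x. (\<lambda>n. \<tau> (x n)) \<longlonglongrightarrow> l"
    by blast
next
  assume "\<exists>x. (\<lambda>n. \<tau> (x n)) \<longlonglongrightarrow> l"
  then obtain x where "(\<lambda>n. \<tau> (x n)) \<longlonglongrightarrow> l"
    by blast
  then show "l \<in> K"
    unfolding closure_sequential by (intro exI[of _ "\<lambda>n. \<tau> (x n)"]) simp
qed

lemma K_ne: "l \<in> K \<Longrightarrow> cls \<tau> l \<noteq> {}"
  unfolding K_iff cls_def by blast

lemma K_hom [simp]: "\<tau> a \<in> K"
  using closure_subset[of "range \<tau>"] by blast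

lemma K_0 [simp]: "0 \<in> K"
  using K_hom[of 0] by simp

lemma K_1 [simp]: "1 \<in> K"
  using K_hom[of 1] by simp

lemma K_add: "l \<in> K \<Longrightarrow> m \<in> K \<Longrightarrow> l + m \<in> K"
proof -
  assume "l \<in> K" "m \<in> K"
  then obtain x y where "(\<lambda>n. \<tau> (x n)) \<longlonglongrightarrow> l" "(\<lambda>n. \<tau> (y n)) \<longlonglongrightarrow> m"
    unfolding K_iff by blast
  then have "(\<lambda>n. \<tau> (x n + y n)) \<longlonglongrightarrow> l + m"
    unfolding hom_add by (rule tendsto_add_nm)
  then show ?thesis
    unfolding K_iff by (rule exI[of _ "\<lambda>n. x n + y n"])
qed

lemma K_mult: "l \<in> K \<Longrightarrow> m \<in> K \<Longrightarrow> l * m \<in> K"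
proof -
  assume "l \<in> K" "m \<in> K"
  then obtain x y where "(\<lambda>n. \<tau> (x n)) \<longlonglongrightarrow> l" "(\<lambda>n. \<tau> (y n)) \<longlonglongrightarrow> m"
    unfolding K_iff by blast
  then have "(\<lambda>n. \<tau> (x n * y n)) \<longlonglongrightarrow> l * m"
    unfolding hom_mult by (rule tendsto_mult_nm)
  then show ?thesis
    unfolding K_iff by (rule exI[of _ "\<lambda>n. x n * y n"])
qed

lemma K_minus: "l \<in> K \<Longrightarrow> - l \<in> K"
  using K_mult[OF K_hom[of "- 1"], of l] by (simp add: hom_minus)

lemma K_diff: "l \<in> K \<Longrightarrow> m \<in> K \<Longrightarrow> l - m \<in> K"
  using K_add[of l "- m"] K_minus[of m] by simp

lemma K_power: "l \<in> K \<Longrightarrow> l ^ n \<in> K"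
  by (induction n) (simp_all add: K_mult)

lemma K_limit: "(\<And>n. f n \<in> K) \<Longrightarrow> f \<longlonglongrightarrow> l \<Longrightarrow> l \<in> K"
  by (metis closed_closure closed_sequentially)

lemma cls_eq_iff: "l \<in> K \<Longrightarrow> cls \<tau> l = cls \<tau> m \<longleftrightarrow> l = m"
proof
  assume "l \<in> K" and eq: "cls \<tau> l = cls \<tau> m"
  then obtain x where "x \<in> cls \<tau> l"
    using K_ne by blast
  then have "(\<lambda>n. \<tau> (x n)) \<longlonglongrightarrow> l" "(\<lambda>n. \<tau> (x n)) \<longlonglongrightarrow> m"
    using eq by (auto simp: cls_def)
  then show "l = m"
    by (rule LIMSEQ_unique)
qed simp

abbreviation R :: "(nat \<Rightarrow> 'a) ring" where
  "R \<equiv> cauchy_ring (adic_abs Q)"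

text \<open>The two absolute values differ by the exponent \<open>kappa\<close>, and C_p is
  complete.\<close>

lemma Cauchy_iff_tau:
  "(\<forall>e>0. \<exists>N. \<forall>m\<ge>N. \<forall>n\<ge>N. adic_abs Q (x m - x n) < e) \<longleftrightarrow> (\<exists>l. (\<lambda>n. \<tau> (x n)) \<longlonglongrightarrow> l)"
proof -
  have abs: "adic_abs Q (x m - x n) = dist (\<tau> (x m)) (\<tau> (x n)) powr kappa" for m n
    by (simp add: kappa(2) dist_eq_nm hom_diff)
  have "(\<forall>e>0. \<exists>N. \<forall>m\<ge>N. \<forall>n\<ge>N. adic_abs Q (x m - x n) < e) \<longleftrightarrow> Cauchy (\<lambda>n. \<tau> (x n))"
    unfolding abs Cauchy_def
  proof safe
    fix e :: real assume e: "e > 0"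
      and *: "\<forall>e>0. \<exists>N. \<forall>m\<ge>N. \<forall>n\<ge>N. dist (\<tau> (x m)) (\<tau> (x n)) powr kappa < e"
    have "e powr kappa > 0"
      using e by simp
    with * obtain N where N: "\<And>m n. m \<ge> N \<Longrightarrow> n \<ge> N \<Longrightarrow> dist (\<tau> (x m)) (\<tau> (x n)) powr kappa < e powr kappa"
      by meson
    have "dist (\<tau> (x m)) (\<tau> (x n)) < e" if "m \<ge> N" "n \<ge> N" for m n
      using N[OF that] powr_mono2[of kappa e "dist (\<tau> (x m)) (\<tau> (x n))"] e kappa(1) by fastforce
    then show "\<exists>N. \<forall>m\<ge>N. \<forall>n\<ge>N. dist (\<tau> (x m)) (\<tau> (x n)) < e"
      by blast
  next
    fix e :: real assume e: "e > 0"
      and *: "\<forall>e>0. \<exists>N. \<forall>m\<ge>N. \<forall>n\<ge>N. dist (\<tau> (x m)) (\<tau> (x n)) < e"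
    have "e powr (1 / kappa) > 0"
      using e by simp
    with * obtain N where N: "\<And>m n. m \<ge> N \<Longrightarrow> n \<ge> N \<Longrightarrow> dist (\<tau> (x m)) (\<tau> (x n)) < e powr (1 / kappa)"
      by meson
    have "dist (\<tau> (x m)) (\<tau> (x n)) powr kappa < e" if "m \<ge> N" "n \<ge> N" for m n
    proof -
      have "dist (\<tau> (x m)) (\<tau> (x n)) powr kappa < (e powr (1 / kappa)) powr kappa"
        using N[OF that] kappa(1) by (intro powr_less_mono2) auto
      then show ?thesis
        using e kappa(1) by (simp add: powr_powr)
    qed
    then show "\<exists>N. \<forall>m\<ge>N. \<forall>n\<ge>N. dist (\<tau> (x m)) (\<tau> (x n)) powr kappa < e"
      by blast
  qed
  also have "\<dots> \<longleftrightarrow> (\<exists>l. (\<lambda>n. \<tau> (x n)) \<longlonglongrightarrow> l)"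
    unfolding Cauchy_convergent_iff convergent_def ..
  finally show ?thesis .
qed

lemma R_simps:
  "carrier R = {x. \<exists>l. (\<lambda>n. \<tau> (x n)) \<longlonglongrightarrow> l}"
  "x \<otimes>\<^bsub>R\<^esub> y = (\<lambda>n. x n * y n)" "x \<oplus>\<^bsub>R\<^esub> y = (\<lambda>n. x n + y n)"
  "\<one>\<^bsub>R\<^esub> = (\<lambda>_. 1)" "\<zero>\<^bsub>R\<^esub> = (\<lambda>_. 0)"
  by (simp_all add: cauchy_ring_def Cauchy_iff_tau)

lemma null_seqs_eq: "null_seqs (adic_abs Q) = cls \<tau> 0"
proof -
  have "(\<lambda>n. adic_abs Q (x n)) \<longlonglongrightarrow> 0 \<longleftrightarrow> (\<lambda>n. \<tau> (x n)) \<longlonglongrightarrow> 0" for x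
    using powr_kappa_tendsto_0_iff[of "\<lambda>n. \<tau> (x n)"] tendsto_iff_nm[of "\<lambda>n. \<tau> (x n)" 0 sequentially]
    by (simp add: kappa(2))
  then show ?thesis
    by (auto simp: null_seqs_def cls_def R_simps)
qed

text \<open>Two sequences whose images have the same limit differ by a null sequence; so the
  elements of the factor ring are the sets \<open>cls \<tau> l\<close> with \<open>l\<close> in
  \<open>K\<close>.\<close>

lemma coset_eq:
  assumes "x \<in> cls \<tau> l" shows "cls \<tau> 0 +>\<^bsub>R\<^esub> x = cls \<tau> l"
proof -
  have x: "(\<lambda>n. \<tau> (x n)) \<longlonglongrightarrow> l"
    using assms by (simp add: cls_def)
  have "cls \<tau> 0 +>\<^bsub>R\<^esub> x = {(\<lambda>n. h n + x n) | h. h \<in> cls \<tau> 0}"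
    by (auto simp: a_r_coset_def r_coset_def R_simps)
  also have "\<dots> = cls \<tau> l"
  proof safe
    fix h assume "h \<in> cls \<tau> 0"
    then have "(\<lambda>n. \<tau> (h n + x n)) \<longlonglongrightarrow> 0 + l"
      unfolding hom_add using x by (intro tendsto_add_nm) (simp_all add: cls_def)
    then show "(\<lambda>n. h n + x n) \<in> cls \<tau> l"
      by (simp add: cls_def)
  next
    fix y assume "y \<in> cls \<tau> l"
    then have "(\<lambda>n. \<tau> (y n - x n)) \<longlonglongrightarrow> l - l"
      unfolding hom_diff using x by (intro tendsto_diff_nm) (simp_all add: cls_def)
    then have "(\<lambda>n. y n - x n) \<in> cls \<tau> 0"
      by (simp add: cls_def)
    then show "\<exists>h. y = (\<lambda>n. h n + x n) \<and> h \<in> cls \<tau> 0"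
      by (intro exI[of _ "\<lambda>n. y n - x n"]) auto
  qed
  finally show ?thesis .
qed

lemma local_embed_eq: "local_embed Q a = cls \<tau> (\<tau> a)"
  unfolding local_embed_def completion_embed_def null_seqs_eq
  by (rule coset_eq) (simp add: cls_def)

lemma carrier_local_field: "carrier (local_field Q) = cls \<tau> ` K"
proof -
  have "carrier (local_field Q) = (\<lambda>x. cls \<tau> 0 +>\<^bsub>R\<^esub> x) ` carrier R"
    by (auto simp: local_field_def completion_def FactRing_def A_RCOSETS_def RCOSETS_def a_r_coset_def null_seqs_eq)
  also have "\<dots> = cls \<tau> ` K"
  proof safe
    fix x assume "x \<in> carrier R"
    then obtain l where "(\<lambda>n. \<tau> (x n)) \<longlonglongrightarrow> l"
      by (auto simp: R_simps)
    then have "cls \<tau> 0 +>\<^bsub>R\<^esub> x = cls \<tau> l" "l \<in> K"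
      using coset_eq[of x l] K_iff by (auto simp: cls_def)
    then show "cls \<tau> 0 +>\<^bsub>R\<^esub> x \<in> cls \<tau> ` K"
      by blast
  next
    fix l assume "l \<in> K"
    then obtain x where x: "(\<lambda>n. \<tau> (x n)) \<longlonglongrightarrow> l"
      by (auto simp: K_iff)
    then have "cls \<tau> l = cls \<tau> 0 +>\<^bsub>R\<^esub> x" "x \<in> carrier R"
      using coset_eq[of x l] by (auto simp: cls_def R_simps)
    then show "cls \<tau> l \<in> (\<lambda>x. cls \<tau> 0 +>\<^bsub>R\<^esub> x) ` carrier R"
      by blast
  qed
  finally show ?thesis .
qed

lemma local_field_simps:
  "\<one>\<^bsub>local_field Q\<^esub> = cls \<tau> 1" "\<zero>\<^bsub>local_field Q\<^esub> = cls \<tau> 0"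
proof -
  have "cls \<tau> 0 +>\<^bsub>R\<^esub> (\<lambda>_. 1) = cls \<tau> 1"
    by (rule coset_eq) (simp add: cls_def)
  then show "\<one>\<^bsub>local_field Q\<^esub> = cls \<tau> 1"
    by (simp add: local_field_def completion_def FactRing_def null_seqs_eq R_simps)
  show "\<zero>\<^bsub>local_field Q\<^esub> = cls \<tau> 0"
    by (simp add: local_field_def completion_def FactRing_def null_seqs_eq)
qed

lemma local_field_mult:
  assumes "l \<in> K" "m \<in> K"
  shows "cls \<tau> l \<otimes>\<^bsub>local_field Q\<^esub> cls \<tau> m = cls \<tau> (l * m)"
proof -
  have "cls \<tau> 0 +>\<^bsub>R\<^esub> (x \<otimes>\<^bsub>R\<^esub> y) = cls \<tau> (l * m)" if "x \<in> cls \<tau> l" "y \<in> cls \<tau> m" for x y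
    using that by (intro coset_eq) (auto simp: cls_def R_simps hom_mult intro: tendsto_mult_nm)
  \<comment> \<open>The product of cosets in the factor ring is a union over pairs of
    representatives, each contributing the same coset; the union equals that coset because the
    classes of elements of \<open>K\<close> are nonempty.\<close>
  then have "rcoset_mult R (cls \<tau> 0) (cls \<tau> l) (cls \<tau> m) = (\<Union>x\<in>cls \<tau> l. \<Union>y\<in>cls \<tau> m. cls \<tau> (l * m))"
    unfolding rcoset_mult_def by (intro SUP_cong refl)
  also have "\<dots> = cls \<tau> (l * m)"
    using K_ne assms by simp
  finally show ?thesis
    by (simp add: local_field_def completion_def FactRing_def null_seqs_eq)
qed

lemma local_field_add:
  assumes "l \<in> K" "m \<in> K"
  shows "cls \<tau> l \<oplus>\<^bsub>local_field Q\<^esub> cls \<tau> m = cls \<tau> (l + m)"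
proof -
  have "set_add R (cls \<tau> l) (cls \<tau> m) = (\<Union>x\<in>cls \<tau> l. \<Union>y\<in>cls \<tau> m. {\<lambda>n. x n + y n})"
    by (simp add: set_add_def set_mult_def R_simps)
  also have "\<dots> = cls \<tau> (l + m)"
  proof safe
    fix x y assume "x \<in> cls \<tau> l" "y \<in> cls \<tau> m"
    then show "(\<lambda>n. x n + y n) \<in> cls \<tau> (l + m)"
      by (auto simp: cls_def hom_add intro: tendsto_add_nm)
  next
    fix z assume z: "z \<in> cls \<tau> (l + m)"
    obtain x where x: "x \<in> cls \<tau> l"
      using K_ne[OF assms(1)] by blast
    have "(\<lambda>n. \<tau> (z n - x n)) \<longlonglongrightarrow> (l + m) - l"
      unfolding hom_diff using z x by (intro tendsto_diff_nm) (simp_all add: cls_def)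
    then have "(\<lambda>n. z n - x n) \<in> cls \<tau> m"
      by (simp add: cls_def)
    then show "z \<in> (\<Union>x\<in>cls \<tau> l. \<Union>y\<in>cls \<tau> m. {\<lambda>n. x n + y n})"
      using x by (intro UN_I[of x] UN_I[of "\<lambda>n. z n - x n"]) auto
  qed
  finally show ?thesis
    by (simp add: local_field_def completion_def FactRing_def)
qed

lemma local_field_minus:
  assumes "l \<in> K" "m \<in> K"
  shows "cls \<tau> l \<ominus>\<^bsub>local_field Q\<^esub> cls \<tau> m = cls \<tau> (l - m)"
proof -
  have "\<ominus>\<^bsub>local_field Q\<^esub> cls \<tau> m = cls \<tau> (- m)"
    unfolding a_inv_def m_inv_def
  proof (rule the_equality)
    show "cls \<tau> (- m) \<in> carrier (add_monoid (local_field Q)) \<and>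
        cls \<tau> m \<otimes>\<^bsub>add_monoid (local_field Q)\<^esub> cls \<tau> (- m) = \<one>\<^bsub>add_monoid (local_field Q)\<^esub> \<and>
        cls \<tau> (- m) \<otimes>\<^bsub>add_monoid (local_field Q)\<^esub> cls \<tau> m = \<one>\<^bsub>add_monoid (local_field Q)\<^esub>"
      using assms(2) K_minus[OF assms(2)] by (simp add: carrier_local_field local_field_add local_field_simps)
    fix y
    assume y: "y \<in> carrier (add_monoid (local_field Q)) \<and>
        cls \<tau> m \<otimes>\<^bsub>add_monoid (local_field Q)\<^esub> y = \<one>\<^bsub>add_monoid (local_field Q)\<^esub> \<and>
        y \<otimes>\<^bsub>add_monoid (local_field Q)\<^esub> cls \<tau> m = \<one>\<^bsub>add_monoid (local_field Q)\<^esub>"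
    then obtain k where k: "k \<in> K" "y = cls \<tau> k"
      by (auto simp: carrier_local_field)
    then have "cls \<tau> (m + k) = cls \<tau> 0"
      using y assms(2) by (simp add: local_field_add local_field_simps)
    then have "m + k = 0"
      using cls_eq_iff[of "m + k" 0] K_add[OF assms(2) k(1)] by simp
    then have "k = - m"
      by (simp add: eq_neg_iff_add_eq_0 add.commute)
    then show "y = cls \<tau> (- m)"
      by (simp add: k)
  qed
  then show ?thesis
    unfolding a_minus_def using local_field_add[OF assms(1) K_minus[OF assms(2)]] by simp
qed

lemma local_field_power:
  assumes "l \<in> K" shows "cls \<tau> l [^]\<^bsub>local_field Q\<^esub> (n::nat) = cls \<tau> (l ^ n)"
proof (induction n)
  case 0
  show ?case
    by (simp add: nat_pow_def local_field_simps)
next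
  case (Suc n)
  then have "cls \<tau> l [^]\<^bsub>local_field Q\<^esub> Suc n = cls \<tau> (l ^ n) \<otimes>\<^bsub>local_field Q\<^esub> cls \<tau> l"
    by (simp add: nat_pow_def)
  also have "\<dots> = cls \<tau> (l ^ Suc n)"
    using local_field_mult[OF K_power[OF assms] assms] by (simp add: mult.commute)
  finally show ?case .
qed

section \<open>Absolute value, metric and principal units of the local field\<close>

lemma local_abs_eq:
  assumes "l \<in> K" shows "local_abs Q (cls \<tau> l) = nm l powr kappa"
  unfolding local_abs_def completion_abs_def
proof (rule the_equality)
  have lim: "(\<lambda>n. adic_abs Q (x n)) \<longlonglongrightarrow> nm l powr kappa" if "x \<in> cls \<tau> l" for x
    unfolding kappa(2) using that by (intro powr_kappa_tendsto) (simp add: cls_def)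
  then show "\<exists>x\<in>cls \<tau> l. (\<lambda>n. adic_abs Q (x n)) \<longlonglongrightarrow> nm l powr kappa"
    using K_ne[OF assms] by blast
  fix r assume "\<exists>x\<in>cls \<tau> l. (\<lambda>n. adic_abs Q (x n)) \<longlonglongrightarrow> r"
  then obtain x where "x \<in> cls \<tau> l" "(\<lambda>n. adic_abs Q (x n)) \<longlonglongrightarrow> r"
    by blast
  then show "r = nm l powr kappa"
    using lim LIMSEQ_unique by blast
qed

lemma local_dist_eq:
  assumes "l \<in> K" "m \<in> K" shows "local_dist Q (cls \<tau> l) (cls \<tau> m) = nm (l - m) powr kappa"
  using assms by (simp add: local_dist_def carrier_local_field local_field_minus local_abs_eq K_diff)

lemma local_dist_tendsto_0_iff:
  assumes "\<And>k. f k \<in> K" "l \<in> K"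
  shows "(\<lambda>k. local_dist Q (cls \<tau> (f k)) (cls \<tau> l)) \<longlonglongrightarrow> 0 \<longleftrightarrow> f \<longlonglongrightarrow> l"
  using powr_kappa_tendsto_0_iff[of "\<lambda>k. f k - l"] tendsto_iff_nm[of f l sequentially] assms
  by (simp add: local_dist_eq)

lemma Metric_space_local:
  assumes "S \<subseteq> carrier (local_field Q)"
  shows "Metric_space S (local_dist Q)"
proof
  fix A B
  show "0 \<le> local_dist Q A B"
    by (auto simp: local_dist_def carrier_local_field local_field_minus local_abs_eq K_diff)
  show "local_dist Q A B = local_dist Q B A"
    by (auto simp: local_dist_def carrier_local_field local_field_minus local_abs_eq K_diff nm_minus_commute)
next
  fix A B assume "A \<in> S" "B \<in> S"
  then have "A \<in> cls \<tau> ` K" "B \<in> cls \<tau> ` K"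
    using assms by (auto simp: carrier_local_field)
  then obtain l m where lm: "l \<in> K" "A = cls \<tau> l" "m \<in> K" "B = cls \<tau> m"
    by (elim imageE)
  then show "local_dist Q A B = 0 \<longleftrightarrow> A = B"
    by (simp add: local_dist_eq cls_eq_iff)
next
  fix A B C assume "A \<in> S" "B \<in> S" "C \<in> S"
  then have "A \<in> cls \<tau> ` K" "B \<in> cls \<tau> ` K" "C \<in> cls \<tau> ` K"
    using assms by (auto simp: carrier_local_field)
  then obtain l m k where lmk: "l \<in> K" "A = cls \<tau> l" "m \<in> K" "B = cls \<tau> m" "k \<in> K" "C = cls \<tau> k"
    by (elim imageE)
  have "nm (l - k) \<le> max (nm (l - m)) (nm (m - k))"
    using nm_add[of "l - m" "m - k"] by simp
  then have "nm (l - k) \<le> nm (l - m) \<or> nm (l - k) \<le> nm (m - k)"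
    by auto
  then have "nm (l - k) powr kappa \<le> nm (l - m) powr kappa \<or> nm (l - k) powr kappa \<le> nm (m - k) powr kappa"
    using kappa(1) by (auto intro: powr_mono2)
  then have "nm (l - k) powr kappa \<le> nm (l - m) powr kappa + nm (m - k) powr kappa"
    by (smt (verit) powr_ge_zero)
  then show "local_dist Q A C \<le> local_dist Q A B + local_dist Q B C"
    using lmk by (simp add: local_dist_eq)
qed

lemma powr_kappa_le_1: "x \<ge> 0 \<Longrightarrow> x powr kappa \<le> 1 \<longleftrightarrow> x \<le> 1"
proof (cases "x \<le> 1")
  case False
  then have "1 powr kappa < x powr kappa"
    using kappa(1) by (intro powr_less_mono2) auto
  with False show ?thesis
    by simp
qed (use powr_mono2[of kappa x 1] kappa(1) in auto)

lemma powr_kappa_less_1: "x \<ge> 0 \<Longrightarrow> x powr kappa < 1 \<longleftrightarrow> x < 1"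
proof (cases "x < 1")
  case True
  assume "x \<ge> 0"
  then have "x powr kappa < 1 powr kappa"
    using True kappa(1) by (intro powr_less_mono2) auto
  with True show ?thesis
    by simp
qed (use powr_mono2[of kappa 1 x] kappa(1) in auto)

lemma local_integers_carrier: "carrier (local_integers Q) = cls \<tau> ` {l \<in> K. nm l \<le> 1}"
  by (auto simp: local_integers_def carrier_local_field local_abs_eq powr_kappa_le_1)

lemma open_unit_ball: "{A \<in> carrier (local_field Q). local_abs Q A < 1} = cls \<tau> ` {l \<in> K. nm l < 1}"
  by (auto simp: carrier_local_field local_abs_eq powr_kappa_less_1)

text \<open>An element of the range of \<tau> close enough to \<open>l\<close> has the same absolute
  value: completion does not enlarge the value group.\<close>

lemma K_value:
  assumes "l \<in> K" "l \<noteq> 0" shows "\<exists>a. a \<noteq> 0 \<and> nm l = av a"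
proof -
  obtain x where "(\<lambda>n. \<tau> (x n)) \<longlonglongrightarrow> l"
    using assms(1) K_iff by blast
  then have "(\<lambda>n. nm (\<tau> (x n) - l)) \<longlonglongrightarrow> 0"
    by (simp add: tendsto_iff_nm)
  moreover have "nm l > 0"
    using assms(2) by simp
  ultimately have "\<forall>\<^sub>F n in sequentially. nm (\<tau> (x n) - l) < nm l"
    by (rule order_tendstoD(2))
  then obtain n where "nm (\<tau> (x n) - l) < nm l"
    by (auto simp: eventually_sequentially)
  then have "nm (\<tau> (x n)) = nm l"
    using nm_diff_eq[of l "\<tau> (x n)"] by (simp add: nm_minus_commute)
  then show ?thesis
    using assms(2) by (intro exI[of _ "x n"]) auto
qed

lemma uniformizer_in_ball:
  assumes "uniformizer Q \<pi>" obtains l where "\<pi> = cls \<tau> l" "l \<in> K" "nm l < 1"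
proof -
  have "\<pi> \<in> carrier (local_integers Q)"
    using assms by (simp add: uniformizer_def)
  then obtain l where l: "\<pi> = cls \<tau> l" "l \<in> K"
    by (auto simp: local_integers_carrier)
  have "cls \<tau> 1 \<in> carrier (local_integers Q)"
    by (auto simp: local_integers_carrier)
  moreover have "cls \<tau> 1 \<otimes>\<^bsub>local_integers Q\<^esub> \<pi> = \<pi>"
    using l local_field_mult[of 1 l] by (simp add: local_integers_def)
  ultimately have "\<pi> \<in> PIdl\<^bsub>local_integers Q\<^esub> \<pi>"
    unfolding cgenideal_def by (metis (mono_tags, lifting) mem_Collect_eq)
  then have "\<pi> \<in> cls \<tau> ` {l \<in> K. nm l < 1}"
    using assms by (simp add: uniformizer_def open_unit_ball)
  then show ?thesis
    using that by blast
qed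

text \<open>Since the value group is that of the number field, a uniformizing element of the latter
  has the largest absolute value below 1 in the completion as well, and every element of the open
  disc is divisible by it.\<close>

lemma ex_uniformizer:
  obtains a where "uniformizer Q (cls \<tau> (\<tau> a))" "a \<noteq> 0" "\<forall>l\<in>K. nm l < 1 \<longrightarrow> nm l \<le> av a"
proof -
  obtain a where a: "uniformizing a"
    using ex_uniformizing by blast
  then have a0: "a \<noteq> 0" and a1: "av a < 1"
    by (simp_all add: uniformizing_def)
  have le: "nm l \<le> av a" if l: "l \<in> K" "nm l < 1" for l
  proof (cases "l = 0")
    case False
    then obtain b where b: "b \<noteq> 0" "nm l = av b"
      using K_value[OF l(1)] by blast
    then obtain j where j: "nm l = av a powi j"
      using a by (auto simp: uniformizing_def)
    have pos: "0 < av a"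
      using a0 by simp
    have "j > 0"
    proof (rule ccontr)
      assume "\<not> j > 0"
      then have "av a powi 0 \<le> av a powi j"
        using powi_le_iff[OF pos a1, of 0 j] by simp
      then show False
        using l(2) j by simp
    qed
    then have "av a powi j \<le> av a powi 1"
      using powi_le_iff[OF pos a1, of j 1] by simp
    then show ?thesis
      by (simp add: j)
  qed simp
  have "PIdl\<^bsub>local_integers Q\<^esub> (cls \<tau> (\<tau> a)) = cls \<tau> ` {l \<in> K. nm l < 1}"
  proof safe
    fix A assume "A \<in> PIdl\<^bsub>local_integers Q\<^esub> (cls \<tau> (\<tau> a))"
    then obtain l where l: "l \<in> K" "nm l \<le> 1" "A = cls \<tau> l \<otimes>\<^bsub>local_field Q\<^esub> cls \<tau> (\<tau> a)"
      unfolding cgenideal_def local_integers_carrier by (auto simp: local_integers_def)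
    have "A = cls \<tau> (l * \<tau> a)" "l * \<tau> a \<in> K"
      using l local_field_mult[OF l(1) K_hom] K_mult[OF l(1) K_hom] by auto
    moreover have "nm (l * \<tau> a) < 1"
      using l(2) a1 mult_right_mono[OF l(2), of "av a"] by (simp add: nm_mult)
    ultimately show "A \<in> cls \<tau> ` {l \<in> K. nm l < 1}"
      by blast
  next
    fix l assume l: "l \<in> K" "nm l < 1"
    define m where "m = l / \<tau> a"
    have m: "m \<in> K" "nm m \<le> 1" "m * \<tau> a = l"
      using le[OF l] a0 K_mult[OF l(1) K_hom[of "inverse a"]]
      by (simp_all add: m_def nm_divide hom_inverse divide_inverse[symmetric])
    have "cls \<tau> l = cls \<tau> m \<otimes>\<^bsub>local_field Q\<^esub> cls \<tau> (\<tau> a)"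
      using local_field_mult[OF m(1) K_hom] m(3) by simp
    moreover have "cls \<tau> m \<in> carrier (local_integers Q)"
      using m by (auto simp: local_integers_carrier)
    ultimately show "cls \<tau> l \<in> PIdl\<^bsub>local_integers Q\<^esub> (cls \<tau> (\<tau> a))"
      unfolding cgenideal_def by (auto simp: local_integers_def)
  qed
  then have "uniformizer Q (cls \<tau> (\<tau> a))"
    using a1 by (auto simp: uniformizer_def open_unit_ball local_integers_carrier)
  then show ?thesis
    using that a0 le by blast
qed

lemma principal_units_eq: "principal_units Q = cls \<tau> ` {l \<in> K. nm (l - 1) < 1}"
proof safe
  fix A assume "A \<in> principal_units Q"
  then obtain \<pi> B where A: "A = \<one>\<^bsub>local_field Q\<^esub> \<oplus>\<^bsub>local_field Q\<^esub> \<pi> \<otimes>\<^bsub>local_field Q\<^esub> B"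
    and \<pi>: "uniformizer Q \<pi>" and B: "B \<in> carrier (local_integers Q)"
    unfolding principal_units_def by blast
  obtain l where l: "\<pi> = cls \<tau> l" "l \<in> K" "nm l < 1"
    using uniformizer_in_ball[OF \<pi>] .
  obtain m where m: "B = cls \<tau> m" "m \<in> K" "nm m \<le> 1"
    using B by (auto simp: local_integers_carrier)
  have "A = cls \<tau> (1 + l * m)"
    unfolding A l m local_field_simps using l m by (simp add: local_field_mult local_field_add K_mult)
  moreover have "nm (l * m) < 1"
    using l m mult_left_mono[OF m(3), of "nm l"] by (simp add: nm_mult)
  moreover have "1 + l * m \<in> K"
    using l m by (simp add: K_add K_mult)
  ultimately show "A \<in> cls \<tau> ` {l \<in> K. nm (l - 1) < 1}"
    by (intro image_eqI[of _ _ "1 + l * m"]) auto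
next
  fix l assume l: "l \<in> K" "nm (l - 1) < 1"
  obtain a where a: "uniformizer Q (cls \<tau> (\<tau> a))" "a \<noteq> 0" "\<forall>l\<in>K. nm l < 1 \<longrightarrow> nm l \<le> av a"
    using ex_uniformizer by blast
  define m where "m = (l - 1) / \<tau> a"
  have lK: "l - 1 \<in> K"
    using l by (simp add: K_diff)
  then have m: "m \<in> K"
    using K_mult[OF lK K_hom[of "inverse a"]] by (simp add: m_def hom_inverse divide_inverse[symmetric])
  have "nm m \<le> 1"
    using a(2,3) lK l(2) by (simp add: m_def nm_divide)
  moreover have "\<tau> a * m = l - 1"
    using a(2) by (simp add: m_def)
  ultimately have "cls \<tau> l = \<one>\<^bsub>local_field Q\<^esub> \<oplus>\<^bsub>local_field Q\<^esub> cls \<tau> (\<tau> a) \<otimes>\<^bsub>local_field Q\<^esub> cls \<tau> m"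
    and "cls \<tau> m \<in> carrier (local_integers Q)"
    using m lK by (auto simp: local_field_simps local_field_mult local_field_add local_integers_carrier)
  then show "cls \<tau> l \<in> principal_units Q"
    unfolding principal_units_def using a(1) by blast
qed

end

section \<open>Powers of principal units with p-adic exponents\<close>

context padic_complex
begin

lemma dvd_if_nm_of_int_le:
  assumes "nm (of_int n :: 'c) \<le> (1 / real p) ^ N" shows "int p ^ N dvd n"
proof (cases "n = 0")
  case False
  define k where "k = multiplicity (int p) n"
  obtain m where m: "n = int p ^ k * m" "\<not> int p dvd m"
    using multiplicity_decompose'[of n "int p"] False p_gt_1 unfolding k_def by auto
  have "nm (of_int n :: 'c) = (1 / real p) ^ k"
    using nm_of_int_eq_1[OF m(2)] by (simp add: m(1) nm_mult nm_power nm_p)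
  then have "(1 / real p) ^ k \<le> (1 / real p) ^ N"
    using assms by simp
  then have "N \<le> k"
    using p_gt_1 by (subst (asm) power_decreasing_iff) auto
  then show ?thesis
    unfolding m(1) by (intro dvd_mult2 le_imp_power_dvd)
qed simp

lemma nm_power_minus_1_le: "nm y \<le> 1 \<Longrightarrow> nm (y ^ m - 1) \<le> nm (y - 1)" for y :: 'c
proof -
  assume y: "nm y \<le> 1"
  have "nm (\<Sum>i<m. y ^ i) \<le> 1"
    using y by (intro nm_sum_le) (auto simp: nm_power power_le_one)
  then have "nm (y - 1) * nm (\<Sum>i<m. y ^ i) \<le> nm (y - 1) * 1"
    by (intro mult_left_mono) auto
  then show ?thesis
    unfolding power_diff_1_eq nm_mult by simp
qed

text \<open>u^(p^N) tends to 1, so exponents congruent modulo p^N give nearby powers. This is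
  uniform continuity of exponentiation in the p-adic metric on the exponents.\<close>

lemma power_uniform:
  assumes u: "nm (u - 1 :: 'c) < 1" and e: "e > 0"
  obtains N where "\<And>a b. nm (of_nat a - of_nat b :: 'c) \<le> (1 / real p) ^ N \<Longrightarrow> nm (u ^ a - u ^ b) < e"
proof -
  have "\<forall>\<^sub>F N in sequentially. nm (u ^ (p ^ N) - 1) < e"
    using tendsto_nm[OF power_p_power_tendsto_1[OF u]] e by (intro order_tendstoD(2)) auto
  then obtain N where N: "nm (u ^ (p ^ N) - 1) < e"
    by (auto simp: eventually_sequentially)
  have u1: "nm u = 1"
    using u by (rule nm_close_1)
  have *: "nm (u ^ a - u ^ b) < e" if ab: "nm (of_nat a - of_nat b :: 'c) \<le> (1 / real p) ^ N" "b \<le> a" for a b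
  proof -
    have "nm (of_int (int a - int b) :: 'c) \<le> (1 / real p) ^ N"
      using ab(1) by simp
    then have "int (p ^ N) dvd int (a - b)"
      using dvd_if_nm_of_int_le[of "int a - int b" N] ab(2) by (simp add: of_nat_diff)
    then obtain m where m: "a - b = p ^ N * m"
      unfolding of_nat_dvd_iff by blast
    then have a: "a = b + p ^ N * m"
      using ab(2) by simp
    have "u ^ a - u ^ b = u ^ b * ((u ^ (p ^ N)) ^ m - 1)"
      unfolding a power_add power_mult by (simp add: right_diff_distrib)
    then have "nm (u ^ a - u ^ b) = nm ((u ^ (p ^ N)) ^ m - 1)"
      by (simp add: nm_mult nm_power u1)
    also have "\<dots> \<le> nm (u ^ (p ^ N) - 1)"
      by (intro nm_power_minus_1_le) (simp add: nm_power u1)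
    finally show ?thesis
      using N by simp
  qed
  show ?thesis
  proof
    fix a b :: nat assume "nm (of_nat a - of_nat b :: 'c) \<le> (1 / real p) ^ N"
    then show "nm (u ^ a - u ^ b) < e"
      using *[of a b] *[of b a] nm_minus_commute[of "u ^ a"] nm_minus_commute[of "of_nat a"]
      by (cases "b \<le> a") auto
  qed
qed

lemma power_difference_tendsto_0:
  assumes u: "nm (u - 1 :: 'c) < 1"
    and lim: "(\<lambda>k. of_nat (n k)) \<longlonglongrightarrow> (\<zeta> :: 'c)" "(\<lambda>k. of_nat (m k)) \<longlonglongrightarrow> \<zeta>"
  shows "(\<lambda>k. u ^ n k - u ^ m k) \<longlonglongrightarrow> 0"
  unfolding tendsto_iff_nm diff_0_right
proof (rule order_tendstoI)
  fix e :: real assume e: "0 < e"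
  obtain N where N: "\<And>a b. nm (of_nat a - of_nat b :: 'c) \<le> (1 / real p) ^ N \<Longrightarrow> nm (u ^ a - u ^ b) < e"
    using power_uniform[OF u e] by metis
  have "(\<lambda>k. nm (of_nat (n k) - of_nat (m k) :: 'c)) \<longlonglongrightarrow> nm (\<zeta> - \<zeta>)"
    by (intro tendsto_nm tendsto_diff_nm lim)
  then have "\<forall>\<^sub>F k in sequentially. nm (of_nat (n k) - of_nat (m k) :: 'c) < (1 / real p) ^ N"
    using p_gt_1 by (intro order_tendstoD(2)) auto
  then show "\<forall>\<^sub>F k in sequentially. nm (u ^ n k - u ^ m k) < e"
    by eventually_elim (simp add: N)
next
  fix e :: real assume "e < 0"
  then show "\<forall>\<^sub>F k in sequentially. e < nm (u ^ n k - u ^ m k)"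
    by (simp add: less_le_trans)
qed

lemma power_convergent:
  assumes u: "nm (u - 1 :: 'c) < 1" and lim: "(\<lambda>k. of_nat (n k)) \<longlonglongrightarrow> (\<zeta> :: 'c)"
  shows "\<exists>w. (\<lambda>k. u ^ n k) \<longlonglongrightarrow> w"
proof -
  have "Cauchy (\<lambda>k. u ^ n k)"
  proof (rule metric_CauchyI)
    fix e :: real assume e: "0 < e"
    obtain N where N: "\<And>a b. nm (of_nat a - of_nat b :: 'c) \<le> (1 / real p) ^ N \<Longrightarrow> nm (u ^ a - u ^ b) < e"
      using power_uniform[OF u e] by metis
    have "Cauchy (\<lambda>k. of_nat (n k) :: 'c)"
      using lim by (rule LIMSEQ_imp_Cauchy)
    moreover have "(1 / real p) ^ N > 0"
      using p_gt_1 by simp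
    ultimately obtain M where M: "\<And>i j. i \<ge> M \<Longrightarrow> j \<ge> M \<Longrightarrow> dist (of_nat (n i) :: 'c) (of_nat (n j)) < (1 / real p) ^ N"
      unfolding Cauchy_def by meson
    have "dist (u ^ n i) (u ^ n j) < e" if "i \<ge> M" "j \<ge> M" for i j
      using N[of "n i" "n j"] M[OF that] by (simp add: dist_eq_nm)
    then show "\<exists>M. \<forall>m\<ge>M. \<forall>k\<ge>M. dist (u ^ n m) (u ^ n k) < e"
      by blast
  qed
  then show ?thesis
    using Cauchy_convergent unfolding convergent_def by blast
qed

lemma ex_nat_tendsto:
  assumes "\<zeta> \<in> closure (\<rat> :: 'c set)" "nm \<zeta> \<le> 1"
  obtains n where "(\<lambda>k. of_nat (n k)) \<longlonglongrightarrow> \<zeta>"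
proof -
  have "\<exists>c. nm (of_nat c - \<zeta>) \<le> (1 / real p) ^ k" for k
  proof -
    have pos: "(1 / real p) ^ k > 0" "(1 / real p) ^ k \<le> 1"
      using p_gt_1 by (auto intro: power_le_one)
    obtain q where q: "nm (\<zeta> - of_rat q) < (1 / real p) ^ k"
      using closure_rat_approx[OF assms(1) pos(1)] .
    have "nm (of_rat q :: 'c) \<le> 1"
      using nm_diff[of \<zeta> "\<zeta> - of_rat q"] q pos(2) assms(2) by simp
    then obtain c where "nm (of_rat q - of_nat c :: 'c) \<le> (1 / real p) ^ k"
      using rat_approx_nat by blast
    then have "nm ((\<zeta> - of_rat q) + (of_rat q - of_nat c)) \<le> (1 / real p) ^ k"
      using nm_add[of "\<zeta> - of_rat q" "of_rat q - of_nat c"] q by simp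
    then show ?thesis
      by (intro exI[of _ c]) (simp add: nm_minus_commute)
  qed
  then obtain n where n: "\<And>k. nm (of_nat (n k) - \<zeta>) \<le> (1 / real p) ^ k"
    by metis
  show ?thesis
  proof
    show "(\<lambda>k. of_nat (n k)) \<longlonglongrightarrow> \<zeta>"
      unfolding tendsto_iff_nm
      by (rule tendsto_sandwich[OF _ _ tendsto_const p_power_tendsto_0]) (simp_all add: n)
  qed
qed

text \<open>The p-adic power carried out inside C_p. By \<open>power_difference_tendsto_0\<close>
  the limit is the same along all sequences of natural numbers tending to \<zeta>.\<close>

definition upow :: "'c \<Rightarrow> 'c \<Rightarrow> 'c" where
  "upow u \<zeta> = (SOME w. \<forall>n. (\<lambda>k. of_nat (n k)) \<longlonglongrightarrow> \<zeta> \<longrightarrow> (\<lambda>k. u ^ n k) \<longlonglongrightarrow> w)"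

lemma upow:
  assumes u: "nm (u - 1) < 1" and lim: "(\<lambda>k. of_nat (n k)) \<longlonglongrightarrow> \<zeta>"
  shows "(\<lambda>k. u ^ n k) \<longlonglongrightarrow> upow u \<zeta>"
proof -
  obtain w where w: "(\<lambda>k. u ^ n k) \<longlonglongrightarrow> w"
    using power_convergent[OF u lim] by blast
  have "\<exists>w. \<forall>n. (\<lambda>k. of_nat (n k)) \<longlonglongrightarrow> \<zeta> \<longrightarrow> (\<lambda>k. u ^ n k) \<longlonglongrightarrow> w"
  proof (intro exI allI impI)
    fix m assume "(\<lambda>k. of_nat (m k)) \<longlonglongrightarrow> \<zeta>"
    then have "(\<lambda>k. u ^ m k - u ^ n k) \<longlonglongrightarrow> 0"
      using power_difference_tendsto_0[OF u _ lim] by blast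
    from tendsto_add_nm[OF this w] show "(\<lambda>k. u ^ m k) \<longlonglongrightarrow> w"
      by simp
  qed
  from someI_ex[OF this] lim show ?thesis
    unfolding upow_def by blast
qed

lemma upow_close:
  assumes u: "nm (u - 1) < 1" and \<zeta>: "\<zeta> \<in> closure \<rat>" "nm \<zeta> \<le> 1"
  shows "nm (upow u \<zeta> - 1) < 1"
proof -
  obtain n where n: "(\<lambda>k. of_nat (n k)) \<longlonglongrightarrow> \<zeta>"
    using ex_nat_tendsto[OF \<zeta>] .
  have "(\<lambda>k. nm (u ^ n k - upow u \<zeta>)) \<longlonglongrightarrow> 0"
    using upow[OF u n] unfolding tendsto_iff_nm .
  then have "\<forall>\<^sub>F k in sequentially. nm (u ^ n k - upow u \<zeta>) < 1"
    by (rule order_tendstoD(2)) simp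
  then obtain k where "nm (u ^ n k - upow u \<zeta>) < 1"
    by (auto simp: eventually_sequentially)
  then have "nm ((u ^ n k - 1) - (u ^ n k - upow u \<zeta>)) < 1"
    using nm_power_close[OF u] by (simp only: nm_diff_less)
  then show ?thesis
    by simp
qed

section \<open>Q_p as an instance of the completion\<close>

lemma field_embedding_of_rat: "field_embedding (of_rat :: rat \<Rightarrow> 'c)"
  by unfold_locales (simp_all add: of_rat_add of_rat_mult)

lemma padic_embedding_of_rat: "padic_embedding p T (of_rat :: rat \<Rightarrow> 'c) 1"
proof -
  interpret field_embedding "of_rat :: rat \<Rightarrow> 'c"
    by (rule field_embedding_of_rat)
  show ?thesis
  proof
    fix x :: rat
    obtain a b where ab: "x = of_int a / of_int b" "b \<noteq> 0"
      by (cases x) (auto simp: Fract_of_int_quotient)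
    then show "\<exists>f::int poly. f \<noteq> 0 \<and> Polynomial.degree f \<le> 1 \<and> ipoly f x = 0"
      by (intro exI[of _ "[:- a, b:]"]) (simp add: map_poly_pCons)
  qed
qed

lemma val_ideal_of_rat: "val_ideal (of_rat :: rat \<Rightarrow> 'c) = rat_prime p"
proof -
  have int: "algebraic_int q \<longleftrightarrow> q \<in> \<int>" for q :: rat
    using rational_algebraic_int_is_int[of q] int_imp_algebraic_int[of q] by (auto simp: Rats_def)
  show ?thesis
  proof safe
    fix q assume "q \<in> val_ideal (of_rat :: rat \<Rightarrow> 'c)"
    then have q: "q \<in> \<int>" "nm (of_rat q :: 'c) < 1"
      by (simp_all add: val_ideal_def int)
    then obtain a where a: "q = of_int a"
      by (auto elim: Ints_cases)
    then have "int p dvd a"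
      using q by (simp add: nm_of_int_dvd)
    then obtain b where "a = int p * b" ..
    then show "q \<in> rat_prime p"
      unfolding rat_prime_def cgenideal_def a by (auto intro!: exI[of _ "of_int b"])
  next
    fix q assume "q \<in> rat_prime p"
    then obtain x where x: "q = x * of_nat p" "algebraic_int x"
      unfolding rat_prime_def cgenideal_def by auto
    then obtain b where b: "x = of_int b"
      using int by (auto elim: Ints_cases)
    have "nm (of_rat q :: 'c) < 1"
      using nm_of_int_dvd[of "b * int p"] by (simp add: x b of_rat_mult)
    then show "q \<in> val_ideal (of_rat :: rat \<Rightarrow> 'c)"
      by (simp add: val_ideal_def int x b)
  qed
qed

end

sublocale padic_complex \<subseteq> rat: padic_embedding p T "of_rat" 1
  by (rule padic_embedding_of_rat)

context padic_complex
begin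

lemma padic_integers_carrier: "carrier (padic_integers p) = cls of_rat ` {\<zeta> \<in> closure (\<rat> :: 'c set). nm \<zeta> \<le> 1}"
  using rat.local_integers_carrier by (simp add: padic_integers_def val_ideal_of_rat Rats_def)

lemma padic_integers_zero: "\<zero>\<^bsub>padic_integers p\<^esub> = cls (of_rat :: rat \<Rightarrow> 'c) 0"
  using rat.local_field_simps(2) by (simp add: padic_integers_def local_integers_def val_ideal_of_rat)

lemma nat_seq_tendsto_iff:
  assumes "\<zeta> \<in> closure (\<rat> :: 'c set)"
  shows "(\<lambda>k. local_dist (rat_prime p) (local_embed (rat_prime p) (of_nat (n k))) (cls of_rat \<zeta>)) \<longlonglongrightarrow> 0
    \<longleftrightarrow> (\<lambda>k. of_nat (n k)) \<longlonglongrightarrow> \<zeta>"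
  using rat.local_dist_tendsto_0_iff[of "\<lambda>k. of_nat (n k)" \<zeta>] rat.K_hom[of "of_nat _"] assms
  unfolding val_ideal_of_rat[symmetric] rat.local_embed_eq by (simp add: Rats_def)

end

context padic_embedding
begin

lemma upow_in_K:
  assumes u: "u \<in> K" "nm (u - 1) < 1" and \<zeta>: "\<zeta> \<in> closure \<rat>" "nm \<zeta> \<le> 1"
  shows "upow u \<zeta> \<in> K"
proof -
  obtain n where "(\<lambda>k. of_nat (n k)) \<longlonglongrightarrow> \<zeta>"
    using ex_nat_tendsto[OF \<zeta>] .
  then have "(\<lambda>k. u ^ n k) \<longlonglongrightarrow> upow u \<zeta>"
    by (rule upow[OF u(2)])
  then show ?thesis
    using K_limit[of "\<lambda>k. u ^ n k" "upow u \<zeta>"] K_power[OF u(1)] by simp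
qed

lemma padic_power_eq:
  assumes u: "u \<in> K" "nm (u - 1) < 1" and \<zeta>: "\<zeta> \<in> closure \<rat>" "nm \<zeta> \<le> 1"
  shows "padic_power p Q (cls \<tau> u) (cls of_rat \<zeta>) = cls \<tau> (upow u \<zeta>)"
  unfolding padic_power_def nat_seq_tendsto_iff[OF \<zeta>(1)] local_field_power[OF u(1)]
proof (rule the_equality)
  note in_K = upow_in_K[OF u \<zeta>]
  show "cls \<tau> (upow u \<zeta>) \<in> carrier (local_field Q) \<and>
      (\<forall>n. (\<lambda>k. of_nat (n k)) \<longlonglongrightarrow> \<zeta> \<longrightarrow> (\<lambda>k. local_dist Q (cls \<tau> (u ^ n k)) (cls \<tau> (upow u \<zeta>))) \<longlonglongrightarrow> 0)"
    using in_K upow[OF u(2)] K_power[OF u(1)] by (simp add: carrier_local_field local_dist_tendsto_0_iff)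
  fix w
  assume w: "w \<in> carrier (local_field Q) \<and>
      (\<forall>n. (\<lambda>k. of_nat (n k)) \<longlonglongrightarrow> \<zeta> \<longrightarrow> (\<lambda>k. local_dist Q (cls \<tau> (u ^ n k)) w) \<longlonglongrightarrow> 0)"
  then obtain m where m: "m \<in> K" "w = cls \<tau> m"
    by (auto simp: carrier_local_field)
  obtain n where n: "(\<lambda>k. of_nat (n k)) \<longlonglongrightarrow> \<zeta>"
    using ex_nat_tendsto[OF \<zeta>] .
  from w have "(\<lambda>k. of_nat (n k)) \<longlonglongrightarrow> \<zeta> \<longrightarrow> (\<lambda>k. local_dist Q (cls \<tau> (u ^ n k)) w) \<longlonglongrightarrow> 0"
    by (elim conjE allE)
  with n have "(\<lambda>k. local_dist Q (cls \<tau> (u ^ n k)) (cls \<tau> m)) \<longlonglongrightarrow> 0"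
    unfolding m(2) by (elim mp)
  then have "(\<lambda>k. u ^ n k) \<longlonglongrightarrow> m"
    using local_dist_tendsto_0_iff[of "\<lambda>k. u ^ n k" m] K_power[OF u(1)] m(1) by simp
  then have "m = upow u \<zeta>"
    using upow[OF u(2) n] by (rule LIMSEQ_unique)
  then show "w = cls \<tau> (upow u \<zeta>)"
    by (simp add: m)
qed

end

section \<open>Galois number fields\<close>

lemma ex_common_denominator:
  assumes "finite I"
  shows "\<exists>N>0. \<forall>i\<in>I. \<exists>a. rat_of_nat N * q i = of_int a"
  using assms
proof (induction I rule: finite_induct)
  case empty
  show ?case
    by (intro exI[of _ 1]) auto
next
  case (insert j I)
  then obtain N where N: "N > 0" "\<forall>i\<in>I. \<exists>a. rat_of_nat N * q i = of_int a"
    by blast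
  obtain a b where ab: "q j = of_int a / of_int b" "b > 0"
    by (metis Rat_cases Fract_of_int_quotient)
  show ?case
  proof (intro exI[of _ "N * nat b"] conjI ballI)
    show "N * nat b > 0"
      using N ab by simp
    fix i assume i: "i \<in> insert j I"
    have b: "rat_of_nat (nat b) = of_int b"
      using ab(2) by simp
    show "\<exists>c. rat_of_nat (N * nat b) * q i = of_int c"
    proof (cases "i = j")
      case True
      then have "rat_of_nat (N * nat b) * q i = of_int (int N * a)"
        using ab by (simp add: b)
      then show ?thesis ..
    next
      case False
      then obtain c where "rat_of_nat N * q i = of_int c"
        using N i by blast
      then have "rat_of_nat (N * nat b) * q i = of_int (b * c)"
        by (simp add: b mult.assoc mult.left_commute)
      then show ?thesis ..
    qed
  qed
qed

locale galois_field =
  fixes T :: "'m::field_char_0 itself"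
  assumes galois: "galois_number_field T"
begin

abbreviation G :: "('m \<Rightarrow> 'm) set" where
  "G \<equiv> galois_group"

lemma galois_embedding: "g \<in> G \<Longrightarrow> field_embedding g"
  by (simp add: galois_group_iff)

lemma vector_space_rat: "vector_space (\<lambda>(q::rat) (x::'m). of_rat q * x)"
  by unfold_locales (simp_all add: of_rat_add of_rat_mult algebra_simps)

definition B :: "'m set" where
  "B = (SOME B. finite B \<and> Modules.module.span (\<lambda>(q::rat) (x::'m). of_rat q * x) B = UNIV)"

lemma B: "finite B" "Modules.module.span (\<lambda>(q::rat) x. of_rat q * x) B = UNIV"
proof -
  have "\<exists>B::'m set. finite B \<and> Modules.module.span (\<lambda>(q::rat) x. of_rat q * x) B = UNIV"
    using galois unfolding galois_number_field_def by blast
  from someI_ex[OF this] show "finite B" "Modules.module.span (\<lambda>(q::rat) x. of_rat q * x) B = UNIV"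
    unfolding B_def by blast+
qed

text \<open>The powers of \<open>x\<close> with exponents up to \<open>card B\<close> are one too
  many for a space spanned by \<open>B\<close>: either two of them coincide or they are linearly
  dependent. Clearing denominators gives an integer equation.\<close>

lemma bounded_degree: "\<exists>f::int poly. f \<noteq> 0 \<and> Polynomial.degree f \<le> card B \<and> ipoly f (x :: 'm) = 0"
proof -
  interpret V: vector_space "\<lambda>(q::rat) (x::'m). of_rat q * x"
    by (rule vector_space_rat)
  let ?n = "card B"
  have "\<exists>c::nat \<Rightarrow> rat. (\<exists>i\<le>?n. c i \<noteq> 0) \<and> (\<Sum>i\<le>?n. of_rat (c i) * x ^ i) = 0"
  proof (cases "inj_on (\<lambda>i. x ^ i) {..?n}")
    case True
    let ?S = "(\<lambda>i. x ^ i) ` {..?n}"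
    have "card ?S = Suc ?n"
      using True by (simp add: card_image)
    then have "V.dependent ?S"
      using V.independent_span_bound[OF B(1), of ?S] B(2) by auto
    then obtain u where u: "(\<Sum>v\<in>?S. of_rat (u v) * v) = 0" "\<exists>v\<in>?S. u v \<noteq> 0"
      using V.dependent_finite[of ?S] by auto
    have "(\<Sum>i\<le>?n. of_rat (u (x ^ i)) * x ^ i) = 0"
      using u(1) sum.reindex[OF True, of "\<lambda>v. of_rat (u v) * v"] by (simp add: o_def)
    then show ?thesis
      using u(2) by (intro exI[of _ "\<lambda>i. u (x ^ i)"]) auto
  next
    case False
    then obtain i j where ij: "i \<le> ?n" "j \<le> ?n" "i \<noteq> j" "x ^ i = x ^ j"
      by (auto simp: inj_on_def)
    define c where "c k = (if k = i then 1 else if k = j then - 1 else 0 :: rat)" for k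
    have "(\<Sum>k\<le>?n. of_rat (c k) * x ^ k) = (\<Sum>k\<in>{i, j}. of_rat (c k) * x ^ k)"
      using ij by (intro sum.mono_neutral_right) (auto simp: c_def)
    also have "\<dots> = 0"
      using ij by (simp add: c_def of_rat_minus)
    finally show ?thesis
      using ij(1) by (intro exI[of _ c]) (auto simp: c_def)
  qed
  then obtain c :: "nat \<Rightarrow> rat" where c: "\<exists>i\<le>?n. c i \<noteq> 0" "(\<Sum>i\<le>?n. of_rat (c i) * x ^ i) = 0"
    by blast
  obtain N where N: "N > 0" "\<forall>i\<in>{..?n}. \<exists>a. rat_of_nat N * c i = of_int a"
    using ex_common_denominator[of "{..?n}" c] by blast
  then obtain a where a: "\<And>i. i \<le> ?n \<Longrightarrow> rat_of_nat N * c i = of_int (a i)"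
    by (metis atMost_iff)
  have a': "of_int (a i) = of_nat N * (of_rat (c i) :: 'm)" if "i \<le> ?n" for i
    using arg_cong[OF a[OF that], of "of_rat :: rat \<Rightarrow> 'm"] by (simp add: of_rat_mult)
  define f where "f = (\<Sum>i\<le>?n. Polynomial.monom (a i) i)"
  have coeff: "Polynomial.coeff f i = (if i \<le> ?n then a i else 0)" for i
    by (simp add: f_def coeff_sum)
  have "f \<noteq> 0"
  proof -
    obtain i where "i \<le> ?n" "c i \<noteq> 0"
      using c(1) by blast
    then have "a i \<noteq> 0"
      using a[of i] N(1) by auto
    then have "Polynomial.coeff f i \<noteq> 0"
      using \<open>i \<le> ?n\<close> by (simp add: coeff)
    then show ?thesis
      by auto
  qed
  moreover have deg: "Polynomial.degree f \<le> ?n"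
    by (rule degree_le) (simp add: coeff)
  moreover have "ipoly f x = 0"
  proof -
    have "ipoly f x = (\<Sum>i\<le>?n. of_nat N * (of_rat (c i) * x ^ i))"
      unfolding ipoly_eq_sum[OF deg] by (intro sum.cong) (auto simp: coeff a')
    also have "\<dots> = 0"
      unfolding sum_distrib_left[symmetric] c(2) by simp
    finally show ?thesis .
  qed
  ultimately show ?thesis
    by blast
qed

lemma embedding_eqI:
  fixes f h :: "'m \<Rightarrow> 'b::field_char_0"
  assumes f: "field_embedding f" and h: "field_embedding h" and eq: "\<And>b. b \<in> B \<Longrightarrow> f b = h b"
  shows "f = h"
proof
  interpret V: vector_space "\<lambda>(q::rat) (x::'m). of_rat q * x"
    by (rule vector_space_rat)
  interpret f: field_embedding f by (rule f)
  interpret h: field_embedding h by (rule h)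
  fix x
  have "x \<in> V.span B"
    using B(2) by simp
  then show "f x = h x"
    by (induction rule: V.span_induct_alt) (simp_all add: eq f.hom_add f.hom_mult h.hom_add h.hom_mult)
qed

lemma finite_int_poly_roots:
  fixes f :: "int poly" assumes "f \<noteq> 0" shows "finite {x :: 'b::field_char_0. ipoly f x = 0}"
proof -
  have "map_poly of_int f \<noteq> (0 :: 'b poly)"
    using assms by (metis coeff_map_poly leading_coeff_0_iff of_int_0 of_int_eq_0_iff coeff_0)
  then show ?thesis
    by (rule poly_roots_finite)
qed

text \<open>An automorphism is determined by its values on the spanning set \<open>B\<close>, and
  each value is a root of a fixed polynomial.\<close>

lemma finite_G: "finite G"
proof -
  have "\<forall>x::'m. \<exists>f::int poly. f \<noteq> 0 \<and> ipoly f x = 0"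
    using bounded_degree by blast
  then obtain f :: "'m \<Rightarrow> int poly" where f: "\<And>x. f x \<noteq> 0" "\<And>x. ipoly (f x) x = 0"
    by metis
  let ?r = "\<lambda>g. restrict g B"
  have "?r ` G \<subseteq> PiE B (\<lambda>b. {y. ipoly (f b) y = 0})"
  proof safe
    fix g b assume "g \<in> G" "b \<in> B"
    then interpret g: field_embedding g
      by (simp add: galois_embedding)
    show "ipoly (f b) (?r g b) = 0"
      using f(2)[of b] \<open>b \<in> B\<close> g.hom_ipoly[of "f b" b] by simp
  qed auto
  moreover have "finite (PiE B (\<lambda>b. {y. ipoly (f b) y = 0}))"
    using B(1) f(1) by (intro finite_PiE finite_int_poly_roots) auto
  ultimately have "finite (?r ` G)"
    by (rule finite_subset)
  moreover have "inj_on ?r G"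
  proof (rule inj_onI)
    fix g h assume gh: "g \<in> G" "h \<in> G" "?r g = ?r h"
    show "g = h"
    proof (rule embedding_eqI)
      fix b assume "b \<in> B"
      then show "g b = h b"
        using fun_cong[OF gh(3), of b] by simp
    qed (simp_all add: galois_embedding gh)
  qed
  ultimately show ?thesis
    by (rule finite_imageD)
qed

lemma id_in_G: "id \<in> G"
  by (simp add: galois_group_iff field_embedding_def)

lemma comp_in_G: "g \<in> G \<Longrightarrow> h \<in> G \<Longrightarrow> g \<circ> h \<in> G"
  by (simp add: galois_group_iff field_embedding_comp bij_comp)

lemma inv_in_G: "g \<in> G \<Longrightarrow> Hilbert_Choice.inv g \<in> G"
proof -
  assume g: "g \<in> G"
  then interpret g: field_embedding g
    by (simp add: galois_embedding)
  have bij: "bij g"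
    using g by (simp add: galois_group_iff)
  then have gi: "g (Hilbert_Choice.inv g x) = x" for x
    by (simp add: bij_is_surj surj_f_inv_f)
  have "field_embedding (Hilbert_Choice.inv g)"
  proof
    show "Hilbert_Choice.inv g 1 = 1"
      using gi[of 1] by (metis g.hom_1 g.hom_eq)
    fix x y
    show "Hilbert_Choice.inv g (x + y) = Hilbert_Choice.inv g x + Hilbert_Choice.inv g y"
      using gi by (metis g.hom_add g.hom_eq)
    show "Hilbert_Choice.inv g (x * y) = Hilbert_Choice.inv g x * Hilbert_Choice.inv g y"
      using gi by (metis g.hom_mult g.hom_eq)
  qed
  then show ?thesis
    using bij by (simp add: galois_group_iff bij_imp_bij_inv)
qed

lemma G_comp_left:
  assumes h: "h \<in> G" shows "bij_betw (\<lambda>g. h \<circ> g) G G"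
proof (rule bij_betw_byWitness[where f' = "\<lambda>g. Hilbert_Choice.inv h \<circ> g"])
  have "bij h"
    using h by (simp add: galois_group_iff)
  then have "Hilbert_Choice.inv h \<circ> h = id" "h \<circ> Hilbert_Choice.inv h = id"
    by (simp_all add: bij_is_inj inv_o_cancel bij_is_surj surj_iff[symmetric])
  then show "\<forall>g\<in>G. Hilbert_Choice.inv h \<circ> (h \<circ> g) = g" "\<forall>g\<in>G. h \<circ> (Hilbert_Choice.inv h \<circ> g) = g"
    by (simp_all add: comp_assoc[symmetric])
qed (use h comp_in_G inv_in_G in auto)

lemma fixed_rational: "(\<And>g. g \<in> G \<Longrightarrow> g x = x) \<Longrightarrow> x \<in> \<rat>" for x :: 'm
  using galois unfolding galois_number_field_def by blast

lemma galois_algebraic_int: "g \<in> G \<Longrightarrow> algebraic_int (g x) \<longleftrightarrow> algebraic_int x"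
  using field_embedding.hom_algebraic_int galois_embedding by blast

text \<open>The characteristic polynomial of \<open>x\<close>: one factor for each automorphism,
  repeated where conjugates coincide, so that the degree is \<open>card G\<close> for every
  \<open>x\<close>.\<close>

definition conj_poly :: "'m \<Rightarrow> 'm poly" where
  "conj_poly x = (\<Prod>g\<in>G. [:- g x, 1:])"

lemma map_poly_hom_mult:
  assumes "field_embedding h"
  shows "map_poly h (f * g) = map_poly h f * map_poly h g"
proof (rule poly_eqI)
  interpret h: field_embedding h by (rule assms)
  fix n
  show "Polynomial.coeff (map_poly h (f * g)) n = Polynomial.coeff (map_poly h f * map_poly h g) n"
    by (simp add: coeff_map_poly coeff_mult h.hom_sum h.hom_mult)
qed

lemma map_poly_hom_prod:
  assumes "field_embedding h"
  shows "map_poly h (\<Prod>i\<in>A. f i) = (\<Prod>i\<in>A. map_poly h (f i))"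
proof -
  interpret h: field_embedding h by (rule assms)
  show ?thesis
    by (induction A rule: infinite_finite_induct) (simp_all add: map_poly_hom_mult[OF assms] map_poly_1')
qed

lemma map_conj_poly:
  fixes h :: "'m \<Rightarrow> 'b::field_char_0"
  assumes "field_embedding h" shows "map_poly h (conj_poly x) = (\<Prod>g\<in>G. [:- h (g x), 1:])"
proof -
  interpret h: field_embedding h by (rule assms)
  show ?thesis
    unfolding conj_poly_def map_poly_hom_prod[OF assms] by (simp add: map_poly_pCons h.hom_minus)
qed

text \<open>Composition with an automorphism permutes the factors, so the coefficients lie in the
  fixed field.\<close>

lemma coeff_conj_poly_rational: "Polynomial.coeff (conj_poly x) n \<in> \<rat>"
proof (rule fixed_rational)
  fix h assume h: "h \<in> G"
  interpret h: field_embedding h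
    by (rule galois_embedding[OF h])
  have "map_poly h (conj_poly x) = (\<Prod>g\<in>G. [:- (h \<circ> g) x, 1:])"
    using map_conj_poly[OF galois_embedding[OF h], of x] by simp
  also have "\<dots> = conj_poly x"
    unfolding conj_poly_def by (rule prod.reindex_bij_betw[OF G_comp_left[OF h]])
  finally have "map_poly h (conj_poly x) = conj_poly x" .
  from arg_cong[OF this, of "\<lambda>f. Polynomial.coeff f n"]
  show "h (Polynomial.coeff (conj_poly x) n) = Polynomial.coeff (conj_poly x) n"
    by (simp add: coeff_map_poly)
qed

lemma algebraic_int_coeff_prod:
  assumes "finite A" "\<And>i. i \<in> A \<Longrightarrow> algebraic_int (a i :: 'b::field_char_0)"
  shows "algebraic_int (Polynomial.coeff (\<Prod>i\<in>A. [:- a i, 1:]) n)"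
  using assms
proof (induction A arbitrary: n rule: finite_induct)
  case empty
  then show ?case
    by (simp add: Polynomial.coeff_1)
next
  case (insert j A)
  then show ?case
    by (cases n) (auto simp: coeff_pCons intro!: algebraic_int_add algebraic_int_diff algebraic_int_mult)
qed

lemma degree_linear_prod:
  assumes "finite A"
  shows "Polynomial.degree (\<Prod>i\<in>A. [:- a i, 1:]) = card A"
    and "Polynomial.lead_coeff (\<Prod>i\<in>A. [:- a i, 1 :: 'b::field_char_0:]) = 1"
proof -
  show "Polynomial.degree (\<Prod>i\<in>A. [:- a i, 1:]) = card A"
    using assms by (subst degree_prod_eq_sum_degree) auto
  show "Polynomial.lead_coeff (\<Prod>i\<in>A. [:- a i, 1 :: 'b:]) = 1"
    by (simp add: lead_coeff_prod)
qed

lemma conj_poly_int: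
  assumes "algebraic_int x"
  obtains f :: "int poly" where "map_poly of_int f = conj_poly x" "Polynomial.lead_coeff f = 1"
    "Polynomial.degree f = card G"
proof -
  have "Polynomial.coeff (conj_poly x) n \<in> \<int>" for n
  proof (rule rational_algebraic_int_is_int)
    show "algebraic_int (Polynomial.coeff (conj_poly x) n)"
      unfolding conj_poly_def using finite_G assms galois_algebraic_int
      by (intro algebraic_int_coeff_prod) auto
  qed (rule coeff_conj_poly_rational)
  then have "\<exists>k. Polynomial.coeff (conj_poly x) n = of_int k" for n
    by (auto elim: Ints_cases)
  then obtain k where k: "\<And>n. Polynomial.coeff (conj_poly x) n = of_int (k n)"
    by metis
  define f where "f = (\<Sum>i\<le>card G. Polynomial.monom (k i) i)"
  have deg: "Polynomial.degree (conj_poly x) = card G" "Polynomial.lead_coeff (conj_poly x) = 1"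
    unfolding conj_poly_def by (rule degree_linear_prod[OF finite_G])+
  have "of_int (k i) = (0 :: 'm)" if "i > card G" for i
    using deg that coeff_eq_0[of "conj_poly x" i] by (simp add: k[symmetric])
  then have k0: "k i = 0" if "i > card G" for i
    using that by simp
  have coeff: "Polynomial.coeff f i = k i" for i
    using k0[of i] by (auto simp: f_def coeff_sum not_le)
  have map: "map_poly of_int f = conj_poly x"
    by (rule poly_eqI) (simp add: coeff_map_poly coeff k)
  have "Polynomial.degree f = card G"
    using deg(1) unfolding map[symmetric] by (simp add: degree_map_poly)
  moreover have "of_int (Polynomial.lead_coeff f) = (1 :: 'm)"
    using deg unfolding map[symmetric] by (simp add: degree_map_poly coeff_map_poly)
  then have "Polynomial.lead_coeff f = 1"
    by simp
  ultimately show ?thesis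
    using that map by blast
qed

lemma norm_int:
  assumes "algebraic_int x" shows "(\<Prod>g\<in>G. g x) \<in> \<int>"
proof (rule rational_algebraic_int_is_int)
  show "algebraic_int (\<Prod>g\<in>G. g x)"
    using assms galois_algebraic_int by (intro algebraic_int_prod) auto
  show "(\<Prod>g\<in>G. g x) \<in> \<rat>"
  proof (rule fixed_rational)
    fix h assume h: "h \<in> G"
    interpret h: field_embedding h
      by (rule galois_embedding[OF h])
    have "h (\<Prod>g\<in>G. g x) = (\<Prod>g\<in>G. (h \<circ> g) x)"
      by (simp add: h.hom_prod)
    also have "\<dots> = (\<Prod>g\<in>G. g x)"
      by (rule prod.reindex_bij_betw[OF G_comp_left[OF h]])
    finally show "h (\<Prod>g\<in>G. g x) = (\<Prod>g\<in>G. g x)" .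
  qed
qed

lemma coeff_linear_prod_bound:
  fixes a :: "'i \<Rightarrow> complex"
  assumes "finite A" "\<And>i. i \<in> A \<Longrightarrow> cmod (a i) \<le> C" "C \<ge> 0"
  shows "cmod (Polynomial.coeff (\<Prod>i\<in>A. [:- a i, 1:]) n) \<le> (1 + C) ^ card A"
  using assms(1,2)
proof (induction A arbitrary: n rule: finite_induct)
  case empty
  then show ?case
    by (simp add: Polynomial.coeff_1)
next
  case (insert j A)
  let ?q = "\<Prod>i\<in>A. [:- a i, 1:]"
  have IH: "cmod (Polynomial.coeff ?q k) \<le> (1 + C) ^ card A" for k
    using insert by simp
  have "Polynomial.coeff ([:- a j, 1:] * ?q) n
      = - a j * Polynomial.coeff ?q n + (if n = 0 then 0 else Polynomial.coeff ?q (n - 1))"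
    by (cases n) (simp_all add: coeff_pCons)
  moreover have "cmod (if n = 0 then 0 else Polynomial.coeff ?q (n - 1)) \<le> (1 + C) ^ card A"
    using IH[of "n - 1"] assms(3) by simp
  moreover have "cmod (- a j * Polynomial.coeff ?q n) \<le> C * (1 + C) ^ card A"
    unfolding norm_mult using insert.prems IH assms(3) by (intro mult_mono) auto
  ultimately have "cmod (Polynomial.coeff ([:- a j, 1:] * ?q) n) \<le> C * (1 + C) ^ card A + (1 + C) ^ card A"
    using norm_triangle_mono by metis
  then show ?case
    using insert.hyps by (simp add: algebra_simps)
qed

lemma finite_bounded_int_polys: "finite {f::int poly. Polynomial.degree f \<le> n \<and> (\<forall>i. \<bar>Polynomial.coeff f i\<bar> \<le> M)}"
proof -
  let ?S = "{f::int poly. Polynomial.degree f \<le> n \<and> (\<forall>i. \<bar>Polynomial.coeff f i\<bar> \<le> M)}"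
  let ?r = "\<lambda>f. restrict (Polynomial.coeff f) {..n}"
  have "?r ` ?S \<subseteq> PiE {..n} (\<lambda>_. {- M..M})"
    by (auto simp: abs_le_iff minus_le_iff)
  moreover have "finite (PiE {..n} (\<lambda>_. {- M..M}))"
    by (intro finite_PiE) auto
  ultimately have "finite (?r ` ?S)"
    by (rule finite_subset)
  moreover have "inj_on ?r ?S"
  proof (rule inj_onI)
    fix f g assume fg: "f \<in> ?S" "g \<in> ?S" "?r f = ?r g"
    show "f = g"
    proof (rule poly_eqI)
      fix i
      show "Polynomial.coeff f i = Polynomial.coeff g i"
      proof (cases "i \<le> n")
        case True
        then show ?thesis
          using fun_cong[OF fg(3), of i] by simp
      next
        case False
        then show ?thesis
          using fg(1,2) by (simp add: coeff_eq_0)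
      qed
    qed
  qed
  ultimately show ?thesis
    by (rule finite_imageD)
qed

text \<open>A bound on the conjugates bounds the integer coefficients of the characteristic
  polynomial, whose degree is fixed; there are finitely many such polynomials, each with finitely
  many roots.\<close>

lemma finite_bounded_algebraic_ints:
  assumes \<tau>: "field_embedding (\<tau> :: 'm \<Rightarrow> complex)"
  shows "finite {x. algebraic_int x \<and> (\<forall>g\<in>G. cmod (\<tau> (g x)) \<le> C)}"
proof (cases "C \<ge> 0")
  case True
  interpret \<tau>: field_embedding \<tau> by (rule \<tau>)
  define M where "M = \<lceil>(1 + C) ^ card G\<rceil>"
  let ?F = "{f::int poly. Polynomial.degree f \<le> card G \<and> (\<forall>i. \<bar>Polynomial.coeff f i\<bar> \<le> M)} - {0}"
  have "{x. algebraic_int x \<and> (\<forall>g\<in>G. cmod (\<tau> (g x)) \<le> C)} \<subseteq> (\<Union>f\<in>?F. {x. ipoly f x = 0})"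
  proof safe
    fix x assume x: "algebraic_int x" "\<forall>g\<in>G. cmod (\<tau> (g x)) \<le> C"
    obtain f :: "int poly" where f: "map_poly of_int f = conj_poly x" "Polynomial.lead_coeff f = 1"
      "Polynomial.degree f = card G"
      using conj_poly_int[OF x(1)] .
    have "\<bar>Polynomial.coeff f i\<bar> \<le> M" for i
    proof -
      have "\<tau> (Polynomial.coeff (conj_poly x) i) = of_int (Polynomial.coeff f i)"
        unfolding f(1)[symmetric] by (simp add: coeff_map_poly)
      moreover have "\<tau> (Polynomial.coeff (conj_poly x) i) = Polynomial.coeff (\<Prod>g\<in>G. [:- \<tau> (g x), 1:]) i"
        unfolding map_conj_poly[OF \<tau>, symmetric] by (simp add: coeff_map_poly)
      ultimately have "cmod (of_int (Polynomial.coeff f i)) \<le> (1 + C) ^ card G"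
        using coeff_linear_prod_bound[OF finite_G, of "\<lambda>g. \<tau> (g x)" C i] x(2) True by simp
      then have "of_int \<bar>Polynomial.coeff f i\<bar> \<le> (1 + C) ^ card G"
        by simp
      then show ?thesis
        unfolding M_def by linarith
    qed
    moreover have "f \<noteq> 0"
      using f(2) by auto
    moreover have "ipoly f x = 0"
      unfolding f(1) conj_poly_def poly_prod using finite_G id_in_G by (intro prod_zero) (auto intro!: bexI[of _ id])
    ultimately show "x \<in> (\<Union>f\<in>?F. {x. ipoly f x = 0})"
      using f(3) by auto
  qed
  moreover have "finite (\<Union>f\<in>?F. {x :: 'm. ipoly f x = 0})"
    using finite_bounded_int_polys finite_int_poly_roots by (intro finite_UN_I) auto
  ultimately show ?thesis
    by (rule finite_subset)
next
  case False
  have "C \<ge> 0" if "\<forall>g\<in>G. cmod (\<tau> (g x)) \<le> C" for x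
    using bspec[OF that id_in_G] norm_ge_zero[of "\<tau> (id x)"] by linarith
  with False have "{x. algebraic_int x \<and> (\<forall>g\<in>G. cmod (\<tau> (g x)) \<le> C)} = {}"
    by auto
  then show ?thesis
    by (simp only: finite.emptyI)
qed

text \<open>Equality of characteristic polynomials under both embeddings gives for each
  \<open>x\<close> some \<open>g\<close> with \<rho> x = \<tau> (g x), but this \<open>g\<close>
  depends on \<open>x\<close>. The curve x(t) = \<Sum> b_i t^i through the spanning vectors makes it
  uniform: a single \<open>h\<close> serves infinitely many t, and a polynomial with infinitely many
  zeros vanishes coefficientwise.\<close>

lemma embedding_conjugate:
  fixes \<tau> \<rho> :: "'m \<Rightarrow> 'b::field_char_0"
  assumes \<tau>: "field_embedding \<tau>" and \<rho>: "field_embedding \<rho>"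
  shows "\<exists>g\<in>G. \<rho> = \<tau> \<circ> g"
proof -
  interpret \<tau>: field_embedding \<tau> by (rule \<tau>)
  interpret \<rho>: field_embedding \<rho> by (rule \<rho>)
  have pointwise: "\<exists>g\<in>G. \<rho> x = \<tau> (g x)" for x
  proof -
    have "map_poly \<rho> (conj_poly x) = map_poly \<tau> (conj_poly x)"
    proof (rule poly_eqI)
      fix n
      obtain q where "Polynomial.coeff (conj_poly x) n = of_rat q"
        using coeff_conj_poly_rational[of x n] unfolding Rats_def by blast
      then show "Polynomial.coeff (map_poly \<rho> (conj_poly x)) n = Polynomial.coeff (map_poly \<tau> (conj_poly x)) n"
        by (simp add: coeff_map_poly)
    qed
    then have "(\<Prod>g\<in>G. [:- \<rho> (g x), 1:]) = (\<Prod>g\<in>G. [:- \<tau> (g x), 1:])"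
      by (simp only: map_conj_poly[OF \<tau>] map_conj_poly[OF \<rho>])
    then have "poly (\<Prod>g\<in>G. [:- \<rho> (g x), 1:]) (\<rho> x) = poly (\<Prod>g\<in>G. [:- \<tau> (g x), 1:]) (\<rho> x)"
      by (rule arg_cong)
    moreover have "poly (\<Prod>g\<in>G. [:- \<rho> (g x), 1:]) (\<rho> x) = 0"
      unfolding poly_prod using finite_G id_in_G by (intro prod_zero) (auto intro!: bexI[of _ id])
    ultimately have "(\<Prod>g\<in>G. \<rho> x - \<tau> (g x)) = 0"
      by (simp add: poly_prod)
    then show ?thesis
      using finite_G by (auto simp: prod_zero_iff)
  qed
  obtain b where "bij_betw b {0..<card B} B"
    using ex_bij_betw_nat_finite[OF B(1)] by blast
  then have b: "B = b ` {..<card B}"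
    by (simp add: bij_betw_def lessThan_atLeast0)
  define x where "x t = (\<Sum>i<card B. b i * of_nat t ^ i)" for t :: nat
  have "\<forall>t. \<exists>g. g \<in> G \<and> \<rho> (x t) = \<tau> (g (x t))"
    using pointwise by blast
  from choice[OF this] obtain g where "\<forall>t. g t \<in> G \<and> \<rho> (x t) = \<tau> (g t (x t))"
    by blast
  then have g: "\<And>t. g t \<in> G" "\<And>t. \<rho> (x t) = \<tau> (g t (x t))"
    by simp_all
  have "\<exists>h\<in>G. infinite {t. g t = h}"
  proof (rule ccontr)
    assume "\<not> ?thesis"
    then have "finite (\<Union>h\<in>G. {t. g t = h})"
      using finite_G by auto
    moreover have "(\<Union>h\<in>G. {t. g t = h}) = UNIV"
      using g(1) by auto
    ultimately show False
      by simp
  qed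
  then obtain h where h: "h \<in> G" "infinite {t. g t = h}"
    by blast
  interpret h: field_embedding h
    by (rule galois_embedding[OF h(1)])
  define f where "f = (\<Sum>i<card B. Polynomial.monom (\<rho> (b i) - \<tau> (h (b i))) i)"
  have "poly f (of_nat t) = 0" if "g t = h" for t
  proof -
    have "poly f (of_nat t) = \<rho> (x t) - \<tau> (h (x t))"
      by (simp add: f_def poly_sum poly_monom x_def \<rho>.hom_sum \<tau>.hom_sum h.hom_sum \<rho>.hom_mult \<tau>.hom_mult
          h.hom_mult \<rho>.hom_power \<tau>.hom_power h.hom_power left_diff_distrib sum_subtractf)
    then show ?thesis
      using g(2)[of t] that by simp
  qed
  then have "of_nat ` {t. g t = h} \<subseteq> {y. poly f y = 0}"
    by auto
  moreover have "infinite ((of_nat :: nat \<Rightarrow> 'b) ` {t. g t = h})"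
    using h(2) by (simp add: finite_image_iff inj_on_def)
  ultimately have "infinite {y. poly f y = 0}"
    by (meson finite_subset)
  then have "f = 0"
    using poly_roots_finite[of f] by blast
  have "\<rho> (b i) = \<tau> (h (b i))" if "i < card B" for i
  proof -
    have "Polynomial.coeff f i = \<rho> (b i) - \<tau> (h (b i))"
      using that by (simp add: f_def coeff_sum)
    then show ?thesis
      using \<open>f = 0\<close> by simp
  qed
  note eq = this
  have "\<rho> = \<tau> \<circ> h"
  proof (rule embedding_eqI)
    fix y assume "y \<in> B"
    then have "y \<in> b ` {..<card B}"
      by (subst b[symmetric])
    then show "\<rho> y = (\<tau> \<circ> h) y"
      using eq by auto
  qed (simp_all add: \<rho> \<tau> field_embedding_comp galois_embedding h)
  with h(1) show ?thesis
    by blast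
qed

lemma complex_conjugations_iff:
  "c \<in> complex_conjugations \<longleftrightarrow> c \<in> G \<and> (\<exists>\<tau>. field_embedding \<tau> \<and> cnj \<circ> \<tau> = \<tau> \<circ> c)"
  unfolding complex_conjugations_def by (auto simp: embeddings_iff)

lemma finite_complex_conjugations: "finite (complex_conjugations :: ('m \<Rightarrow> 'm) set)"
  using finite_G by (rule finite_subset[rotated]) (auto simp: complex_conjugations_iff)

lemma complex_conjugations_nonempty:
  assumes "field_embedding (\<tau> :: 'm \<Rightarrow> complex)"
  shows "(complex_conjugations :: ('m \<Rightarrow> 'm) set) \<noteq> {}"
proof -
  interpret \<tau>: field_embedding \<tau> by (rule assms)
  have "field_embedding (cnj \<circ> \<tau>)"
    by unfold_locales (simp_all add: \<tau>.hom_add \<tau>.hom_mult)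
  then obtain c where "c \<in> G" "cnj \<circ> \<tau> = \<tau> \<circ> c"
    using embedding_conjugate[OF assms] by blast
  then have "c \<in> complex_conjugations"
    unfolding complex_conjugations_iff using assms by (intro conjI exI)
  then show ?thesis
    by blast
qed

end

section \<open>Primes above p\<close>

locale galois_padic = padic_complex p T + galois_field U
  for p :: nat and T :: "'c::{field_char_0, complete_space} itself" and U :: "'m::field_char_0 itself"
begin

lemma padic_embedding_if_embedding:
  "field_embedding (\<tau> :: 'm \<Rightarrow> 'c) \<Longrightarrow> padic_embedding p T \<tau> (card B)"
  by (intro padic_embedding.intro padic_complex_axioms padic_embedding_axioms.intro bounded_degree)

lemma embedding_comp_galois:
  "field_embedding (\<tau> :: 'm \<Rightarrow> 'c) \<Longrightarrow> g \<in> G \<Longrightarrow> field_embedding (\<tau> \<circ> g)"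
  by (intro field_embedding_comp galois_embedding)

context
  fixes P :: "'m set"
  assumes P: "P \<in> primes_above p"
begin

section \<open>Elementary properties of a prime above p\<close>

lemma prime_ideal: "primeideal P ring_of_integers"
  using P by (simp add: primes_above_def)

lemma ideal: "ideal P ring_of_integers"
  using primeideal.axioms(1)[OF prime_ideal] .

lemma P_int: "x \<in> P \<Longrightarrow> algebraic_int x"
  using ideal.Icarr[OF ideal] by simp

lemma P_add: "x \<in> P \<Longrightarrow> y \<in> P \<Longrightarrow> x + y \<in> P"
  using additive_subgroup.a_closed[OF ideal.axioms(1)[OF ideal], of x y] by simp

lemma P_mult: "algebraic_int a \<Longrightarrow> x \<in> P \<Longrightarrow> a * x \<in> P"
  using ideal.I_l_closed[OF ideal, of x a] by simp

lemma P_1: "1 \<notin> P"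
proof
  assume "1 \<in> P"
  then have "carrier ring_of_integers \<subseteq> P"
    using P_mult[of _ 1] by auto
  then show False
    using primeideal.I_notcarr[OF prime_ideal] P_int by auto
qed

lemma P_prime: "algebraic_int a \<Longrightarrow> algebraic_int b \<Longrightarrow> a * b \<in> P \<Longrightarrow> a \<in> P \<or> b \<in> P"
  using primeideal.I_prime[OF prime_ideal, of a b] by simp

lemma P_0: "0 \<in> P"
  using additive_subgroup.zero_closed[OF ideal.axioms(1)[OF ideal]] by simp

lemma P_p: "of_nat p \<in> P"
  using P by (simp add: primes_above_def)

lemma P_minus: "x \<in> P \<Longrightarrow> - x \<in> P"
  using P_mult[of "- 1" x] by simp

lemma P_sum: "(\<And>i. i \<in> A \<Longrightarrow> f i \<in> P) \<Longrightarrow> sum f A \<in> P"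
  by (induction A rule: infinite_finite_induct) (auto intro: P_0 P_add)

lemma P_of_int: "of_int n \<in> P \<longleftrightarrow> int p dvd n"
proof
  assume n: "of_int n \<in> P"
  show "int p dvd n"
  proof (rule ccontr)
    assume "\<not> int p dvd n"
    then have "Rings.coprime (int p) n"
      using prime_p by (simp add: prime_imp_coprime)
    then obtain a b where ab: "a * int p + b * n = 1"
      using bezout_int[of "int p" n] by (auto simp: coprime_iff_gcd_eq_1)
    have "of_int a * of_nat p + of_int b * of_int n \<in> P"
      using n P_p by (intro P_add P_mult) auto
    moreover have "of_int a * of_nat p + of_int b * of_int n = (of_int (a * int p + b * n) :: 'm)"
      by simp
    ultimately show False
      using P_1 by (simp add: ab)
  qed
next
  assume "int p dvd n"
  then obtain m where m: "n = int p * m" ..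
  have "of_int m * of_nat p \<in> P"
    using P_p by (intro P_mult) auto
  then show "of_int n \<in> P"
    by (simp add: m mult.commute)
qed

lemma P_power: "algebraic_int x \<Longrightarrow> x ^ n \<in> P \<Longrightarrow> x \<in> P"
proof (induction n)
  case 0
  then show ?case
    using P_1 by simp
next
  case (Suc n)
  then show ?case
    using P_prime[of x "x ^ n"] by (auto simp: algebraic_int_power)
qed

context
  fixes \<tau> :: "'m \<Rightarrow> 'c"
  assumes \<tau>: "field_embedding \<tau>"
begin

section \<open>Every prime above p is induced by an embedding\<close>

lemma nm_embedding_le_1: "algebraic_int x \<Longrightarrow> g \<in> G \<Longrightarrow> nm (\<tau> (g x)) \<le> 1"
  using padic_embedding.av_le_1[OF padic_embedding_if_embedding[OF \<tau>], of "g x"]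
  by (simp add: galois_algebraic_int)

text \<open>The norm of \<open>x\<close> is a rational integer and, being \<open>x\<close> times an
  algebraic integer, lies in \<open>P\<close>; so \<open>p\<close> divides it. It could not be small
  if all conjugates of \<open>x\<close> had absolute value 1.\<close>

lemma P_conjugate_small:
  assumes x: "x \<in> P" shows "\<exists>g\<in>G. nm (\<tau> (g x)) < 1"
proof (rule ccontr)
  assume no: "\<not> ?thesis"
  interpret \<tau>: field_embedding \<tau> by (rule \<tau>)
  obtain n where n: "(\<Prod>g\<in>G. g x) = of_int n"
    using norm_int[OF P_int[OF x]] by (auto elim: Ints_cases)
  have "(\<Prod>g\<in>G. g x) = (\<Prod>g\<in>G - {id}. g x) * x"
    using prod.remove[OF finite_G id_in_G, of "\<lambda>g. g x"] by (simp add: mult.commute)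
  moreover have "(\<Prod>g\<in>G - {id}. g x) * x \<in> P"
    using x P_int[OF x] by (intro P_mult algebraic_int_prod) (simp_all add: galois_algebraic_int)
  ultimately have "of_int n \<in> P"
    unfolding n[symmetric] by (simp only:)
  then have "int p dvd n"
    by (simp only: P_of_int)
  then have "nm (\<tau> (of_int n)) < 1"
    by (simp add: nm_of_int_dvd)
  moreover have "nm (\<tau> (of_int n)) = (\<Prod>g\<in>G. nm (\<tau> (g x)))"
    unfolding n[symmetric] by (simp add: \<tau>.hom_prod nm_prod)
  moreover have "(\<Prod>g\<in>G. nm (\<tau> (g x))) = 1"
    using no nm_embedding_le_1[OF P_int[OF x]] by (intro prod.neutral ballI) (force simp: not_less)
  ultimately show False
    by simp
qed

text \<open>Prime avoidance for the ideals \<open>val_ideal (\<tau> \<circ> g)\<close> covering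
  \<open>P\<close>. Redundant ideals are dropped by induction; in an irredundant cover by several
  ideals each one owns an element of \<open>P\<close> outside all others, and a suitable sum escapes
  all of them.\<close>

lemma prime_avoidance:
  assumes "finite F" "F \<subseteq> G" "\<And>x. x \<in> P \<Longrightarrow> \<exists>g\<in>F. nm (\<tau> (g x)) < 1"
  shows "\<exists>g\<in>F. \<forall>x\<in>P. nm (\<tau> (g x)) < 1"
  using assms
proof (induction F rule: finite_psubset_induct)
  case (psubset F)
  interpret \<tau>: field_embedding \<tau> by (rule \<tau>)
  show ?case
  proof (cases "\<exists>g\<in>F. \<forall>x\<in>P. \<exists>h\<in>F - {g}. nm (\<tau> (h x)) < 1")
    case True
    then obtain g where g: "g \<in> F" "\<forall>x\<in>P. \<exists>h\<in>F - {g}. nm (\<tau> (h x)) < 1"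
      by blast
    have "\<exists>h\<in>F - {g}. \<forall>x\<in>P. nm (\<tau> (h x)) < 1"
      using g psubset.prems(1) by (intro psubset.IH) auto
    then show ?thesis
      by blast
  next
    case False
    then have "\<forall>g\<in>F. \<exists>x. x \<in> P \<and> (\<forall>h\<in>F - {g}. \<not> nm (\<tau> (h x)) < 1)"
      by blast
    from bchoice[OF this] obtain x where
      x: "\<And>g. g \<in> F \<Longrightarrow> x g \<in> P" "\<And>g h. g \<in> F \<Longrightarrow> h \<in> F \<Longrightarrow> h \<noteq> g \<Longrightarrow> \<not> nm (\<tau> (h (x g))) < 1"
      by blast
    have unit: "nm (\<tau> (h (x g))) = 1" if "g \<in> F" "h \<in> F" "h \<noteq> g" for g h
    proof -
      have "nm (\<tau> (h (x g))) \<le> 1"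
        using nm_embedding_le_1[OF P_int[OF x(1)[OF that(1)]], of h] psubset.prems(1) that(2) by blast
      then show ?thesis
        using x(2)[OF that] by simp
    qed
    have small: "nm (\<tau> (g (x g))) < 1" if g: "g \<in> F" for g
    proof -
      obtain h where "h \<in> F" "nm (\<tau> (h (x g))) < 1"
        using psubset.prems(2)[OF x(1)[OF g]] by blast
      then show ?thesis
        using unit[OF g, of h] by (cases "h = g") auto
    qed
    obtain g\<^sub>0 where g0: "g\<^sub>0 \<in> F"
      using psubset.prems(2)[OF P_0] by blast
    show ?thesis
    proof (cases "F = {g\<^sub>0}")
      case True
      then show ?thesis
        using psubset.prems(2) by auto
    next
      case False
      then obtain g\<^sub>1 where g1: "g\<^sub>1 \<in> F" "g\<^sub>1 \<noteq> g\<^sub>0"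
        using g0 by blast
      \<comment> \<open>On \<open>F\<close>, the element \<open>x g\<^sub>0\<close> is small at
        \<open>g\<^sub>0\<close> only, while \<open>w\<close> is a unit at \<open>g\<^sub>0\<close>
        and small everywhere else; so their sum is a unit at every member of
        \<open>F\<close>.\<close>
      define w where "w = (\<Prod>g\<in>F - {g\<^sub>0}. x g)"
      have int: "algebraic_int (x g)" if "g \<in> F" for g
        using P_int x(1) that by blast
      have "w = (\<Prod>g\<in>F - {g\<^sub>0} - {g\<^sub>1}. x g) * x g\<^sub>1"
        unfolding w_def using psubset.hyps g1 by (subst prod.remove[of _ g\<^sub>1]) (auto simp: mult.commute)
      then have wP: "w \<in> P"
        using int x(1) g1 by (auto intro!: P_mult algebraic_int_prod)
      have nw: "nm (\<tau> (h w)) = (\<Prod>g\<in>F - {g\<^sub>0}. nm (\<tau> (h (x g))))" if "h \<in> F" for h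
      proof -
        interpret h: field_embedding h
          using galois_embedding that psubset.prems(1) by blast
        show ?thesis
          by (simp add: w_def h.hom_prod \<tau>.hom_prod nm_prod)
      qed
      have "x g\<^sub>0 + w \<in> P"
        using x(1)[OF g0] wP by (rule P_add)
      then obtain h where h: "h \<in> F" "nm (\<tau> (h (x g\<^sub>0 + w))) < 1"
        using psubset.prems(2) by blast
      interpret h: field_embedding h
        using galois_embedding h(1) psubset.prems(1) by blast
      have sum: "\<tau> (h (x g\<^sub>0 + w)) = \<tau> (h (x g\<^sub>0)) + \<tau> (h w)"
        by (simp add: h.hom_add \<tau>.hom_add)
      have False
      proof (cases "h = g\<^sub>0")
        case True
        have "nm (\<tau> (h w)) = 1"
          unfolding nw[OF h(1)] using unit h(1) True by (intro prod.neutral) auto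
        moreover have "nm (\<tau> (h (x g\<^sub>0))) < 1"
          using small[OF g0] True by simp
        ultimately have "nm (\<tau> (h (x g\<^sub>0 + w))) = 1"
          unfolding sum using nm_add_eq[of "\<tau> (h (x g\<^sub>0))" "\<tau> (h w)"] by (simp add: add.commute)
        with h(2) show False by simp
      next
        case False
        have "nm (\<tau> (h w)) = nm (\<tau> (h (x h))) * (\<Prod>g\<in>F - {g\<^sub>0} - {h}. nm (\<tau> (h (x g))))"
          unfolding nw[OF h(1)] using psubset.hyps h(1) False by (subst prod.remove[of _ h]) auto
        also have "(\<Prod>g\<in>F - {g\<^sub>0} - {h}. nm (\<tau> (h (x g)))) = 1"
          using unit h(1) by (intro prod.neutral) auto
        finally have "nm (\<tau> (h w)) < 1"
          using small[OF h(1)] by simp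
        moreover have "nm (\<tau> (h (x g\<^sub>0))) = 1"
          using unit[OF g0 h(1) False] .
        ultimately have "nm (\<tau> (h (x g\<^sub>0 + w))) = 1"
          unfolding sum using nm_add_eq[of "\<tau> (h w)" "\<tau> (h (x g\<^sub>0))"] by simp
        with h(2) show False by simp
      qed
      then show ?thesis ..
    qed
  qed
qed

text \<open>Maximality of primes above \<open>p\<close>, on an integral equation of
  \<open>x\<close>. Its terms below the first coefficient a_i prime to \<open>p\<close> lie in
  \<open>P\<close>, hence so does the remainder x^i s, and primality puts \<open>s\<close> into
  \<open>P\<close> if \<open>x\<close> is not there. Then |s| < 1, whereas s = a_i + x u with |x u|
  < 1 and |a_i| = 1.\<close>

lemma prime_eq_val_ideal_if_subset:
  assumes sub: "P \<subseteq> val_ideal \<tau>" shows "P = val_ideal \<tau>"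
proof
  interpret E: padic_embedding p T \<tau> "card B"
    by (rule padic_embedding_if_embedding[OF \<tau>])
  show "val_ideal \<tau> \<subseteq> P"
  proof
    fix x assume "x \<in> val_ideal \<tau>"
    then have x: "algebraic_int x" "nm (\<tau> x) < 1"
      by (simp_all add: val_ideal_def)
    show "x \<in> P"
    proof (rule ccontr)
      assume xP: "x \<notin> P"
      obtain f :: "int poly" where f: "ipoly f x = 0" "Polynomial.lead_coeff f = 1"
        using x(1) unfolding algebraic_int_altdef_ipoly by blast
      let ?a = "Polynomial.coeff f"
      define d where "d = Polynomial.degree f"
      have ad: "\<not> int p dvd ?a d"
        using f(2) p_gt_1 by (simp add: d_def)
      define i where "i = (LEAST i. \<not> int p dvd ?a i)"
      have i: "\<not> int p dvd ?a i"
        unfolding i_def using ad by (rule LeastI)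
      have below: "int p dvd ?a j" if "j < i" for j
        using that not_less_Least unfolding i_def by blast
      have id: "i \<le> d"
        unfolding i_def using ad by (rule Least_le)
      define s where "s = (\<Sum>j=i..d. of_int (?a j) * x ^ (j - i))"
      have "0 = (\<Sum>j\<le>d. of_int (?a j) * x ^ j)"
        using f(1) ipoly_eq_sum[of f d x] by (simp add: d_def)
      also have "{..d} = {..<i} \<union> {i..d}"
        using id by auto
      also have "(\<Sum>j\<in>\<dots>. of_int (?a j) * x ^ j)
          = (\<Sum>j<i. of_int (?a j) * x ^ j) + (\<Sum>j=i..d. of_int (?a j) * x ^ j)"
        by (rule sum.union_disjoint) auto
      also have "(\<Sum>j=i..d. of_int (?a j) * x ^ j) = x ^ i * s"
        unfolding s_def sum_distrib_left
      proof (intro sum.cong refl)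
        fix j assume "j \<in> {i..d}"
        then have "x ^ j = x ^ i * x ^ (j - i)"
          by (simp flip: power_add)
        then show "of_int (?a j) * x ^ j = x ^ i * (of_int (?a j) * x ^ (j - i))"
          by (simp add: mult.left_commute)
      qed
      finally have "x ^ i * s = - (\<Sum>j<i. of_int (?a j) * x ^ j)"
        by (simp add: eq_neg_iff_add_eq_0 add.commute)
      moreover have "(\<Sum>j<i. x ^ j * of_int (?a j)) \<in> P"
        using below x(1) by (intro P_sum P_mult algebraic_int_power) (auto simp: P_of_int)
      ultimately have "x ^ i * s \<in> P"
        by (auto simp: mult.commute intro: P_minus)
      moreover have "algebraic_int s"
        unfolding s_def using x(1) by (intro algebraic_int_sum algebraic_int_mult algebraic_int_power) auto
      ultimately have "s \<in> P"
        using P_prime[of "x ^ i" s] P_power[of x i] x(1) xP by (auto simp: algebraic_int_power)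
      then have ns: "nm (\<tau> s) < 1"
        using sub by (auto simp: val_ideal_def)
      define u where "u = (\<Sum>j=Suc i..d. of_int (?a j) * x ^ (j - Suc i))"
      have "s = of_int (?a i) + x * u"
      proof -
        have "s = of_int (?a i) + (\<Sum>j=Suc i..d. of_int (?a j) * x ^ (j - i))"
          unfolding s_def using id by (subst sum.atLeast_Suc_atMost) auto
        also have "(\<Sum>j=Suc i..d. of_int (?a j) * x ^ (j - i)) = x * u"
          unfolding u_def sum_distrib_left
        proof (intro sum.cong refl)
          fix j assume "j \<in> {Suc i..d}"
          then have "j - i = Suc (j - Suc i)"
            by auto
          then show "of_int (?a j) * x ^ (j - i) = x * (of_int (?a j) * x ^ (j - Suc i))"
            by (simp only: power_Suc mult.left_commute)
        qed
        finally show ?thesis .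
      qed
      then have "of_int (?a i) = \<tau> s - \<tau> x * \<tau> u"
        by (simp add: E.hom_add E.hom_mult)
      moreover have "nm (\<tau> x * \<tau> u) < 1"
      proof -
        have "algebraic_int u"
          unfolding u_def using x(1) by (intro algebraic_int_sum algebraic_int_mult algebraic_int_power) auto
        then have "nm (\<tau> x) * nm (\<tau> u) \<le> nm (\<tau> x) * 1"
          by (intro mult_left_mono E.av_le_1) auto
        then show ?thesis
          using x(2) by (simp add: nm_mult)
      qed
      ultimately have "nm (of_int (?a i) :: 'c) < 1"
        using nm_diff_less[OF ns] by simp
      then show False
        using i nm_of_int_dvd by simp
    qed
  qed
qed (rule sub)

end

lemma prime_eq_val_ideal:
  assumes \<tau>: "field_embedding (\<tau> :: 'm \<Rightarrow> 'c)"
  shows "\<exists>g\<in>G. P = val_ideal (\<tau> \<circ> g)"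
proof -
  obtain g where g: "g \<in> G" "\<forall>x\<in>P. nm (\<tau> (g x)) < 1"
    using prime_avoidance[OF \<tau> finite_G order_refl P_conjugate_small[OF \<tau>]] by blast
  then have "P \<subseteq> val_ideal (\<tau> \<circ> g)"
    using P_int by (auto simp: val_ideal_def)
  then have "P = val_ideal (\<tau> \<circ> g)"
    by (rule prime_eq_val_ideal_if_subset[OF embedding_comp_galois[OF \<tau> g(1)]])
  then show ?thesis
    using g(1) by blast
qed

text \<open>If \<open>\<bar>x\<bar> < 1\<close> in the local field then \<open>x\<^sup>n \<rightarrow> 0\<close>, hence \<open>\<phi>(x)\<^sup>n \<rightarrow> 0\<close> by continuity.\<close>

lemma continuous_embedding_val_ideal:
  fixes \<phi> :: "(nat \<Rightarrow> 'm) set \<Rightarrow> 'c"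
  assumes \<tau>: "field_embedding (\<tau> :: 'm \<Rightarrow> 'c)"
    and \<phi>: "\<phi> \<in> ring_hom (local_field P) ring_of_type_algebra"
    and cont: "continuous_map (Metric_space.mtopology (carrier (local_field P)) (local_dist P)) euclidean \<phi>"
  shows "field_embedding (\<phi> \<circ> local_embed P)" "P = val_ideal (\<phi> \<circ> local_embed P)"
proof -
  \<comment> \<open>Some embedding \<rho> inducing \<open>P\<close> is available already; it gives
    coordinates on the local field in which \<phi> can be analysed.\<close>
  obtain g where g: "g \<in> G" "P = val_ideal (\<tau> \<circ> g)"
    using prime_eq_val_ideal[OF \<tau>] by blast
  define \<rho> where "\<rho> = \<tau> \<circ> g"
  have P_eq: "P = val_ideal \<rho>"
    by (simp add: g(2) \<rho>_def)
  interpret E: padic_embedding p T \<rho> "card B"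
    unfolding \<rho>_def by (rule padic_embedding_if_embedding[OF embedding_comp_galois[OF \<tau> g(1)]])
  let ?\<sigma> = "\<phi> \<circ> local_embed P"
  have \<sigma>: "?\<sigma> x = \<phi> (cls \<rho> (\<rho> x))" for x
    by (simp add: P_eq E.local_embed_eq)
  have carr: "cls \<rho> (\<rho> x) \<in> carrier (local_field P)" for x
    by (simp add: P_eq E.carrier_local_field)
  show emb: "field_embedding ?\<sigma>"
  proof
    show "?\<sigma> 1 = 1"
      unfolding \<sigma> using ring_hom_one[OF \<phi>] by (simp add: P_eq E.local_field_simps)
    fix x y
    show "?\<sigma> (x + y) = ?\<sigma> x + ?\<sigma> y"
      unfolding \<sigma> using ring_hom_add[OF \<phi> carr carr, of x y]
      by (simp add: P_eq E.local_field_add E.hom_add)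
    show "?\<sigma> (x * y) = ?\<sigma> x * ?\<sigma> y"
      unfolding \<sigma> using ring_hom_mult[OF \<phi> carr carr, of x y]
      by (simp add: P_eq E.local_field_mult E.hom_mult)
  qed
  interpret \<sigma>: field_embedding ?\<sigma> by (rule emb)
  have "P \<subseteq> val_ideal ?\<sigma>"
  proof
    fix x assume "x \<in> P"
    then have x: "algebraic_int x" "nm (\<rho> x) < 1"
      unfolding P_eq by (simp_all add: val_ideal_def)
    interpret M: Metric_space "carrier (local_field P)" "local_dist P"
      unfolding P_eq by (rule E.Metric_space_local) simp
    have "(\<lambda>n. nm (\<rho> x) ^ n) \<longlonglongrightarrow> 0"
      using x(2) by (intro LIMSEQ_realpow_zero) auto
    then have "(\<lambda>n. \<rho> (x ^ n)) \<longlonglongrightarrow> 0"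
      by (simp add: tendsto_iff_nm E.hom_power nm_power)
    then have "(\<lambda>n. local_dist P (cls \<rho> (\<rho> (x ^ n))) (cls \<rho> (\<rho> 0))) \<longlonglongrightarrow> 0"
      unfolding P_eq by (subst E.local_dist_tendsto_0_iff) auto
    then have "limitin M.mtopology (\<lambda>n. cls \<rho> (\<rho> (x ^ n))) (cls \<rho> (\<rho> 0)) sequentially"
      unfolding M.limitin_metric_dist_null using carr by (intro conjI always_eventually allI)
    then have "limitin euclidean (\<phi> \<circ> (\<lambda>n. cls \<rho> (\<rho> (x ^ n)))) (\<phi> (cls \<rho> (\<rho> 0))) sequentially"
      using cont by (rule continuous_map_limit[rotated])
    then have "(\<lambda>n. ?\<sigma> (x ^ n)) \<longlonglongrightarrow> ?\<sigma> 0"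
      unfolding limitin_canonical_iff \<sigma> by (simp add: o_def)
    then have lim: "(\<lambda>n. nm (?\<sigma> x) ^ n) \<longlonglongrightarrow> 0"
      unfolding \<sigma>.hom_0 \<sigma>.hom_power tendsto_iff_nm by (simp add: nm_power)
    have "nm (?\<sigma> x) < 1"
    proof (rule ccontr)
      assume "\<not> nm (?\<sigma> x) < 1"
      then have "1 \<le> nm (?\<sigma> x) ^ n" for n
        by (intro one_le_power) auto
      then have "1 \<le> (0::real)"
        by (intro LIMSEQ_le_const[OF lim]) auto
      then show False by simp
    qed
    then show "x \<in> val_ideal ?\<sigma>"
      using x(1) by (simp add: val_ideal_def)
  qed
  then show "P = val_ideal ?\<sigma>"
    by (rule prime_eq_val_ideal_if_subset[OF emb])
qed

end

lemma vimage_val_ideal: "g \<in> G \<Longrightarrow> g -` val_ideal \<tau> = val_ideal (\<tau> \<circ> g)" for \<tau> :: "'m \<Rightarrow> 'c"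
  by (auto simp: val_ideal_def galois_algebraic_int)

lemma finite_primes_above:
  assumes \<tau>: "field_embedding (\<tau> :: 'm \<Rightarrow> 'c)"
  shows "finite (primes_above p :: 'm set set)"
proof (rule finite_subset)
  show "primes_above p \<subseteq> (\<lambda>g. val_ideal (\<tau> \<circ> g)) ` G"
    using prime_eq_val_ideal[OF _ \<tau>] by blast
  show "finite ((\<lambda>g. val_ideal (\<tau> \<circ> g)) ` G)"
    using finite_G by simp
qed

end

section \<open>Specialising independence of columns\<close>

text \<open>\<open>y'\<close> is \<open>y\<close> with the entry at \<open>j\<close> chosen so that
  the pivot equation \<open>c\<close> holds; every equation \<open>d\<close> then turns into its
  eliminated form, divided by \<open>c j\<close>.\<close>

lemma pivot_sum:
  fixes c d y :: "'j \<Rightarrow> 'b::field"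
  assumes "finite S" "j \<in> S" "c j \<noteq> 0"
  defines "y' \<equiv> y(j := - (\<Sum>l\<in>S - {j}. c l * y l) / c j)"
  shows "(\<Sum>l\<in>S. d l * y' l) = (\<Sum>l\<in>S - {j}. (c j * d l - d j * c l) * y l) / c j"
proof -
  have "(\<Sum>l\<in>S. d l * y' l) = d j * y' j + (\<Sum>l\<in>S - {j}. d l * y' l)"
    using assms by (intro sum.remove)
  also have "(\<Sum>l\<in>S - {j}. d l * y' l) = (\<Sum>l\<in>S - {j}. d l * y l)"
    by (intro sum.cong) (auto simp: y'_def)
  also have "d j * y' j + (\<Sum>l\<in>S - {j}. d l * y l)
      = (c j * (\<Sum>l\<in>S - {j}. d l * y l) - d j * (\<Sum>l\<in>S - {j}. c l * y l)) / c j"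
    using assms(3) by (simp add: y'_def field_simps)
  also have "c j * (\<Sum>l\<in>S - {j}. d l * y l) - d j * (\<Sum>l\<in>S - {j}. c l * y l)
      = (\<Sum>l\<in>S - {j}. (c j * d l - d j * c l) * y l)"
    by (simp add: sum_distrib_left sum_subtractf left_diff_distrib mult.assoc)
  finally show ?thesis .
qed

text \<open>Gaussian elimination on the matrix \<open>b\<close>, carried out on \<open>a\<close> and \<open>b\<close> in parallel: every entry of
  \<open>a\<close> that specialises to a pivot is nonzero.\<close>

lemma independent_columns_if_specialised:
  fixes a :: "'i \<Rightarrow> 'j \<Rightarrow> 'a::field" and b :: "'i \<Rightarrow> 'j \<Rightarrow> 'b::field" and e :: "'k \<Rightarrow> 'j \<Rightarrow> 'b"
  assumes "finite S" "finite K"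
    and mult: "\<And>x y x' y'. (x, y) \<in> Sp \<Longrightarrow> (x', y') \<in> Sp \<Longrightarrow> (x * x', y * y') \<in> Sp"
    and diff: "\<And>x y x' y'. (x, y) \<in> Sp \<Longrightarrow> (x', y') \<in> Sp \<Longrightarrow> (x - x', y - y') \<in> Sp"
    and zero: "\<And>y. (0, y) \<in> Sp \<Longrightarrow> y = 0"
    and "\<And>i j. i \<in> I \<Longrightarrow> j \<in> S \<Longrightarrow> (a i j, b i j) \<in> Sp"
    and "\<And>y. \<lbrakk>\<And>i. i \<in> I \<Longrightarrow> (\<Sum>j\<in>S. b i j * y j) = 0; \<And>k. k \<in> K \<Longrightarrow> (\<Sum>j\<in>S. e k j * y j) = 0\<rbrakk>
        \<Longrightarrow> \<forall>j\<in>S. y j = 0"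
  shows "\<exists>T\<subseteq>S. card S \<le> card T + card K \<and>
     (\<forall>z. (\<forall>i\<in>I. (\<Sum>j\<in>T. a i j * z j) = 0) \<longrightarrow> (\<forall>j\<in>T. z j = 0))"
  using assms(1,2,6,7)
proof (induction "card S" arbitrary: S K a b e)
  case 0
  then have "S = {}"
    by simp
  then show ?case
    by (intro exI[of _ "{}"]) auto
next
  case (Suc n)
  note fin = Suc.prems(1,2) and Sp = Suc.prems(3) and triv = Suc.prems(4)
  show ?case
  proof (cases "\<exists>i\<in>I. \<exists>j\<in>S. b i j \<noteq> 0")
    case True
    then obtain i j where ij: "i \<in> I" "j \<in> S" "b i j \<noteq> 0"
      by blast
    have aij: "a i j \<noteq> 0"
      using zero[of "b i j"] Sp[OF ij(1,2)] ij(3) by metis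
    define a' where "a' k l = a i j * a k l - a k j * a i l" for k l
    define b' where "b' k l = b i j * b k l - b k j * b i l" for k l
    define e' where "e' k l = b i j * e k l - e k j * b i l" for k l
    have card: "card S = Suc (card (S - {j}))"
      using card.remove[OF fin(1) ij(2)] .
    have "\<exists>T\<subseteq>S - {j}. card (S - {j}) \<le> card T + card K \<and>
        (\<forall>z. (\<forall>i\<in>I. (\<Sum>j\<in>T. a' i j * z j) = 0) \<longrightarrow> (\<forall>j\<in>T. z j = 0))"
    proof (rule Suc.hyps(1))
      show "n = card (S - {j})"
        using Suc.hyps(2) card by simp
      show "finite (S - {j})" "finite K"
        using fin by auto
      show "(a' k l, b' k l) \<in> Sp" if "k \<in> I" "l \<in> S - {j}" for k l
        unfolding a'_def b'_def using that ij by (intro diff mult Sp) auto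
      fix y
      assume y: "\<And>k. k \<in> I \<Longrightarrow> (\<Sum>l\<in>S - {j}. b' k l * y l) = 0" "\<And>k. k \<in> K \<Longrightarrow> (\<Sum>l\<in>S - {j}. e' k l * y l) = 0"
      define y' where "y' = y(j := - (\<Sum>l\<in>S - {j}. b i l * y l) / b i j)"
      have "\<forall>l\<in>S. y' l = 0"
      proof (rule triv)
        show "(\<Sum>l\<in>S. b k l * y' l) = 0" if "k \<in> I" for k
          using pivot_sum[OF fin(1) ij(2), of "b i" "b k" y] ij(3) y(1)[OF that] by (simp add: y'_def b'_def)
        show "(\<Sum>l\<in>S. e k l * y' l) = 0" if "k \<in> K" for k
          using pivot_sum[OF fin(1) ij(2), of "b i" "e k" y] ij(3) y(2)[OF that] by (simp add: y'_def e'_def)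
      qed
      note zero' = this
      show "\<forall>l\<in>S - {j}. y l = 0"
      proof
        fix l assume l: "l \<in> S - {j}"
        then have "y' l = 0"
          using zero' by blast
        with l show "y l = 0"
          by (simp add: y'_def)
      qed
    qed
    then obtain T where T: "T \<subseteq> S - {j}" "card (S - {j}) \<le> card T + card K"
      "\<And>z. (\<forall>i\<in>I. (\<Sum>j\<in>T. a' i j * z j) = 0) \<Longrightarrow> (\<forall>j\<in>T. z j = 0)"
      by blast
    have finT: "finite T" "j \<notin> T"
      using T(1) fin(1) finite_subset by auto
    show ?thesis
    proof (intro exI[of _ "insert j T"] conjI allI impI)
      show "insert j T \<subseteq> S"
        using T(1) ij(2) by auto
      show "card S \<le> card (insert j T) + card K"
        using T(2) card finT by simp
      fix z assume z: "\<forall>k\<in>I. (\<Sum>l\<in>insert j T. a k l * z l) = 0"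
      have eq: "(\<Sum>l\<in>T. a k l * z l) = - (a k j * z j)" if "k \<in> I" for k
        using z that finT by (simp add: eq_neg_iff_add_eq_0 add.commute)
      have zT: "\<forall>l\<in>T. z l = 0"
      proof (rule T(3), rule ballI)
        fix k assume k: "k \<in> I"
        have "(\<Sum>l\<in>T. a' k l * z l) = a i j * (\<Sum>l\<in>T. a k l * z l) - a k j * (\<Sum>l\<in>T. a i l * z l)"
          by (simp add: a'_def sum_distrib_left sum_subtractf left_diff_distrib mult.assoc)
        also have "\<dots> = 0"
          using eq[OF k] eq[OF ij(1)] by simp
        finally show "(\<Sum>l\<in>T. a' k l * z l) = 0" .
      qed
      then have "a i j * z j = 0"
        using eq[OF ij(1)] by simp
      then show "\<forall>l\<in>insert j T. z l = 0"
        using zT aij by simp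
    qed
  next
    case bzero: False
    show ?thesis
    \<comment> \<open>No pivot is left in \<open>b\<close>, so one is taken from the extra rows
      \<open>e\<close>. It has no counterpart in \<open>a\<close>: column \<open>j\<close> is given
      up together with row \<open>k\<close>, which accounts for \<open>card K\<close> in the
      bound.\<close>
    proof (cases "\<exists>k\<in>K. \<exists>j\<in>S. e k j \<noteq> 0")
      case True
      then obtain k j where kj: "k \<in> K" "j \<in> S" "e k j \<noteq> 0"
        by blast
      define e' where "e' i l = e k j * e i l - e i j * e k l" for i l
      have card: "card S = Suc (card (S - {j}))" "card K = Suc (card (K - {k}))"
        using card.remove[OF fin(1) kj(2)] card.remove[OF fin(2) kj(1)] .
      have "\<exists>T\<subseteq>S - {j}. card (S - {j}) \<le> card T + card (K - {k}) \<and>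
          (\<forall>z. (\<forall>i\<in>I. (\<Sum>j\<in>T. a i j * z j) = 0) \<longrightarrow> (\<forall>j\<in>T. z j = 0))"
      proof (rule Suc.hyps(1))
        show "n = card (S - {j})"
          using Suc.hyps(2) card by simp
        show "finite (S - {j})" "finite (K - {k})"
          using fin by auto
        show "(a i l, b i l) \<in> Sp" if "i \<in> I" "l \<in> S - {j}" for i l
          using that by (intro Sp) auto
        fix y
        assume y: "\<And>i. i \<in> K - {k} \<Longrightarrow> (\<Sum>l\<in>S - {j}. e' i l * y l) = 0"
        define y' where "y' = y(j := - (\<Sum>l\<in>S - {j}. e k l * y l) / e k j)"
        have "\<forall>l\<in>S. y' l = 0"
        proof (rule triv)
          show "(\<Sum>l\<in>S. b i l * y' l) = 0" if "i \<in> I" for i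
            using bzero that by (intro sum.neutral) auto
          show "(\<Sum>l\<in>S. e i l * y' l) = 0" if "i \<in> K" for i
          proof (cases "i = k")
            case True
            then show ?thesis
              using pivot_sum[OF fin(1) kj(2), of "e k" "e k" y] kj(3) by (simp add: y'_def)
          next
            case False
            then show ?thesis
              using pivot_sum[OF fin(1) kj(2), of "e k" "e i" y] kj(3) y[of i] that by (simp add: y'_def e'_def)
          qed
        qed
        note zero' = this
        show "\<forall>l\<in>S - {j}. y l = 0"
        proof
          fix l assume l: "l \<in> S - {j}"
          then have "y' l = 0"
            using zero' by blast
          with l show "y l = 0"
            by (simp add: y'_def)
        qed
      qed
      then obtain T where T: "T \<subseteq> S - {j}" "card (S - {j}) \<le> card T + card (K - {k})"
        "\<forall>z. (\<forall>i\<in>I. (\<Sum>j\<in>T. a i j * z j) = 0) \<longrightarrow> (\<forall>j\<in>T. z j = 0)"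
        by blast
      then show ?thesis
        using card by (intro exI[of _ T]) auto
    next
      case False
      \<comment> \<open>All rows vanish on \<open>S\<close>, so even the all-ones vector satisfies
        every equation; this is possible only if no column is left.\<close>
      have "\<forall>j\<in>S. (1 :: 'b) = 0"
        using bzero False by (intro triv[of "\<lambda>_. 1"]) auto
      then have "S = {}"
        by auto
      then show ?thesis
        using Suc.hyps(2) by simp
    qed
  qed
qed

section \<open>Evaluating polynomials at two points\<close>

text \<open>Agrees with the expression in \<open>rat_alg_indep\<close>: algebraic independence of
  \<open>x\<close> says that no nonzero polynomial in the first \<open>n\<close> variables has
  \<open>peval\<close> equal to 0.\<close>

definition peval :: "nat \<Rightarrow> (nat \<Rightarrow> 'a::field_char_0) \<Rightarrow> ((nat \<Rightarrow>\<^sub>0 nat) \<Rightarrow>\<^sub>0 rat) \<Rightarrow> 'a" where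
  "peval n x f = (\<Sum>m\<in>Poly_Mapping.keys f. of_rat (Poly_Mapping.lookup f m) *
     (\<Prod>i<n. x i ^ Poly_Mapping.lookup m i))"

lemma peval_superset:
  assumes "finite A" "Poly_Mapping.keys f \<subseteq> A"
  shows "peval n x f = (\<Sum>m\<in>A. of_rat (Poly_Mapping.lookup f m) * (\<Prod>i<n. x i ^ Poly_Mapping.lookup m i))"
  unfolding peval_def using assms by (intro sum.mono_neutral_left) (auto simp: in_keys_iff)

lemma peval_0 [simp]: "peval n x 0 = 0"
  by (simp add: peval_def)

lemma peval_add: "peval n x (f + g) = peval n x f + peval n x g"
proof -
  let ?A = "Poly_Mapping.keys f \<union> Poly_Mapping.keys g"
  have "Poly_Mapping.keys (f + g) \<subseteq> ?A"
    by (rule Poly_Mapping.keys_add)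
  then show ?thesis
    using peval_superset[of ?A "f + g" n x] peval_superset[of ?A f n x] peval_superset[of ?A g n x]
    by (simp add: lookup_add of_rat_add distrib_right sum.distrib)
qed

lemma peval_diff: "peval n x (f - g) = peval n x f - peval n x g"
  using peval_add[of n x "f - g" g] by simp

lemma peval_sum: "peval n x (sum f A) = (\<Sum>i\<in>A. peval n x (f i))"
  by (induction A rule: infinite_finite_induct) (simp_all add: peval_add)

lemma peval_single: "peval n x (Poly_Mapping.single m c) = of_rat c * (\<Prod>i<n. x i ^ Poly_Mapping.lookup m i)"
  by (simp add: peval_def)

lemma poly_mapping_eq_sum_single:
  "f = (\<Sum>m\<in>Poly_Mapping.keys f. Poly_Mapping.single m (Poly_Mapping.lookup f m))"
proof (rule poly_mapping_eqI)
  fix k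
  have "Poly_Mapping.lookup (\<Sum>m\<in>Poly_Mapping.keys f. Poly_Mapping.single m (Poly_Mapping.lookup f m)) k
      = (\<Sum>m\<in>Poly_Mapping.keys f. if m = k then Poly_Mapping.lookup f m else 0)"
    by (simp add: lookup_sum lookup_single when_def)
  also have "\<dots> = Poly_Mapping.lookup f k"
    by (simp add: in_keys_iff)
  finally show "Poly_Mapping.lookup f k
      = Poly_Mapping.lookup (\<Sum>m\<in>Poly_Mapping.keys f. Poly_Mapping.single m (Poly_Mapping.lookup f m)) k" ..
qed

lemma peval_mult: "peval n x (f * g) = peval n x f * peval n x g"
proof -
  let ?s = "\<lambda>f m. Poly_Mapping.single m (Poly_Mapping.lookup f m)"
  have "f * g = (\<Sum>m\<in>Poly_Mapping.keys f. \<Sum>k\<in>Poly_Mapping.keys g. ?s f m * ?s g k)"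
    by (subst poly_mapping_eq_sum_single[of f], subst poly_mapping_eq_sum_single[of g]) (rule sum_product)
  then have "peval n x (f * g)
      = (\<Sum>m\<in>Poly_Mapping.keys f. \<Sum>k\<in>Poly_Mapping.keys g. peval n x (?s f m) * peval n x (?s g k))"
    by (simp add: peval_sum mult_single peval_single of_rat_mult lookup_add power_add prod.distrib mult_ac)
  also have "\<dots> = peval n x (\<Sum>m\<in>Poly_Mapping.keys f. ?s f m) * peval n x (\<Sum>k\<in>Poly_Mapping.keys g. ?s g k)"
    by (simp only: sum_product peval_sum)
  finally show ?thesis
    by (simp only: poly_mapping_eq_sum_single[symmetric])
qed

text \<open>The specialisation sending each x_i to y_i, kept as a graph on the ring generated by the
  x_i, so that ring operations can be treated before it is known to be a function. That last point
  is \<open>eval_pairs_zero\<close>.\<close>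

definition eval_pairs :: "nat \<Rightarrow> (nat \<Rightarrow> 'a::field_char_0) \<Rightarrow> (nat \<Rightarrow> 'b::field_char_0) \<Rightarrow> ('a \<times> 'b) set" where
  "eval_pairs n x y =
     {(peval n x f, peval n y f) | f. \<forall>m\<in>Poly_Mapping.keys f. Poly_Mapping.keys m \<subseteq> {..<n}}"

lemma eval_pairsI:
  "(\<And>m. m \<in> Poly_Mapping.keys f \<Longrightarrow> Poly_Mapping.keys m \<subseteq> {..<n}) \<Longrightarrow> (peval n x f, peval n y f) \<in> eval_pairs n x y"
  unfolding eval_pairs_def by blast

lemma eval_pairsE:
  assumes "(a, b) \<in> eval_pairs n x y"
  obtains f where "a = peval n x f" "b = peval n y f" "\<forall>m\<in>Poly_Mapping.keys f. Poly_Mapping.keys m \<subseteq> {..<n}"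
  using assms unfolding eval_pairs_def by blast

lemma eval_pairs_diff:
  assumes "(a, b) \<in> eval_pairs n x y" "(a', b') \<in> eval_pairs n x y"
  shows "(a - a', b - b') \<in> eval_pairs n x y"
proof -
  obtain f where f: "a = peval n x f" "b = peval n y f" "\<forall>m\<in>Poly_Mapping.keys f. Poly_Mapping.keys m \<subseteq> {..<n}"
    using eval_pairsE[OF assms(1)] .
  obtain g where g: "a' = peval n x g" "b' = peval n y g" "\<forall>m\<in>Poly_Mapping.keys g. Poly_Mapping.keys m \<subseteq> {..<n}"
    using eval_pairsE[OF assms(2)] .
  have "Poly_Mapping.keys (f - g) \<subseteq> Poly_Mapping.keys f \<union> Poly_Mapping.keys g"
    by (rule keys_diff)
  then have "(peval n x (f - g), peval n y (f - g)) \<in> eval_pairs n x y"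
    using f(3) g(3) by (intro eval_pairsI) blast
  then show ?thesis
    by (simp add: peval_diff f g)
qed

lemma eval_pairs_mult:
  assumes "(a, b) \<in> eval_pairs n x y" "(a', b') \<in> eval_pairs n x y"
  shows "(a * a', b * b') \<in> eval_pairs n x y"
proof -
  obtain f where f: "a = peval n x f" "b = peval n y f" "\<forall>m\<in>Poly_Mapping.keys f. Poly_Mapping.keys m \<subseteq> {..<n}"
    using eval_pairsE[OF assms(1)] .
  obtain g where g: "a' = peval n x g" "b' = peval n y g" "\<forall>m\<in>Poly_Mapping.keys g. Poly_Mapping.keys m \<subseteq> {..<n}"
    using eval_pairsE[OF assms(2)] .
  have "(peval n x (f * g), peval n y (f * g)) \<in> eval_pairs n x y"
  proof (rule eval_pairsI)
    fix m assume "m \<in> Poly_Mapping.keys (f * g)"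
    then obtain k l where kl: "m = k + l" "k \<in> Poly_Mapping.keys f" "l \<in> Poly_Mapping.keys g"
      using keys_mult[of f g] by blast
    then have "Poly_Mapping.keys m \<subseteq> Poly_Mapping.keys k \<union> Poly_Mapping.keys l"
      using Poly_Mapping.keys_add[of k l] by simp
    then show "Poly_Mapping.keys m \<subseteq> {..<n}"
      using f(3) g(3) kl by blast
  qed
  then show ?thesis
    by (simp add: peval_mult f g)
qed

lemma eval_pairs_rational_combination:
  "(\<Sum>i<n. of_rat (q i) * x i, \<Sum>i<n. of_rat (q i) * y i) \<in> eval_pairs n x y"
proof -
  define f where "f = (\<Sum>i<n. Poly_Mapping.single (Poly_Mapping.single i (1::nat)) (q i))"
  have prod: "(\<Prod>j<n. z j ^ Poly_Mapping.lookup (Poly_Mapping.single i (1::nat)) j) = z i" if "i < n"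
    for z :: "nat \<Rightarrow> 'c::field_char_0" and i
  proof -
    have "(\<Prod>j<n. z j ^ Poly_Mapping.lookup (Poly_Mapping.single i (1::nat)) j) = (\<Prod>j<n. if j = i then z j else 1)"
      by (intro prod.cong) (auto simp: lookup_single when_def)
    also have "\<dots> = z i"
      using that by simp
    finally show ?thesis .
  qed
  have eval: "peval n z f = (\<Sum>i<n. of_rat (q i) * z i)" for z :: "nat \<Rightarrow> 'c::field_char_0"
    unfolding f_def peval_sum peval_single by (intro sum.cong) (simp_all add: prod del: One_nat_def)
  have keys: "Poly_Mapping.keys m \<subseteq> {..<n}" if m: "m \<in> Poly_Mapping.keys f" for m
  proof -
    have "Poly_Mapping.keys f \<subseteq> (\<Union>i<n. Poly_Mapping.keys (Poly_Mapping.single (Poly_Mapping.single i (1::nat)) (q i)))"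
      unfolding f_def by (rule keys_sum)
    also have "\<dots> \<subseteq> (\<Union>i<n. {Poly_Mapping.single i 1})"
      by auto
    finally obtain i where "i < n" "m = Poly_Mapping.single i 1"
      using m by blast
    then show ?thesis
      by simp
  qed
  show ?thesis
    using eval_pairsI[OF keys, of f] unfolding eval .
qed

text \<open>Algebraic independence leaves only the zero polynomial with value 0 at
  \<open>x\<close>.\<close>

lemma eval_pairs_zero:
  assumes "rat_alg_indep n x" "(0, b) \<in> eval_pairs n x y" shows "b = 0"
proof -
  obtain f where f: "0 = peval n x f" "b = peval n y f" "\<forall>m\<in>Poly_Mapping.keys f. Poly_Mapping.keys m \<subseteq> {..<n}"
    using eval_pairsE[OF assms(2)] .
  then have "f = 0"
    using assms(1)[unfolded rat_alg_indep_def, rule_format, of f] by (simp add: peval_def)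
  then show ?thesis
    by (simp add: f(2))
qed

section \<open>Units\<close>

abbreviation OU :: "'a::field_char_0 set" where
  "OU \<equiv> Units ring_of_integers"

lemma OU_iff: "u \<in> OU \<longleftrightarrow> algebraic_int u \<and> u \<noteq> 0 \<and> algebraic_int (inverse u)"
proof
  assume "u \<in> OU"
  then obtain v where v: "algebraic_int u" "algebraic_int v" "v * u = 1"
    by (auto simp: Units_def)
  then have "u \<noteq> 0"
    by auto
  moreover have "inverse u = v"
    using v(3) by (metis inverse_unique mult.commute)
  ultimately show "algebraic_int u \<and> u \<noteq> 0 \<and> algebraic_int (inverse u)"
    using v by simp
next
  assume "algebraic_int u \<and> u \<noteq> 0 \<and> algebraic_int (inverse u)"
  then show "u \<in> OU"
    unfolding Units_def by (auto intro!: bexI[of _ "inverse u"])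
qed

lemma algebraic_int_imp_algebraic: "algebraic_int x \<Longrightarrow> Polynomial.algebraic x"
  by (erule algebraic_int.cases, rule algebraicI) auto

lemma OU_nonzero: "u \<in> OU \<Longrightarrow> u \<noteq> 0"
  by (simp add: OU_iff)

lemma OU_1: "1 \<in> OU"
  by (simp add: OU_iff)

lemma OU_mult: "u \<in> OU \<Longrightarrow> v \<in> OU \<Longrightarrow> u * v \<in> OU"
  by (simp add: OU_iff algebraic_int_mult)

lemma OU_inverse: "u \<in> OU \<Longrightarrow> inverse u \<in> OU"
  by (simp add: OU_iff)

lemma OU_power: "u \<in> OU \<Longrightarrow> u ^ n \<in> OU"
  by (induction n) (simp_all add: OU_1 OU_mult)

lemma OU_powi: "u \<in> OU \<Longrightarrow> u powi k \<in> OU"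
  by (simp add: power_int_def OU_power OU_inverse)

lemma OU_prod: "(\<And>i. i \<in> A \<Longrightarrow> f i \<in> OU) \<Longrightarrow> prod f A \<in> OU"
  by (induction A rule: infinite_finite_induct) (simp_all add: OU_1 OU_mult)

text \<open>What the real and the p-adic logarithm of units have in common.\<close>

definition unit_additive :: "('a::field_char_0 \<Rightarrow> 'k::field_char_0) \<Rightarrow> bool" where
  "unit_additive F \<longleftrightarrow> (\<forall>u\<in>OU. \<forall>v\<in>OU. F (u * v) = F u + F v)"

definition mult_indep :: "'a::field_char_0 set \<Rightarrow> bool" where
  "mult_indep W \<longleftrightarrow> (\<forall>a. (\<Prod>w\<in>W. w powi a w) = 1 \<longrightarrow> (\<forall>w\<in>W. a w = 0))"

lemma additive_prod_powi:
  fixes F :: "'a::field_char_0 \<Rightarrow> 'k::field_char_0"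
  assumes "unit_additive F"
    and f: "\<And>i. i \<in> A \<Longrightarrow> f i \<in> OU"
  shows "F (\<Prod>i\<in>A. f i powi a i) = (\<Sum>i\<in>A. of_int (a i) * F (f i))"
proof -
  have F: "F (u * v) = F u + F v" if "u \<in> OU" "v \<in> OU" for u v
    using assms(1) that unfolding unit_additive_def by blast
  have F1: "F 1 = 0"
    using F[OF OU_1 OU_1] by simp
  have Finv: "F (inverse u) = - F u" if "u \<in> OU" for u
    using F[OF that OU_inverse[OF that]] OU_nonzero[OF that] F1 by (simp add: eq_neg_iff_add_eq_0 add.commute)
  have Fpow: "F (u ^ n) = of_nat n * F u" if "u \<in> OU" for u n
    by (induction n) (simp_all add: F1 F OU_power that distrib_right)
  have Fpowi: "F (u powi k) = of_int k * F u" if "u \<in> OU" for u k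
    using that by (simp add: power_int_def Fpow Finv OU_inverse)
  show ?thesis
    using f by (induction A rule: infinite_finite_induct) (simp_all add: F1 F Fpowi OU_powi OU_prod)
qed

text \<open>The same coefficients \<open>q\<close> serve for the real and the p-adic logarithm.\<close>

lemma mult_indep_extend:
  assumes V: "finite V" "V \<subseteq> OU" "mult_indep V" and u: "u \<in> OU"
    and dep: "\<not> mult_indep (insert u V) \<or> u \<in> V"
  shows "\<exists>q. (\<forall>F :: 'a::field_char_0 \<Rightarrow> real. unit_additive F \<longrightarrow> F u = (\<Sum>w\<in>V. of_rat (q w) * F w)) \<and>
    (\<forall>F :: 'a::field_char_0 \<Rightarrow> 'k::field_char_0. unit_additive F \<longrightarrow> F u = (\<Sum>w\<in>V. of_rat (q w) * F w))"
proof (cases "u \<in> V")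
  case True
  define q where "q w = (if w = u then 1 else 0 :: rat)" for w
  have main: "F u = (\<Sum>w\<in>V. of_rat (q w) * F w)" for F :: "'a \<Rightarrow> 'b::field_char_0"
  proof -
    have "(\<Sum>w\<in>V. of_rat (q w) * F w) = (\<Sum>w\<in>V. if w = u then F w else 0)"
      by (intro sum.cong) (auto simp: q_def)
    then show ?thesis
      using V(1) True by simp
  qed
  show ?thesis
    by (intro exI[of _ q] conjI allI impI; rule main)
next
  case False
  with dep obtain a where a: "(\<Prod>w\<in>insert u V. w powi a w) = 1" "\<exists>w\<in>insert u V. a w \<noteq> 0"
    unfolding mult_indep_def by blast
  have "a u \<noteq> 0"
  proof
    assume "a u = 0"
    then have "(\<Prod>w\<in>V. w powi a w) = 1"
      using a(1) False V(1) by simp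
    then have "\<forall>w\<in>V. a w = 0"
      using V(3) unfolding mult_indep_def by blast
    with a(2) \<open>a u = 0\<close> show False
      by auto
  qed
  \<comment> \<open>The relation is solved for \<open>u\<close>, whose exponent is nonzero because
    \<open>V\<close> is independent.\<close>
  define q where "q w = - rat_of_int (a w) / rat_of_int (a u)" for w
  have main: "F u = (\<Sum>w\<in>V. of_rat (q w) * F w)"
    if F: "unit_additive F" for F :: "'a \<Rightarrow> 'b::field_char_0"
  proof -
    have "F 1 = 0"
      using F OU_1 by (force simp: unit_additive_def)
    moreover have "F (\<Prod>w\<in>insert u V. w powi a w) = (\<Sum>w\<in>insert u V. of_int (a w) * F w)"
      using u V(2) by (intro additive_prod_powi F) auto
    ultimately have "of_int (a u) * F u + (\<Sum>w\<in>V. of_int (a w) * F w) = 0"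
      using a(1) False V(1) by simp
    then have "F u = - (\<Sum>w\<in>V. of_int (a w) * F w) / of_int (a u)"
      using \<open>a u \<noteq> 0\<close> by (simp add: field_simps eq_neg_iff_add_eq_0)
    also have "\<dots> = (\<Sum>w\<in>V. of_rat (q w) * F w)"
      unfolding sum_negf[symmetric] sum_divide_distrib
      by (intro sum.cong) (simp_all add: q_def of_rat_divide of_rat_minus)
    finally show ?thesis .
  qed
  show ?thesis
    by (intro exI[of _ q] conjI allI impI; rule main; assumption)
qed

context galois_field
begin

lemma OU_galois: "g \<in> G \<Longrightarrow> u \<in> OU \<Longrightarrow> g u \<in> OU"
proof -
  assume g: "g \<in> G" and u: "u \<in> OU"
  interpret g: field_embedding g
    by (rule galois_embedding[OF g])
  show ?thesis
    using u by (simp add: OU_iff g.hom_algebraic_int flip: g.hom_inverse)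
qed

lemma norm_unit:
  assumes "u \<in> OU" shows "(\<Prod>g\<in>G. g u) \<in> {1, - 1}"
proof -
  obtain n where n: "(\<Prod>g\<in>G. g u) = of_int n"
    using norm_int[of u] assms by (auto simp: OU_iff elim: Ints_cases)
  obtain m where m: "(\<Prod>g\<in>G. g (inverse u)) = of_int m"
    using norm_int[of "inverse u"] assms by (auto simp: OU_iff elim: Ints_cases)
  have "(\<Prod>g\<in>G. g u) * (\<Prod>g\<in>G. g (inverse u)) = (\<Prod>g\<in>G. 1)"
    unfolding prod.distrib[symmetric]
  proof (intro prod.cong refl)
    fix g assume g: "g \<in> G"
    interpret g: field_embedding g
      by (rule galois_embedding[OF g])
    show "g u * g (inverse u) = 1"
      using OU_nonzero[OF assms] by (simp add: g.hom_inverse)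
  qed
  then have "of_int (n * m) = (1 :: 'm)"
    using n m by simp
  then have "n * m = 1"
    by (metis of_int_eq_1_iff)
  then have "n = 1 \<or> n = - 1"
    by (metis zmult_eq_1_iff)
  with n show ?thesis
    by auto
qed

section \<open>Real logarithms of units\<close>

context
  fixes \<tau> :: "'m \<Rightarrow> complex"
  assumes \<tau>: "field_embedding \<tau>"
begin

interpretation \<tau>: field_embedding \<tau>
  by (rule \<tau>)

definition Lr :: "'m \<Rightarrow> real" where
  "Lr u = ln (cmod (\<tau> u))"

lemma Lr_mult: "u \<in> OU \<Longrightarrow> v \<in> OU \<Longrightarrow> Lr (u * v) = Lr u + Lr v"
  using OU_nonzero[of u] OU_nonzero[of v] by (simp add: Lr_def \<tau>.hom_mult norm_mult ln_mult)

lemma unit_additive_Lr: "unit_additive Lr"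
  by (simp add: unit_additive_def Lr_mult)

text \<open>The norm of a unit is 1 or -1; this is the product formula for units.\<close>

lemma sum_Lr: "u \<in> OU \<Longrightarrow> (\<Sum>g\<in>G. Lr (g u)) = 0"
proof -
  assume u: "u \<in> OU"
  have "g u \<noteq> 0" if "g \<in> G" for g
    using OU_nonzero[OF OU_galois[OF that u]] .
  then have "(\<Sum>g\<in>G. Lr (g u)) = ln (\<Prod>g\<in>G. cmod (\<tau> (g u)))"
    unfolding Lr_def by (subst ln_prod) (auto simp: finite_G)
  also have "(\<Prod>g\<in>G. cmod (\<tau> (g u))) = cmod (\<tau> (\<Prod>g\<in>G. g u))"
    by (simp add: \<tau>.hom_prod prod_norm)
  also have "\<dots> = 1"
    using norm_unit[OF u] by (auto simp: \<tau>.hom_minus)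
  finally show ?thesis
    by simp
qed

text \<open>Rounding the multiples \<open>N\<lambda>\<close> of a real relation \<open>\<lambda>\<close> gives units with bounded conjugates; there are
  only finitely many, so two of them coincide.\<close>

lemma real_logs_independent:
  assumes W: "finite W" "W \<subseteq> OU" "mult_indep W"
    and rel: "\<And>g. g \<in> G \<Longrightarrow> (\<Sum>w\<in>W. Lr (g w) * y w) = 0"
  shows "\<forall>w\<in>W. y w = 0"
proof (rule ccontr)
  assume "\<not> ?thesis"
  then obtain u where u: "u \<in> W" "y u \<noteq> 0"
    by blast
  \<comment> \<open>Normalised so that \<open>l u\<close> is 1. The exponent of \<open>u\<close> in
    \<open>x N\<close> is then \<open>N\<close> itself, and equal values of \<open>x\<close> at
    different arguments give a nontrivial relation.\<close>
  define l where "l w = y w / y u" for w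
  define x where "x N = (\<Prod>w\<in>W. w powi \<lfloor>real N * l w\<rfloor>)" for N :: nat
  \<comment> \<open>The unrounded exponents contribute 0 by the relation, so the logarithms of the
    conjugates of \<open>x N\<close> stem from the fractional parts alone and are bounded
    independently of \<open>N\<close>.\<close>
  define C where "C = (\<Sum>g\<in>G. \<Sum>w\<in>W. \<bar>Lr (g w)\<bar>)"
  have bound: "cmod (\<tau> (g (x N))) \<le> exp C" if g: "g \<in> G" for g N
  proof -
    interpret g: field_embedding g
      by (rule galois_embedding[OF g])
    have gx: "g (x N) = (\<Prod>w\<in>W. g w powi \<lfloor>real N * l w\<rfloor>)"
      by (simp add: x_def g.hom_prod g.hom_powi)
    have "Lr (g (x N)) = (\<Sum>w\<in>W. of_int \<lfloor>real N * l w\<rfloor> * Lr (g w))"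
      unfolding gx using W(2) OU_galois[OF g] by (intro additive_prod_powi unit_additive_Lr) auto
    also have "\<dots> = (\<Sum>w\<in>W. (real N * l w) * Lr (g w)) - (\<Sum>w\<in>W. frac (real N * l w) * Lr (g w))"
      unfolding sum_subtractf[symmetric] by (intro sum.cong) (auto simp: frac_def algebra_simps)
    also have "(\<Sum>w\<in>W. (real N * l w) * Lr (g w)) = real N / y u * (\<Sum>w\<in>W. Lr (g w) * y w)"
      unfolding sum_distrib_left by (intro sum.cong) (auto simp: l_def)
    also have "\<dots> = 0"
      using rel[OF g] by simp
    finally have "Lr (g (x N)) \<le> \<bar>\<Sum>w\<in>W. frac (real N * l w) * Lr (g w)\<bar>"
      by simp
    also have "\<dots> \<le> (\<Sum>w\<in>W. \<bar>frac (real N * l w) * Lr (g w)\<bar>)"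
      by (rule sum_abs)
    also have "\<dots> \<le> (\<Sum>w\<in>W. \<bar>Lr (g w)\<bar>)"
    proof (rule sum_mono)
      fix w
      have "\<bar>frac (real N * l w)\<bar> \<le> 1"
        using frac_ge_0[of "real N * l w"] frac_lt_1[of "real N * l w"] by simp
      then show "\<bar>frac (real N * l w) * Lr (g w)\<bar> \<le> \<bar>Lr (g w)\<bar>"
        unfolding abs_mult by (rule mult_left_le_one_le[rotated 2]) auto
    qed
    also have "\<dots> \<le> C"
      unfolding C_def using finite_G g by (intro member_le_sum) (auto intro: sum_nonneg)
    finally have "Lr (g (x N)) \<le> C" .
    moreover have "g (x N) \<noteq> 0"
      unfolding gx using W(2) OU_galois[OF g] OU_nonzero by (intro OU_nonzero OU_prod OU_powi) auto
    ultimately show ?thesis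
      unfolding Lr_def by (metis exp_le_cancel_iff exp_ln \<tau>.hom_eq_0 zero_less_norm_iff)
  qed
  have "algebraic_int (x N)" for N
  proof -
    have "x N \<in> OU"
      unfolding x_def using W(2) by (intro OU_prod OU_powi) auto
    then show ?thesis
      by (simp add: OU_iff)
  qed
  then have "range x \<subseteq> {x. algebraic_int x \<and> (\<forall>g\<in>G. cmod (\<tau> (g x)) \<le> exp C)}"
    using bound by auto
  then have "finite (range x)"
    using finite_bounded_algebraic_ints[OF \<tau>] by (rule finite_subset)
  then have "\<not> inj x"
    using finite_imageD infinite_UNIV_nat by blast
  then obtain M N where MN: "x M = x N" "M \<noteq> N"
    by (auto simp: inj_def)
  have "(\<Prod>w\<in>W. w powi (\<lfloor>real M * l w\<rfloor> - \<lfloor>real N * l w\<rfloor>)) = x M / x N"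
    unfolding x_def prod_dividef[symmetric] using W(2) OU_nonzero
    by (intro prod.cong refl power_int_diff) auto
  also have "\<dots> = 1"
  proof -
    have "x N \<noteq> 0"
      unfolding x_def using W(2) by (intro OU_nonzero OU_prod OU_powi) auto
    then show ?thesis
      by (simp add: MN)
  qed
  finally have "\<forall>w\<in>W. \<lfloor>real M * l w\<rfloor> - \<lfloor>real N * l w\<rfloor> = 0"
    using W(3)[unfolded mult_indep_def, rule_format, of "\<lambda>w. \<lfloor>real M * l w\<rfloor> - \<lfloor>real N * l w\<rfloor>"] by blast
  then have "\<lfloor>real M * l u\<rfloor> = \<lfloor>real N * l u\<rfloor>"
    using u(1) by simp
  then show False
    using MN(2) u(2) by (simp add: l_def)
qed

end

text \<open>A function that is invariant under \<open>c\<close> and vanishes off \<open>J\<close> is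
  carried by the cosets inside \<open>J\<close>. Prescribing 0 at one representative of each of them
  except \<open>A\<^sub>0\<close> leaves the common value on \<open>A\<^sub>0\<close>, which the
  vanishing total sum kills. Truncated subtraction fits the case of no coset inside
  \<open>J\<close>, where \<open>K\<close> is empty.\<close>

lemma coset_representatives:
  assumes c: "c \<in> G"
  shows "\<exists>K\<subseteq>G. card K \<le> coset_count J c - 1 \<and>
    (\<forall>\<Lambda> :: ('m \<Rightarrow> 'm) \<Rightarrow> real. (\<forall>g\<in>G. \<Lambda> (c \<circ> g) = \<Lambda> g) \<longrightarrow> (\<Sum>g\<in>G. \<Lambda> g) = 0 \<longrightarrow>
       (\<forall>g\<in>(G - J) \<union> K. \<Lambda> g = 0) \<longrightarrow> (\<forall>g\<in>G. \<Lambda> g = 0))"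
proof -
  define A where "A = {A. \<exists>g\<in>G. A = {g, c \<circ> g} \<and> A \<subseteq> J}"
  have count: "coset_count J c = card A"
    by (simp add: coset_count_def A_def)
  have "A \<subseteq> (\<lambda>g. {g, c \<circ> g}) ` G"
    by (auto simp: A_def)
  then have finA: "finite A"
    using finite_G finite_surj by blast
  have "\<forall>S\<in>A. \<exists>g. g \<in> G \<and> S = {g, c \<circ> g}"
    by (auto simp: A_def)
  from bchoice[OF this] obtain rep where rep: "\<And>S. S \<in> A \<Longrightarrow> rep S \<in> G" "\<And>S. S \<in> A \<Longrightarrow> S = {rep S, c \<circ> rep S}"
    by blast
  show ?thesis
  proof (cases "A = {}")
    case True
    show ?thesis
    proof (intro exI[of _ "{}"] conjI allI impI)
      fix \<Lambda> :: "('m \<Rightarrow> 'm) \<Rightarrow> real"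
      assume "\<forall>g\<in>G. \<Lambda> (c \<circ> g) = \<Lambda> g" "\<forall>g\<in>(G - J) \<union> {}. \<Lambda> g = 0"
      then have inv: "\<And>g. g \<in> G \<Longrightarrow> \<Lambda> (c \<circ> g) = \<Lambda> g" and J: "\<And>g. g \<in> G - J \<Longrightarrow> \<Lambda> g = 0"
        by blast+
      show "\<forall>g\<in>G. \<Lambda> g = 0"
      proof
        fix g assume g: "g \<in> G"
        have "{g, c \<circ> g} \<notin> A"
          using True by simp
        then have "g \<notin> J \<or> c \<circ> g \<notin> J"
          using g by (auto simp: A_def)
        then show "\<Lambda> g = 0"
          using J[of g] J[of "c \<circ> g"] inv[OF g] g comp_in_G[OF c g] by auto
      qed
    qed auto
  next
    case False
    then obtain A\<^sub>0 where A0: "A\<^sub>0 \<in> A"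
      by blast
    show ?thesis
    proof (intro exI[of _ "rep ` (A - {A\<^sub>0})"] conjI allI impI)
      show "rep ` (A - {A\<^sub>0}) \<subseteq> G"
        using rep(1) by auto
      have "card (rep ` (A - {A\<^sub>0})) \<le> card (A - {A\<^sub>0})"
        using finA by (intro card_image_le) auto
      then show "card (rep ` (A - {A\<^sub>0})) \<le> coset_count J c - 1"
        using A0 finA by (simp add: count)
      fix \<Lambda> :: "('m \<Rightarrow> 'm) \<Rightarrow> real"
      assume sum: "(\<Sum>g\<in>G. \<Lambda> g) = 0"
        and "\<forall>g\<in>G. \<Lambda> (c \<circ> g) = \<Lambda> g" "\<forall>g\<in>(G - J) \<union> rep ` (A - {A\<^sub>0}). \<Lambda> g = 0"
      then have inv: "\<And>g. g \<in> G \<Longrightarrow> \<Lambda> (c \<circ> g) = \<Lambda> g"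
        and J: "\<And>g. g \<in> G - J \<Longrightarrow> \<Lambda> g = 0" and K: "\<And>g. g \<in> rep ` (A - {A\<^sub>0}) \<Longrightarrow> \<Lambda> g = 0"
        by blast+
      have on_coset: "\<Lambda> g = \<Lambda> (rep S)" if "S \<in> A" "g \<in> S" for g S
      proof -
        have "g = rep S \<or> g = c \<circ> rep S"
          using rep(2)[OF that(1)] that(2) by blast
        then show ?thesis
          using inv[OF rep(1)[OF that(1)]] by auto
      qed
      have other: "\<Lambda> g = 0" if g: "g \<in> G" "{g, c \<circ> g} \<noteq> A\<^sub>0" for g
      proof (cases "{g, c \<circ> g} \<in> A")
        case True
        then have "\<Lambda> (rep {g, c \<circ> g}) = 0"
          using g(2) by (intro K) auto
        then show ?thesis
          using on_coset[OF True, of g] by simp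
      next
        case False
        then have "g \<notin> J \<or> c \<circ> g \<notin> J"
          using g by (auto simp: A_def)
        then show ?thesis
          using J[of g] J[of "c \<circ> g"] inv[OF g(1)] g(1) comp_in_G[OF c g(1)] by auto
      qed
      define Z where "Z = {g \<in> G. {g, c \<circ> g} = A\<^sub>0}"
      have Z: "\<Lambda> g = \<Lambda> (rep A\<^sub>0)" if "g \<in> Z" for g
        using that by (intro on_coset[OF A0]) (auto simp: Z_def)
      have "(\<Sum>g\<in>G. \<Lambda> g) = (\<Sum>g\<in>Z. \<Lambda> g)"
        using finite_G other by (intro sum.mono_neutral_right) (auto simp: Z_def)
      also have "\<dots> = real (card Z) * \<Lambda> (rep A\<^sub>0)"
        using Z by simp
      finally have "real (card Z) * \<Lambda> (rep A\<^sub>0) = 0"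
        using sum by simp
      moreover have "rep A\<^sub>0 \<in> Z"
        using rep[OF A0] by (auto simp: Z_def)
      moreover have "finite Z"
        using finite_G by (simp add: Z_def)
      ultimately have "\<Lambda> (rep A\<^sub>0) = 0"
        by auto
      then show "\<forall>g\<in>G. \<Lambda> g = 0"
        using other Z by (auto simp: Z_def)
    qed
  qed
qed

end

context galois_padic
begin

section \<open>P-adic logarithms of units and the use of the conjecture\<close>

lemma nm_unit:
  assumes \<sigma>: "field_embedding (\<sigma> :: 'm \<Rightarrow> 'c)" and u: "u \<in> OU" shows "nm (\<sigma> u) = 1"
proof -
  interpret E: padic_embedding p T \<sigma> "card B"
    by (rule padic_embedding_if_embedding[OF \<sigma>])
  have "nm (\<sigma> u) \<le> 1" "nm (\<sigma> (inverse u)) \<le> 1"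
    using u by (auto intro!: E.av_le_1 simp: OU_iff)
  then show ?thesis
    using OU_nonzero[OF u] by (simp add: E.hom_inverse nm_inverse inverse_le_1_iff)
qed

lemma unit_additive_plog:
  assumes \<sigma>: "field_embedding (\<sigma> :: 'm \<Rightarrow> 'c)"
  shows "unit_additive (\<lambda>u. plog (\<sigma> u))"
proof -
  interpret \<sigma>: field_embedding \<sigma> by (rule \<sigma>)
  show ?thesis
    by (simp add: unit_additive_def \<sigma>.hom_mult plog_mult OU_nonzero)
qed

text \<open>On units the kernel of the p-adic logarithm is torsion; so a rational relation between
  logarithms becomes, once denominators are cleared, a multiplicative relation up to a root of
  unity.\<close>

lemma plogs_rat_lin_indep:
  fixes w :: "nat \<Rightarrow> 'm"
  assumes \<sigma>: "field_embedding (\<sigma> :: 'm \<Rightarrow> 'c)"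
    and V: "V \<subseteq> OU" "mult_indep V" and w: "bij_betw w {..<n} V"
  shows "rat_lin_indep n (\<lambda>i. plog (\<sigma> (w i)))"
  unfolding rat_lin_indep_def
proof (rule allI, rule impI)
  fix q :: "nat \<Rightarrow> rat"
  assume q: "(\<Sum>i<n. of_rat (q i) * plog (\<sigma> (w i))) = 0"
  interpret \<sigma>: field_embedding \<sigma> by (rule \<sigma>)
  have wV: "w i \<in> V" if "i < n" for i
    using w that by (auto simp: bij_betw_def)
  obtain N where N: "N > 0" "\<forall>i\<in>{..<n}. \<exists>a. rat_of_nat N * q i = of_int a"
    using ex_common_denominator[of "{..<n}" q] by blast
  from bchoice[OF N(2)] obtain a where a: "\<And>i. i < n \<Longrightarrow> rat_of_nat N * q i = of_int (a i)"
    by auto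
  have a': "of_int (a i) = of_nat N * (of_rat (q i) :: 'c)" if "i < n" for i
    using arg_cong[OF a[OF that], of "of_rat :: rat \<Rightarrow> 'c"] by (simp add: of_rat_mult)
  define u where "u = (\<Prod>i<n. w i powi a i)"
  have uOU: "u \<in> OU"
    unfolding u_def using wV V(1) by (intro OU_prod OU_powi) auto
  have "plog (\<sigma> u) = (\<Sum>i<n. of_int (a i) * plog (\<sigma> (w i)))"
    unfolding u_def using wV V(1)
    by (intro additive_prod_powi[OF unit_additive_plog[OF \<sigma>]]) auto
  also have "\<dots> = of_nat N * (\<Sum>i<n. of_rat (q i) * plog (\<sigma> (w i)))"
    unfolding sum_distrib_left by (intro sum.cong) (auto simp: a')
  finally have "plog (\<sigma> u) = 0"
    using q by simp
  then obtain m where m: "m > 0" "\<sigma> u ^ m = 1"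
    using plog_eq_0[OF nm_unit[OF \<sigma> uOU]] by blast
  then have "\<sigma> (u ^ m) = \<sigma> 1"
    by (simp add: \<sigma>.hom_power)
  then have um: "u ^ m = 1"
    by (simp only: \<sigma>.hom_eq)
  \<comment> \<open>Multiplying the exponents by \<open>m\<close> removes the root of unity and
    makes the relation exact; at the same time indices are translated into elements of
    \<open>V\<close>.\<close>
  define b where "b v = a (inv_into {..<n} w v) * int m" for v
  have inv: "inv_into {..<n} w (w i) = i" if "i < n" for i
    using w that by (simp add: bij_betw_def inv_into_f_f)
  have "(\<Prod>v\<in>V. v powi b v) = (\<Prod>i<n. w i powi b (w i))"
    using prod.reindex_bij_betw[OF w, of "\<lambda>v. v powi b v"] by simp
  also have "\<dots> = (\<Prod>i<n. (w i powi a i) ^ m)"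
    by (intro prod.cong) (auto simp: b_def inv power_int_power')
  also have "\<dots> = 1"
    using um by (simp add: u_def prod_power_distrib)
  finally have b0: "\<forall>v\<in>V. b v = 0"
    using V(2) unfolding mult_indep_def by blast
  show "\<forall>i<n. q i = 0"
  proof (intro allI impI)
    fix i assume i: "i < n"
    then have "a i = 0"
      using b0 wV[OF i] inv[OF i] m(1) by (auto simp: b_def)
    then show "q i = 0"
      using a[OF i] N(1) by simp
  qed
qed

lemma schanuel_alg_indep:
  fixes w :: "nat \<Rightarrow> 'm"
  assumes \<sigma>: "field_embedding (\<sigma> :: 'm \<Rightarrow> 'c)" and sch: "padic_schanuel p T"
    and V: "V \<subseteq> OU" "mult_indep V" and w: "bij_betw w {..<n} V"
  shows "rat_alg_indep n (\<lambda>i. plog (\<sigma> (w i)))"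
proof -
  interpret \<sigma>: field_embedding \<sigma> by (rule \<sigma>)
  have "\<sigma> (w i) \<noteq> 0 \<and> Polynomial.algebraic (\<sigma> (w i))" if "i < n" for i
  proof -
    have "w i \<in> OU"
      using w V(1) that by (auto simp: bij_betw_def)
    then show ?thesis
      by (simp add: OU_iff \<sigma>.hom_algebraic_int algebraic_int_imp_algebraic)
  qed
  then show ?thesis
    using sch[unfolded padic_schanuel_def, rule_format, of n "\<lambda>i. \<sigma> (w i)"]
      plogs_rat_lin_indep[OF \<sigma> V w] unfolding padic_log_eq by blast
qed

text \<open>The real matrix with rows \<open>G - J\<close>, completed by the rows \<open>K\<close>
  of \<open>coset_representatives\<close>, has independent columns by
  \<open>real_logs_independent\<close>. Each completing row costs at most one column when the p-adic
  matrix with rows \<open>G - J\<close> alone is considered.\<close>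

lemma independent_plog_columns:
  assumes \<sigma>: "field_embedding (\<sigma> :: 'm \<Rightarrow> 'c)" and sch: "padic_schanuel p T"
    and c: "c \<in> complex_conjugations" and W: "finite W" "W \<subseteq> OU" "mult_indep W"
  obtains S where "S \<subseteq> W" "card W \<le> card S + (coset_count J c - 1)"
    "\<forall>z :: 'm \<Rightarrow> 'c. (\<forall>h\<in>G - J. (\<Sum>v\<in>S. plog (\<sigma> (h v)) * z v) = 0) \<longrightarrow> (\<forall>v\<in>S. z v = 0)"
proof -
  obtain \<tau> :: "'m \<Rightarrow> complex" where \<tau>: "field_embedding \<tau>" "cnj \<circ> \<tau> = \<tau> \<circ> c" and cG: "c \<in> G"
    using c complex_conjugations_iff by blast
  interpret \<tau>: field_embedding \<tau> by (rule \<tau>(1))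
  let ?Lr = "Lr \<tau>"
  \<comment> \<open>All conjugates occur in matrix entries and may be multiplicatively dependent; a
    maximal independent subset \<open>V\<close> of them provides the variables for the
    conjecture.\<close>
  define Us where "Us = (\<lambda>(h, v). h v) ` (G \<times> W)"
  have Us: "finite Us" "Us \<subseteq> OU"
    using finite_G W OU_galois by (auto simp: Us_def)
  have "finite {V. V \<subseteq> Us \<and> mult_indep V}" "{} \<in> {V. V \<subseteq> Us \<and> mult_indep V}"
    using Us(1) by (auto simp: mult_indep_def)
  then have "\<exists>V\<in>{V. V \<subseteq> Us \<and> mult_indep V}. \<forall>V'\<in>{V. V \<subseteq> Us \<and> mult_indep V}. V \<subseteq> V' \<longrightarrow> V = V'"
    by (intro finite_has_maximal) auto
  then obtain V where V: "V \<subseteq> Us" "mult_indep V"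
    and max: "\<And>V'. V' \<subseteq> Us \<Longrightarrow> mult_indep V' \<Longrightarrow> V \<subseteq> V' \<Longrightarrow> V = V'"
    by auto
  have finV: "finite V" and VOU: "V \<subseteq> OU"
    using V(1) Us finite_subset by auto
  define n where "n = card V"
  obtain w where "bij_betw w {0..<card V} V"
    using ex_bij_betw_nat_finite[OF finV] by blast
  then have w: "bij_betw w {..<n} V"
    by (simp add: n_def lessThan_atLeast0)
  define x where "x i = plog (\<sigma> (w i))" for i
  define y where "y i = ?Lr (w i)" for i
  have pairs: "(plog (\<sigma> u), ?Lr u) \<in> eval_pairs n x y" if u: "u \<in> Us" for u
  proof -
    have "\<not> mult_indep (insert u V) \<or> u \<in> V"
      using max[of "insert u V"] V(1) u by blast
    then obtain q where
      q: "\<forall>F :: 'm \<Rightarrow> real. unit_additive F \<longrightarrow> F u = (\<Sum>w\<in>V. of_rat (q w) * F w)"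
        "\<forall>F :: 'm \<Rightarrow> 'c. unit_additive F \<longrightarrow> F u = (\<Sum>w\<in>V. of_rat (q w) * F w)"
      using mult_indep_extend[where ?'k = 'c, OF finV VOU V(2), of u] u Us(2) by blast
    have "?Lr u = (\<Sum>w\<in>V. of_rat (q w) * ?Lr w)"
      using q(1) unit_additive_Lr[OF \<tau>(1)] by blast
    also have "\<dots> = (\<Sum>i<n. of_rat (q (w i)) * y i)"
      using sum.reindex_bij_betw[OF w, of "\<lambda>v. of_rat (q v) * ?Lr v"] by (simp add: y_def)
    finally have 1: "?Lr u = (\<Sum>i<n. of_rat (q (w i)) * y i)" .
    have "plog (\<sigma> u) = (\<Sum>w\<in>V. of_rat (q w) * plog (\<sigma> w))"
      using spec[OF q(2), of "\<lambda>u. plog (\<sigma> u)"] unit_additive_plog[OF \<sigma>] by simp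
    also have "\<dots> = (\<Sum>i<n. of_rat (q (w i)) * x i)"
      using sum.reindex_bij_betw[OF w, of "\<lambda>v. of_rat (q v) * plog (\<sigma> v)"] by (simp add: x_def)
    finally have 2: "plog (\<sigma> u) = (\<Sum>i<n. of_rat (q (w i)) * x i)" .
    show ?thesis
      unfolding 1 2 by (rule eval_pairs_rational_combination)
  qed
  have alg: "rat_alg_indep n x"
    unfolding x_def using schanuel_alg_indep[OF \<sigma> sch VOU V(2) w] .
  obtain K where K: "K \<subseteq> G" "card K \<le> coset_count J c - 1"
    "\<forall>\<Lambda> :: ('m \<Rightarrow> 'm) \<Rightarrow> real. (\<forall>g\<in>G. \<Lambda> (c \<circ> g) = \<Lambda> g) \<longrightarrow> (\<Sum>g\<in>G. \<Lambda> g) = 0 \<longrightarrow>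
       (\<forall>g\<in>(G - J) \<union> K. \<Lambda> g = 0) \<longrightarrow> (\<forall>g\<in>G. \<Lambda> g = 0)"
    using coset_representatives[OF cG, of J] by blast
  have "\<exists>S\<subseteq>W. card W \<le> card S + card K \<and>
     (\<forall>z. (\<forall>i\<in>G - J. (\<Sum>j\<in>S. plog (\<sigma> (i j)) * z j) = 0) \<longrightarrow> (\<forall>j\<in>S. z j = 0))"
  proof (rule independent_columns_if_specialised[where b = "\<lambda>h v. ?Lr (h v)" and e = "\<lambda>h v. ?Lr (h v)"
        and Sp = "eval_pairs n x y"])
    show "finite W" by (rule W(1))
    show "finite K"
      using K(1) finite_G finite_subset by blast
    show "(plog (\<sigma> (h v)), ?Lr (h v)) \<in> eval_pairs n x y" if "h \<in> G - J" "v \<in> W" for h v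
      using that by (intro pairs) (auto simp: Us_def)
    fix z :: "'m \<Rightarrow> real"
    assume z: "\<And>h. h \<in> G - J \<Longrightarrow> (\<Sum>v\<in>W. ?Lr (h v) * z v) = 0" "\<And>h. h \<in> K \<Longrightarrow> (\<Sum>v\<in>W. ?Lr (h v) * z v) = 0"
    define \<Lambda> where "\<Lambda> g = (\<Sum>v\<in>W. ?Lr (g v) * z v)" for g
    have "\<forall>g\<in>G. \<Lambda> g = 0"
    proof (rule K(3)[THEN spec, THEN mp, THEN mp, THEN mp])
      have "cmod (\<tau> (c u)) = cmod (\<tau> u)" for u
        using arg_cong[OF fun_cong[OF \<tau>(2), of u], of cmod] by simp
      then show "\<forall>g\<in>G. \<Lambda> (c \<circ> g) = \<Lambda> g"
        by (simp add: \<Lambda>_def Lr_def[OF \<tau>(1)])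
      show "\<forall>g\<in>(G - J) \<union> K. \<Lambda> g = 0"
        using z unfolding \<Lambda>_def by blast
      have "(\<Sum>g\<in>G. \<Sum>v\<in>W. ?Lr (g v) * z v) = (\<Sum>v\<in>W. (\<Sum>g\<in>G. ?Lr (g v)) * z v)"
        unfolding sum_distrib_right by (rule sum.swap)
      also have "\<dots> = 0"
        using sum_Lr[OF \<tau>(1)] W(2) by (intro sum.neutral) auto
      finally show "(\<Sum>g\<in>G. \<Lambda> g) = 0"
        unfolding \<Lambda>_def .
    qed
    then show "\<forall>v\<in>W. z v = 0"
      unfolding \<Lambda>_def by (intro real_logs_independent[OF \<tau>(1) W]) blast
  next
    show "t = 0" if "(0, t) \<in> eval_pairs n x y" for t
      using eval_pairs_zero[OF alg that] .
  qed (rule eval_pairs_mult eval_pairs_diff; assumption)+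
  then obtain S where "S \<subseteq> W" "card W \<le> card S + card K"
    "\<forall>z. (\<forall>i\<in>G - J. (\<Sum>j\<in>S. plog (\<sigma> (i j)) * z j) = 0) \<longrightarrow> (\<forall>j\<in>S. z j = 0)"
    by blast
  then show ?thesis
    using that[of S] K(2) by auto
qed

end

section \<open>The closure of the diagonally embedded units\<close>

text \<open>\<open>E\<close> selects for each prime in \<Gamma> an embedding inducing it, which
  gives coordinates in C_p on that local field. It is chosen without regard to the embeddings
  \<sigma> \<circ> h of the logarithm matrix; \<open>same_ideal_tendsto_1\<close> connects the
  two.\<close>

locale diagonal_closure = galois_padic p T U
  for p :: nat and T :: "'c::{field_char_0, complete_space} itself" and U :: "'m::field_char_0 itself" +
  fixes \<Gamma> :: "'m set set" and E :: "'m set \<Rightarrow> 'm \<Rightarrow> 'c"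
  assumes finite_\<Gamma>: "finite \<Gamma>"
    and embedding_E: "P \<in> \<Gamma> \<Longrightarrow> field_embedding (E P)"
    and val_ideal_E: "P \<in> \<Gamma> \<Longrightarrow> val_ideal (E P) = P"
begin

lemma padic_embedding_E: "P \<in> \<Gamma> \<Longrightarrow> padic_embedding p T (E P) (card B)"
  by (intro padic_embedding_if_embedding embedding_E)

definition KE :: "('m set \<Rightarrow> 'c) set" where
  "KE = {l. \<forall>P\<in>\<Gamma>. l P \<in> closure (range (E P)) \<and> nm (l P - 1) < 1}"

text \<open>Coordinates on the product of the groups of principal units. A family is a function on
  all sets of elements, but only its values on \<Gamma> count.\<close>

definition class_family :: "('m set \<Rightarrow> 'c) \<Rightarrow> 'm set \<Rightarrow> (nat \<Rightarrow> 'm) set" where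
  "class_family l = (\<lambda>P\<in>\<Gamma>. cls (E P) (l P))"

lemma class_family_eq_iff:
  assumes "l \<in> KE" shows "class_family l = class_family m \<longleftrightarrow> (\<forall>P\<in>\<Gamma>. l P = m P)"
proof
  assume eq: "class_family l = class_family m"
  show "\<forall>P\<in>\<Gamma>. l P = m P"
  proof
    fix P assume P: "P \<in> \<Gamma>"
    interpret e: padic_embedding p T "E P" "card B"
      by (rule padic_embedding_E[OF P])
    have "cls (E P) (l P) = cls (E P) (m P)"
      using fun_cong[OF eq, of P] P by (simp add: class_family_def)
    then show "l P = m P"
      using e.cls_eq_iff[of "l P" "m P"] assms P by (simp add: KE_def)
  qed
next
  assume "\<forall>P\<in>\<Gamma>. l P = m P"
  then show "class_family l = class_family m"
    unfolding class_family_def by (intro restrict_ext) simp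
qed

lemma principal_units_eq_E:
  "P \<in> \<Gamma> \<Longrightarrow> principal_units P = cls (E P) ` {l \<in> closure (range (E P)). nm (l - 1) < 1}"
  using padic_embedding.principal_units_eq[OF padic_embedding_E] val_ideal_E by simp

lemma Pi_principal_units: "Pi\<^sub>E \<Gamma> principal_units = class_family ` KE"
proof (intro equalityI subsetI)
  fix x assume x: "x \<in> Pi\<^sub>E \<Gamma> principal_units"
  have "\<forall>P\<in>\<Gamma>. \<exists>l. l \<in> closure (range (E P)) \<and> nm (l - 1) < 1 \<and> x P = cls (E P) l"
  proof
    fix P assume P: "P \<in> \<Gamma>"
    have "x P \<in> principal_units P"
      using x P by blast
    then show "\<exists>l. l \<in> closure (range (E P)) \<and> nm (l - 1) < 1 \<and> x P = cls (E P) l"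
      unfolding principal_units_eq_E[OF P] by blast
  qed
  from bchoice[OF this] obtain l where
    l: "\<forall>P\<in>\<Gamma>. l P \<in> closure (range (E P)) \<and> nm (l P - 1) < 1 \<and> x P = cls (E P) (l P)" ..
  have "x = class_family l"
  proof
    fix P show "x P = class_family l P"
      using l PiE_arb[OF x, of P] by (cases "P \<in> \<Gamma>") (auto simp: class_family_def)
  qed
  moreover have "l \<in> KE"
    using l by (simp add: KE_def)
  ultimately show "x \<in> class_family ` KE"
    by blast
next
  fix x assume "x \<in> class_family ` KE"
  then obtain l where l: "l \<in> KE" "x = class_family l" ..
  show "x \<in> Pi\<^sub>E \<Gamma> principal_units"
  proof (rule PiE_I)
    fix P assume P: "P \<in> \<Gamma>"
    show "x P \<in> principal_units P"
      using l P unfolding principal_units_eq_E[OF P] by (simp add: class_family_def KE_def)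
  qed (simp add: l class_family_def)
qed

lemma diag_embed_eq: "diag_embed \<Gamma> u = class_family (\<lambda>P. E P u)"
  unfolding diag_embed_def class_family_def
proof (rule restrict_ext)
  fix P assume "P \<in> \<Gamma>"
  then show "local_embed P u = cls (E P) (E P u)"
    using padic_embedding.local_embed_eq[OF padic_embedding_E] val_ideal_E by simp
qed

abbreviation Y :: "'m set" where
  "Y \<equiv> principal_global_units \<Gamma>"

lemma in_range_E: "E P u \<in> closure (range (E P))"
  by (rule subsetD[OF closure_subset rangeI])

lemma Y_iff: "u \<in> Y \<longleftrightarrow> u \<in> OU \<and> (\<forall>P\<in>\<Gamma>. nm (E P u - 1) < 1)"
proof -
  have "diag_embed \<Gamma> u \<in> Pi\<^sub>E \<Gamma> principal_units \<longleftrightarrow> (\<forall>P\<in>\<Gamma>. nm (E P u - 1) < 1)"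
  proof
    assume "diag_embed \<Gamma> u \<in> Pi\<^sub>E \<Gamma> principal_units"
    then obtain l where l: "l \<in> KE" "class_family l = class_family (\<lambda>P. E P u)"
      unfolding Pi_principal_units diag_embed_eq by auto
    have "\<forall>P\<in>\<Gamma>. l P = E P u"
      using l(2) by (simp only: class_family_eq_iff[OF l(1)])
    then show "\<forall>P\<in>\<Gamma>. nm (E P u - 1) < 1"
      using l(1) by (auto simp: KE_def)
  next
    assume "\<forall>P\<in>\<Gamma>. nm (E P u - 1) < 1"
    then have "(\<lambda>P. E P u) \<in> KE"
      using in_range_E by (simp add: KE_def)
    then show "diag_embed \<Gamma> u \<in> Pi\<^sub>E \<Gamma> principal_units"
      unfolding Pi_principal_units diag_embed_eq by (rule imageI)
  qed
  then show ?thesis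
    by (simp add: principal_global_units_def)
qed

lemma Y_KE: "u \<in> Y \<Longrightarrow> (\<lambda>P. E P u) \<in> KE"
  using in_range_E by (simp add: KE_def Y_iff)

lemma Y_mult: assumes "u \<in> Y" "v \<in> Y" shows "u * v \<in> Y"
proof -
  have "nm (E P (u * v) - 1) < 1" if P: "P \<in> \<Gamma>" for P
  proof -
    interpret e: field_embedding "E P" by (rule embedding_E[OF P])
    show ?thesis
      using assms P by (simp add: e.hom_mult nm_mult_close Y_iff)
  qed
  then show ?thesis
    using assms by (simp add: Y_iff OU_mult)
qed

lemma Y_1: "1 \<in> Y"
proof -
  have "nm (E P 1 - 1) < 1" if P: "P \<in> \<Gamma>" for P
  proof -
    interpret e: field_embedding "E P" by (rule embedding_E[OF P])
    show ?thesis
      by simp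
  qed
  then show ?thesis
    by (simp add: Y_iff OU_1)
qed

lemma Y_power: "u \<in> Y \<Longrightarrow> u ^ n \<in> Y"
  by (induction n) (simp_all add: Y_1 Y_mult)

lemma Metric_space_principal_units: "P \<in> \<Gamma> \<Longrightarrow> Metric_space (principal_units P) (local_dist P)"
proof -
  assume P: "P \<in> \<Gamma>"
  interpret e: padic_embedding p T "E P" "card B"
    by (rule padic_embedding_E[OF P])
  have "principal_units P \<subseteq> carrier (local_field (val_ideal (E P)))"
    unfolding e.carrier_local_field principal_units_eq_E[OF P] by (rule image_mono) auto
  then show ?thesis
    using e.Metric_space_local[of "principal_units P"] unfolding val_ideal_E[OF P] by simp
qed

lemma local_dist_tendsto_0_iff_E:
  assumes P: "P \<in> \<Gamma>" and "l \<in> closure (range (E P))"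
  shows "(\<lambda>k. local_dist P (cls (E P) (E P (u k))) (cls (E P) l)) \<longlonglongrightarrow> 0 \<longleftrightarrow> (\<lambda>k. E P (u k)) \<longlonglongrightarrow> l"
  using padic_embedding.local_dist_tendsto_0_iff[OF padic_embedding_E[OF P], of "\<lambda>k. E P (u k)" l,
      OF in_range_E assms(2)] unfolding val_ideal_E[OF P] .

text \<open>A finite product of metric spaces is sequential in the required sense: points of the
  closure are limits of sequences, and convergence is tested in each coordinate.\<close>

lemma class_family_in_diag_closure_iff:
  assumes l: "l \<in> KE"
  shows "class_family l \<in> diag_closure \<Gamma> \<longleftrightarrow> (\<exists>u. (\<forall>k. u k \<in> Y) \<and> (\<forall>P\<in>\<Gamma>. (\<lambda>k. E P (u k)) \<longlonglongrightarrow> l P))"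
proof -
  define top where "top = (\<lambda>P :: 'm set. Metric_space.mtopology (principal_units P) (local_dist P))"
  have topspace: "topspace (product_topology top \<Gamma>) = Pi\<^sub>E \<Gamma> principal_units"
    unfolding topspace_product_topology
    by (rule PiE_cong) (simp add: top_def Metric_space.topspace_mtopology Metric_space_principal_units)
  have family_l: "class_family l \<in> Pi\<^sub>E \<Gamma> principal_units"
    unfolding Pi_principal_units using l by (rule imageI)
  have closure: "diag_closure \<Gamma> = product_topology top \<Gamma> closure_of (diag_embed \<Gamma> ` Y)"
    unfolding diag_closure_def top_def by (rule refl)
  have dist: "(\<lambda>k. local_dist P (class_family (\<lambda>P. E P (u k)) P) (class_family l P)) \<longlonglongrightarrow> 0 \<longleftrightarrow> (\<lambda>k. E P (u k)) \<longlonglongrightarrow> l P"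
    if P: "P \<in> \<Gamma>" for P u
    using local_dist_tendsto_0_iff_E[OF P, of "l P" u] l P by (simp add: class_family_def KE_def)
  show ?thesis
  proof
    assume clos: "class_family l \<in> diag_closure \<Gamma>"
    have "\<exists>u. u \<in> Y \<and> (\<forall>P\<in>\<Gamma>. local_dist P (class_family (\<lambda>P. E P u) P) (class_family l P) < 1 / real (Suc k))" for k
    proof -
      \<comment> \<open>Finiteness of \<Gamma> makes the product of these balls open in the product
        topology; the radii 1 / (k + 1) yield a sequence.\<close>
      define ball where "ball P = Metric_space.mball (principal_units P) (local_dist P) (class_family l P) (1 / real (Suc k))" for P
      have "openin (top P) (ball P)" if "P \<in> \<Gamma>" for P
        unfolding top_def ball_def
        by (rule Metric_space.openin_mball[OF Metric_space_principal_units[OF that]])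
      then have "openin (product_topology top \<Gamma>) (Pi\<^sub>E \<Gamma> ball)"
        using finite_\<Gamma> by (simp add: openin_PiE)
      moreover have "class_family l \<in> Pi\<^sub>E \<Gamma> ball"
      proof (rule PiE_I)
        fix P assume P: "P \<in> \<Gamma>"
        show "class_family l P \<in> ball P"
          using family_l P unfolding ball_def
          by (subst Metric_space.centre_in_mball_iff[OF Metric_space_principal_units[OF P]]) auto
      qed (use family_l in auto)
      ultimately obtain u where u: "u \<in> Y" "diag_embed \<Gamma> u \<in> Pi\<^sub>E \<Gamma> ball"
        using clos unfolding closure in_closure_of by blast
      have "local_dist P (class_family (\<lambda>P. E P u) P) (class_family l P) < 1 / real (Suc k)" if P: "P \<in> \<Gamma>" for P
      proof -
        interpret M: Metric_space "principal_units P" "local_dist P"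
          by (rule Metric_space_principal_units[OF P])
        have "diag_embed \<Gamma> u P \<in> ball P"
          using u(2) P by blast
        then show ?thesis
          unfolding diag_embed_eq ball_def by (simp add: M.commute)
      qed
      with u(1) show ?thesis
        by blast
    qed
    then have "\<forall>k. \<exists>u. u \<in> Y \<and> (\<forall>P\<in>\<Gamma>. local_dist P (class_family (\<lambda>P. E P u) P) (class_family l P) < 1 / real (Suc k))"
      by blast
    from choice[OF this] obtain u where u: "\<forall>k. u k \<in> Y \<and> (\<forall>P\<in>\<Gamma>. local_dist P (class_family (\<lambda>P. E P (u k)) P) (class_family l P) < 1 / real (Suc k))" ..
    have "(\<lambda>k. E P (u k)) \<longlonglongrightarrow> l P" if P: "P \<in> \<Gamma>" for P
    proof -
      interpret M: Metric_space "principal_units P" "local_dist P"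
        by (rule Metric_space_principal_units[OF P])
      have "(\<lambda>k. local_dist P (class_family (\<lambda>P. E P (u k)) P) (class_family l P)) \<longlonglongrightarrow> 0"
      proof (rule real_tendsto_sandwich)
        show "(\<lambda>_. 0 :: real) \<longlonglongrightarrow> 0"
          by (rule tendsto_const)
        show "(\<lambda>k. 1 / real (Suc k)) \<longlonglongrightarrow> 0"
          by (rule LIMSEQ_Suc[OF lim_1_over_n])
        show "\<forall>\<^sub>F k in sequentially. 0 \<le> local_dist P (class_family (\<lambda>P. E P (u k)) P) (class_family l P)"
          by simp
        show "\<forall>\<^sub>F k in sequentially. local_dist P (class_family (\<lambda>P. E P (u k)) P) (class_family l P) \<le> 1 / real (Suc k)"
          using u P by (intro always_eventually allI less_imp_le) blast
      qed
      then show ?thesis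
        unfolding dist[OF P] .
    qed
    with u show "\<exists>u. (\<forall>k. u k \<in> Y) \<and> (\<forall>P\<in>\<Gamma>. (\<lambda>k. E P (u k)) \<longlonglongrightarrow> l P)"
      by blast
  next
    assume "\<exists>u. (\<forall>k. u k \<in> Y) \<and> (\<forall>P\<in>\<Gamma>. (\<lambda>k. E P (u k)) \<longlonglongrightarrow> l P)"
    then obtain u where u: "\<And>k. u k \<in> Y" "\<And>P. P \<in> \<Gamma> \<Longrightarrow> (\<lambda>k. E P (u k)) \<longlonglongrightarrow> l P"
      by blast
    have mem: "class_family (\<lambda>P. E P (u k)) \<in> Pi\<^sub>E \<Gamma> principal_units" for k
      unfolding Pi_principal_units using Y_KE[OF u(1)] by (rule imageI)
    have "limitin (product_topology top \<Gamma>) (\<lambda>k. class_family (\<lambda>P. E P (u k))) (class_family l) sequentially"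
      unfolding limitin_componentwise topspace
    proof (intro conjI ballI)
      show "class_family l \<in> extensional \<Gamma>"
        by (simp add: class_family_def)
      show "\<forall>\<^sub>F k in sequentially. class_family (\<lambda>P. E P (u k)) \<in> Pi\<^sub>E \<Gamma> principal_units"
        by (intro always_eventually allI mem)
      fix P assume P: "P \<in> \<Gamma>"
      interpret M: Metric_space "principal_units P" "local_dist P"
        by (rule Metric_space_principal_units[OF P])
      show "limitin (top P) (\<lambda>k. class_family (\<lambda>P. E P (u k)) P) (class_family l P) sequentially"
        unfolding top_def M.limitin_metric_dist_null
      proof (intro conjI)
        show "class_family l P \<in> principal_units P"
          using family_l P by blast
        show "\<forall>\<^sub>F k in sequentially. class_family (\<lambda>P. E P (u k)) P \<in> principal_units P"
          using mem P by (intro always_eventually allI) blast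
        show "(\<lambda>k. local_dist P (class_family (\<lambda>P. E P (u k)) P) (class_family l P)) \<longlonglongrightarrow> 0"
          unfolding dist[OF P] by (rule u(2)[OF P])
      qed
    qed
    then have ev: "\<forall>\<^sub>F k in sequentially. class_family (\<lambda>P. E P (u k)) \<in> V"
      if "class_family l \<in> V" "openin (product_topology top \<Gamma>) V" for V
      using that unfolding limitin_def by blast
    show "class_family l \<in> diag_closure \<Gamma>"
      unfolding closure in_closure_of
    proof (intro conjI allI impI)
      show "class_family l \<in> topspace (product_topology top \<Gamma>)"
        unfolding topspace by (rule family_l)
      fix V assume "class_family l \<in> V \<and> openin (product_topology top \<Gamma>) V"
      then have "\<forall>\<^sub>F k in sequentially. class_family (\<lambda>P. E P (u k)) \<in> V"
        using ev by blast
      then obtain k where "class_family (\<lambda>P. E P (u k)) \<in> V"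
        using eventually_happens'[OF sequentially_bot] by blast
      then show "\<exists>y. y \<in> diag_embed \<Gamma> ` Y \<and> y \<in> V"
        using imageI[OF u(1), of "diag_embed \<Gamma>" k] unfolding diag_embed_eq by blast
    qed
  qed
qed

lemma diag_closure_subset: "diag_closure \<Gamma> \<subseteq> class_family ` KE"
proof -
  have "diag_closure \<Gamma> \<subseteq> topspace (product_topology (\<lambda>P. Metric_space.mtopology (principal_units P) (local_dist P)) \<Gamma>)"
    unfolding diag_closure_def by (rule closure_of_subset_topspace)
  also have "\<dots> = Pi\<^sub>E \<Gamma> principal_units"
    unfolding topspace_product_topology
    by (rule PiE_cong) (simp add: Metric_space.topspace_mtopology Metric_space_principal_units)
  finally show ?thesis
    by (simp add: Pi_principal_units)
qed

end

context diagonal_closure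
begin

section \<open>The closure as a module over the p-adic integers\<close>

abbreviation Mo :: "((nat \<Rightarrow> rat) set, 'm set \<Rightarrow> (nat \<Rightarrow> 'm) set) module" where
  "Mo \<equiv> diag_closure_module p \<Gamma>"

lemma Mo_simps:
  "carrier Mo = diag_closure \<Gamma>" "\<zero>\<^bsub>Mo\<^esub> = (\<lambda>P\<in>\<Gamma>. \<one>\<^bsub>local_field P\<^esub>)"
  "x \<oplus>\<^bsub>Mo\<^esub> y = (\<lambda>P\<in>\<Gamma>. x P \<otimes>\<^bsub>local_field P\<^esub> y P)" "z \<odot>\<^bsub>Mo\<^esub> x = (\<lambda>P\<in>\<Gamma>. padic_power p P (x P) z)"
  by (simp_all add: diag_closure_module_def)

lemma KE_mult: assumes "l \<in> KE" "m \<in> KE" shows "(\<lambda>P. l P * m P) \<in> KE"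
proof -
  have "l P * m P \<in> closure (range (E P)) \<and> nm (l P * m P - 1) < 1" if P: "P \<in> \<Gamma>" for P
  proof -
    interpret e: padic_embedding p T "E P" "card B"
      by (rule padic_embedding_E[OF P])
    show ?thesis
      using assms P by (simp add: KE_def e.K_mult nm_mult_close)
  qed
  then show ?thesis
    by (simp add: KE_def)
qed

lemma KE_1: "(\<lambda>_. 1) \<in> KE"
proof -
  have "1 \<in> closure (range (E P))" if P: "P \<in> \<Gamma>" for P
  proof -
    interpret e: padic_embedding p T "E P" "card B"
      by (rule padic_embedding_E[OF P])
    show ?thesis
      by (rule e.K_1)
  qed
  then show ?thesis
    by (simp add: KE_def)
qed

lemma Mo_zero: "\<zero>\<^bsub>Mo\<^esub> = class_family (\<lambda>_. 1)"
  unfolding Mo_simps class_family_def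
proof (rule restrict_ext)
  fix P assume P: "P \<in> \<Gamma>"
  interpret e: padic_embedding p T "E P" "card B"
    by (rule padic_embedding_E[OF P])
  show "\<one>\<^bsub>local_field P\<^esub> = cls (E P) 1"
    using e.local_field_simps(1) unfolding val_ideal_E[OF P] .
qed

lemma Mo_add:
  assumes "l \<in> KE" "m \<in> KE"
  shows "class_family l \<oplus>\<^bsub>Mo\<^esub> class_family m = class_family (\<lambda>P. l P * m P)"
proof -
  have "(\<lambda>P\<in>\<Gamma>. class_family l P \<otimes>\<^bsub>local_field P\<^esub> class_family m P) = (\<lambda>P\<in>\<Gamma>. cls (E P) (l P * m P))"
  proof (rule restrict_ext)
    fix P assume P: "P \<in> \<Gamma>"
    interpret e: padic_embedding p T "E P" "card B"
      by (rule padic_embedding_E[OF P])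
    have "cls (E P) (l P) \<otimes>\<^bsub>local_field P\<^esub> cls (E P) (m P) = cls (E P) (l P * m P)"
      using e.local_field_mult[of "l P" "m P"] assms P unfolding val_ideal_E[OF P] by (simp add: KE_def)
    then show "class_family l P \<otimes>\<^bsub>local_field P\<^esub> class_family m P = cls (E P) (l P * m P)"
      using P by (simp add: class_family_def)
  qed
  then show ?thesis
    unfolding Mo_simps class_family_def[of "\<lambda>P. l P * m P"] .
qed

lemma diag_closureE:
  assumes "x \<in> diag_closure \<Gamma>"
  obtains l u where "x = class_family l" "l \<in> KE" "\<forall>k. u k \<in> Y" "\<forall>P\<in>\<Gamma>. (\<lambda>k. E P (u k)) \<longlonglongrightarrow> l P"
proof -
  obtain l where l: "l \<in> KE" "x = class_family l"
    using assms diag_closure_subset by blast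
  then obtain u where "\<forall>k. u k \<in> Y" "\<forall>P\<in>\<Gamma>. (\<lambda>k. E P (u k)) \<longlonglongrightarrow> l P"
    using assms class_family_in_diag_closure_iff[OF l(1)] by blast
  then show ?thesis
    by (rule that[OF l(2,1)])
qed

lemma diag_closure_mult:
  assumes x: "x \<in> diag_closure \<Gamma>" and y: "y \<in> diag_closure \<Gamma>"
  shows "x \<oplus>\<^bsub>Mo\<^esub> y \<in> diag_closure \<Gamma>"
proof -
  obtain l u where l: "x = class_family l" "l \<in> KE" "\<forall>k. u k \<in> Y" "\<forall>P\<in>\<Gamma>. (\<lambda>k. E P (u k)) \<longlonglongrightarrow> l P"
    by (rule diag_closureE[OF x])
  obtain m v where m: "y = class_family m" "m \<in> KE" "\<forall>k. v k \<in> Y" "\<forall>P\<in>\<Gamma>. (\<lambda>k. E P (v k)) \<longlonglongrightarrow> m P"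
    by (rule diag_closureE[OF y])
  have lim: "(\<lambda>k. E P (u k * v k)) \<longlonglongrightarrow> l P * m P" if P: "P \<in> \<Gamma>" for P
  proof -
    interpret e: field_embedding "E P" by (rule embedding_E[OF P])
    show ?thesis
      unfolding e.hom_mult by (rule tendsto_mult_nm) (use l(4) m(4) P in auto)
  qed
  have "\<exists>w. (\<forall>k. w k \<in> Y) \<and> (\<forall>P\<in>\<Gamma>. (\<lambda>k. E P (w k)) \<longlonglongrightarrow> l P * m P)"
    by (rule exI[of _ "\<lambda>k. u k * v k"]) (use l(3) m(3) lim Y_mult in simp)
  then show ?thesis
    unfolding l(1) m(1) Mo_add[OF l(2) m(2)] class_family_in_diag_closure_iff[OF KE_mult[OF l(2) m(2)]] .
qed

lemma diag_closure_1: "\<zero>\<^bsub>Mo\<^esub> \<in> diag_closure \<Gamma>"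
proof -
  have lim: "(\<lambda>k. E P 1) \<longlonglongrightarrow> 1" if P: "P \<in> \<Gamma>" for P
  proof -
    interpret e: field_embedding "E P" by (rule embedding_E[OF P])
    show ?thesis by simp
  qed
  have "\<exists>w :: nat \<Rightarrow> 'm. (\<forall>k. w k \<in> Y) \<and> (\<forall>P\<in>\<Gamma>. (\<lambda>k. E P (w k)) \<longlonglongrightarrow> 1)"
    by (rule exI[of _ "\<lambda>_. 1"]) (use lim Y_1 in simp)
  then show ?thesis
    unfolding Mo_zero class_family_in_diag_closure_iff[OF KE_1] .
qed

text \<open>Provides the calculus of the finite sums in which \<open>indep_subset\<close> is
  expressed.\<close>

lemma abelian_monoid_Mo: "abelian_monoid Mo"
proof (rule abelian_monoidI)
  fix x y assume "x \<in> carrier Mo" "y \<in> carrier Mo"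
  then show "x \<oplus>\<^bsub>Mo\<^esub> y \<in> carrier Mo"
    unfolding Mo_simps(1) by (rule diag_closure_mult)
next
  show "\<zero>\<^bsub>Mo\<^esub> \<in> carrier Mo"
    unfolding Mo_simps(1) by (rule diag_closure_1)
next
  fix x y z assume "x \<in> carrier Mo" "y \<in> carrier Mo" "z \<in> carrier Mo"
  then obtain l m n where l: "x = class_family l" "l \<in> KE" and m: "y = class_family m" "m \<in> KE"
    and n: "z = class_family n" "n \<in> KE"
    unfolding Mo_simps(1) using diag_closure_subset by blast
  show "x \<oplus>\<^bsub>Mo\<^esub> y \<oplus>\<^bsub>Mo\<^esub> z = x \<oplus>\<^bsub>Mo\<^esub> (y \<oplus>\<^bsub>Mo\<^esub> z)"
    unfolding l(1) m(1) n(1) using l(2) m(2) n(2) by (simp only: Mo_add KE_mult mult.assoc)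
next
  fix x assume "x \<in> carrier Mo"
  then obtain l where l: "x = class_family l" "l \<in> KE"
    unfolding Mo_simps(1) using diag_closure_subset by blast
  show "\<zero>\<^bsub>Mo\<^esub> \<oplus>\<^bsub>Mo\<^esub> x = x"
    unfolding Mo_zero l(1) Mo_add[OF KE_1 l(2)] by simp
next
  fix x y assume "x \<in> carrier Mo" "y \<in> carrier Mo"
  then obtain l m where l: "x = class_family l" "l \<in> KE" and m: "y = class_family m" "m \<in> KE"
    unfolding Mo_simps(1) using diag_closure_subset by blast
  show "x \<oplus>\<^bsub>Mo\<^esub> y = y \<oplus>\<^bsub>Mo\<^esub> x"
    unfolding l(1) m(1) Mo_add[OF l(2) m(2)] Mo_add[OF m(2) l(2)] by (simp only: mult.commute)
qed

lemma finsum_Mo: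
  assumes "finite A" "\<forall>i\<in>A. l i \<in> KE \<and> class_family (l i) \<in> diag_closure \<Gamma>"
  shows "(\<lambda>P. \<Prod>i\<in>A. l i P) \<in> KE \<and>
    finsum Mo (\<lambda>i. class_family (l i)) A = class_family (\<lambda>P. \<Prod>i\<in>A. l i P)"
  using assms
proof (induction A rule: finite_induct)
  case empty
  interpret abelian_monoid Mo by (rule abelian_monoid_Mo)
  show ?case
    by (simp add: Mo_zero KE_1)
next
  case (insert i A)
  interpret abelian_monoid Mo by (rule abelian_monoid_Mo)
  have "finsum Mo (\<lambda>i. class_family (l i)) (insert i A) = class_family (l i) \<oplus>\<^bsub>Mo\<^esub> finsum Mo (\<lambda>i. class_family (l i)) A"
    using insert.prems insert.hyps by (intro finsum_insert) (auto simp: Mo_simps(1))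
  then show ?case
    using insert by (simp add: Mo_add KE_mult)
qed

text \<open>One sequence of natural numbers tending to \<zeta> serves all primes at once, so the
  p-adic power is a simultaneous limit of the natural powers of \<open>u\<close> and stays in the
  closure.\<close>

lemma smult_Mo:
  assumes u: "u \<in> Y" and \<zeta>: "\<zeta> \<in> closure \<rat>" "nm \<zeta> \<le> 1"
  shows "cls of_rat \<zeta> \<odot>\<^bsub>Mo\<^esub> diag_embed \<Gamma> u = class_family (\<lambda>P. upow (E P u) \<zeta>)"
    and "(\<lambda>P. upow (E P u) \<zeta>) \<in> KE" and "class_family (\<lambda>P. upow (E P u) \<zeta>) \<in> diag_closure \<Gamma>"
proof -
  have u1: "nm (E P u - 1) < 1" if "P \<in> \<Gamma>" for P
    using u that by (simp add: Y_iff)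
  have "(\<lambda>P\<in>\<Gamma>. padic_power p P (class_family (\<lambda>P. E P u) P) (cls of_rat \<zeta>)) = (\<lambda>P\<in>\<Gamma>. cls (E P) (upow (E P u) \<zeta>))"
  proof (rule restrict_ext)
    fix P assume P: "P \<in> \<Gamma>"
    interpret e: padic_embedding p T "E P" "card B"
      by (rule padic_embedding_E[OF P])
    have "padic_power p P (cls (E P) (E P u)) (cls of_rat \<zeta>) = cls (E P) (upow (E P u) \<zeta>)"
      using e.padic_power_eq[OF e.K_hom u1[OF P] \<zeta>] unfolding val_ideal_E[OF P] .
    then show "padic_power p P (class_family (\<lambda>P. E P u) P) (cls of_rat \<zeta>) = cls (E P) (upow (E P u) \<zeta>)"
      using P by (simp add: class_family_def)
  qed
  then show "cls of_rat \<zeta> \<odot>\<^bsub>Mo\<^esub> diag_embed \<Gamma> u = class_family (\<lambda>P. upow (E P u) \<zeta>)"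
    unfolding Mo_simps(4) diag_embed_eq class_family_def[of "\<lambda>P. upow (E P u) \<zeta>"] .
  have "upow (E P u) \<zeta> \<in> closure (range (E P)) \<and> nm (upow (E P u) \<zeta> - 1) < 1" if P: "P \<in> \<Gamma>" for P
  proof -
    interpret e: padic_embedding p T "E P" "card B"
      by (rule padic_embedding_E[OF P])
    show ?thesis
      using e.upow_in_K[OF e.K_hom u1[OF P] \<zeta>] upow_close[OF u1[OF P] \<zeta>] by blast
  qed
  then show KE: "(\<lambda>P. upow (E P u) \<zeta>) \<in> KE"
    by (simp add: KE_def)
  obtain n where n: "(\<lambda>k. of_nat (n k)) \<longlonglongrightarrow> \<zeta>"
    by (rule ex_nat_tendsto[OF \<zeta>])
  have lim: "(\<lambda>k. E P (u ^ n k)) \<longlonglongrightarrow> upow (E P u) \<zeta>" if P: "P \<in> \<Gamma>" for P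
  proof -
    interpret e: field_embedding "E P" by (rule embedding_E[OF P])
    show ?thesis
      unfolding e.hom_power by (rule upow[OF u1[OF P] n])
  qed
  have "\<exists>w. (\<forall>k. w k \<in> Y) \<and> (\<forall>P\<in>\<Gamma>. (\<lambda>k. E P (w k)) \<longlonglongrightarrow> upow (E P u) \<zeta>)"
    by (rule exI[of _ "\<lambda>k. u ^ n k"]) (use lim Y_power[OF u] in simp)
  then show "class_family (\<lambda>P. upow (E P u) \<zeta>) \<in> diag_closure \<Gamma>"
    unfolding class_family_in_diag_closure_iff[OF KE] .
qed

lemma diag_embed_in_diag_closure: "u \<in> Y \<Longrightarrow> diag_embed \<Gamma> u \<in> diag_closure \<Gamma>"
  unfolding diag_embed_eq by (subst class_family_in_diag_closure_iff[OF Y_KE]) (auto intro!: exI[of _ "\<lambda>_. u"])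

text \<open>At each prime some power of a unit is principal; the product of these finitely many
  exponents serves all primes and all units in \<open>S\<close>.\<close>

lemma power_in_Y:
  assumes "finite S" "S \<subseteq> OU" shows "\<exists>N>0. \<forall>v\<in>S. v ^ N \<in> Y"
proof -
  have ex: "\<exists>m>0. nm (E P v ^ m - 1) < 1" if "P \<in> \<Gamma>" "v \<in> S" for P v
    using unit_power_close[OF nm_unit[OF embedding_E[OF that(1)]]] assms(2) that(2) by blast
  define m where "m P v = (SOME m. m > 0 \<and> nm (E P v ^ m - 1) < 1)" for P v
  have m: "m P v > 0" "nm (E P v ^ m P v - 1) < 1" if "P \<in> \<Gamma>" "v \<in> S" for P v
    using someI_ex[OF ex[OF that]] unfolding m_def by blast+
  define N where "N = (\<Prod>(P, v)\<in>\<Gamma> \<times> S. m P v)"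
  have "N > 0"
    unfolding N_def using m(1) by (intro prod_pos) auto
  moreover have "v ^ N \<in> Y" if v: "v \<in> S" for v
  proof -
    have "nm (E P (v ^ N) - 1) < 1" if P: "P \<in> \<Gamma>" for P
    proof -
      interpret e: field_embedding "E P" by (rule embedding_E[OF P])
      have "m P v dvd N"
        unfolding N_def using dvd_prodI[of "\<Gamma> \<times> S" "(P, v)" "\<lambda>(P, v). m P v"] finite_\<Gamma> assms(1) P v by auto
      then obtain k where k: "N = m P v * k" ..
      show ?thesis
        unfolding e.hom_power k power_mult by (rule nm_power_close[OF m(2)[OF P v]])
    qed
    then show ?thesis
      using v assms(2) by (auto simp: Y_iff OU_power)
  qed
  ultimately show ?thesis
    by blast
qed

text \<open>Through either embedding \<open>adic_abs P\<close> is a power of the absolute value of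
  C_p, so smallness of x - 1 passes from one to the other.\<close>

lemma same_ideal_tendsto_1:
  assumes P: "P \<in> \<Gamma>" and \<sigma>: "field_embedding (\<sigma> :: 'm \<Rightarrow> 'c)" "P = val_ideal \<sigma>"
    and lim: "(\<lambda>k. E P (x k)) \<longlonglongrightarrow> 1"
  shows "(\<lambda>k. \<sigma> (x k)) \<longlonglongrightarrow> 1"
proof -
  interpret e: padic_embedding p T "E P" "card B"
    by (rule padic_embedding_E[OF P])
  interpret s: padic_embedding p T \<sigma> "card B"
    by (rule padic_embedding_if_embedding[OF \<sigma>(1)])
  have "(\<lambda>k. nm (E P (x k - 1))) \<longlonglongrightarrow> 0"
    using lim unfolding tendsto_iff_nm[of _ 1] by (simp add: e.hom_diff)
  then have "(\<lambda>k. nm (E P (x k - 1)) powr e.kappa) \<longlonglongrightarrow> 0"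
    unfolding e.powr_kappa_tendsto_0_iff .
  then have "(\<lambda>k. adic_abs P (x k - 1)) \<longlonglongrightarrow> 0"
    unfolding e.kappa(2)[symmetric] val_ideal_E[OF P] .
  then have "(\<lambda>k. adic_abs (val_ideal \<sigma>) (x k - 1)) \<longlonglongrightarrow> 0"
    using \<sigma>(2) by simp
  then have "(\<lambda>k. nm (\<sigma> (x k - 1))) \<longlonglongrightarrow> 0"
    unfolding s.kappa(2) s.powr_kappa_tendsto_0_iff .
  then show ?thesis
    unfolding tendsto_iff_nm[of _ 1] by (simp add: s.hom_diff)
qed

text \<open>The exponents are approximated by natural numbers, which keeps the products
  \<open>x k\<close> inside the number field, where the embedding can be exchanged. They tend to 1
  under \<open>E P\<close>, hence under \<sigma>; their logarithms tend to 0, and also to the sum in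
  question times \<open>N\<close>.\<close>

lemma plog_relation:
  assumes S: "finite S" "S \<subseteq> OU" and Y: "\<forall>v\<in>S. v ^ N \<in> Y" and N: "N > 0"
    and \<zeta>: "\<forall>v\<in>S. \<zeta> v \<in> closure \<rat> \<and> nm (\<zeta> v) \<le> 1"
    and P: "P \<in> \<Gamma>" and \<sigma>: "field_embedding (\<sigma> :: 'm \<Rightarrow> 'c)" "P = val_ideal \<sigma>"
    and rel: "(\<Prod>v\<in>S. upow (E P (v ^ N)) (\<zeta> v)) = 1"
  shows "(\<Sum>v\<in>S. plog (\<sigma> v) * \<zeta> v) = 0"
proof -
  interpret e: padic_embedding p T "E P" "card B"
    by (rule padic_embedding_E[OF P])
  interpret s: field_embedding \<sigma>
    by (rule \<sigma>(1))
  have "\<forall>v\<in>S. \<exists>n. (\<lambda>k. of_nat (n k)) \<longlonglongrightarrow> \<zeta> v"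
  proof
    fix v assume "v \<in> S"
    then have "\<zeta> v \<in> closure \<rat>" "nm (\<zeta> v) \<le> 1"
      using \<zeta> by auto
    from ex_nat_tendsto[OF this] show "\<exists>n. (\<lambda>k. of_nat (n k)) \<longlonglongrightarrow> \<zeta> v"
      by blast
  qed
  from bchoice[OF this] obtain n where n: "\<forall>v\<in>S. (\<lambda>k. of_nat (n v k)) \<longlonglongrightarrow> \<zeta> v" ..
  define x where "x k = (\<Prod>v\<in>S. (v ^ N) ^ n v k)" for k
  have "(\<lambda>k. \<Prod>v\<in>S. E P (v ^ N) ^ n v k) \<longlonglongrightarrow> (\<Prod>v\<in>S. upow (E P (v ^ N)) (\<zeta> v))"
  proof (rule tendsto_prod_nm)
    fix v assume v: "v \<in> S"
    have "nm (E P (v ^ N) - 1) < 1"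
      using Y v P by (auto simp: Y_iff)
    then show "(\<lambda>k. E P (v ^ N) ^ n v k) \<longlonglongrightarrow> upow (E P (v ^ N)) (\<zeta> v)"
      by (rule upow) (use n v in blast)
  qed
  then have "(\<lambda>k. E P (x k)) \<longlonglongrightarrow> 1"
    unfolding rel by (simp add: x_def e.hom_prod e.hom_power)
  then have "(\<lambda>k. \<sigma> (x k)) \<longlonglongrightarrow> 1"
    by (rule same_ideal_tendsto_1[OF P \<sigma>])
  then have "(\<lambda>k. plog (\<sigma> (x k))) \<longlonglongrightarrow> 0"
    by (rule plog_tendsto_0)
  moreover have "plog (\<sigma> (x k)) = (\<Sum>v\<in>S. of_nat (n v k) * (of_nat N * plog (\<sigma> v)))" for k
  proof -
    have nz: "\<sigma> v \<noteq> 0" if "v \<in> S" for v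
      using OU_nonzero[of v] S(2) that by auto
    have "plog (\<sigma> (x k)) = (\<Sum>v\<in>S. plog ((\<sigma> v ^ N) ^ n v k))"
      unfolding x_def s.hom_prod s.hom_power by (rule plog_prod) (use nz in simp)
    also have "\<dots> = (\<Sum>v\<in>S. of_nat (n v k) * (of_nat N * plog (\<sigma> v)))"
      using nz by (intro sum.cong refl) (simp add: plog_power)
    finally show ?thesis .
  qed
  ultimately have "(\<lambda>k. \<Sum>v\<in>S. of_nat (n v k) * (of_nat N * plog (\<sigma> v))) \<longlonglongrightarrow> 0"
    by simp
  moreover have "(\<lambda>k. \<Sum>v\<in>S. of_nat (n v k) * (of_nat N * plog (\<sigma> v))) \<longlonglongrightarrow> (\<Sum>v\<in>S. \<zeta> v * (of_nat N * plog (\<sigma> v)))"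
    by (intro tendsto_sum_nm tendsto_mult_nm tendsto_const) (use n in blast)
  ultimately have "(\<Sum>v\<in>S. \<zeta> v * (of_nat N * plog (\<sigma> v))) = 0"
    using LIMSEQ_unique by blast
  also have "(\<Sum>v\<in>S. \<zeta> v * (of_nat N * plog (\<sigma> v))) = of_nat N * (\<Sum>v\<in>S. plog (\<sigma> v) * \<zeta> v)"
    unfolding sum_distrib_left by (rule sum.cong[OF refl]) (simp add: mult_ac)
  finally show ?thesis
    using N by simp
qed

text \<open>A p-adic relation between the N-th powers, read at the prime induced by \<sigma> \<circ>
  h, becomes a linear relation in row \<open>h\<close> with the exponents as coefficients.
  Independence of the columns over C_p makes all exponents vanish.\<close>

lemma card_le_rank_diag_closure_module:
  assumes \<sigma>: "field_embedding (\<sigma> :: 'm \<Rightarrow> 'c)" and H: "H \<subseteq> G" "\<forall>h\<in>H. val_ideal (\<sigma> \<circ> h) \<in> \<Gamma>"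
    and S: "finite S" "S \<subseteq> OU"
    and indep: "\<forall>z :: 'm \<Rightarrow> 'c. (\<forall>h\<in>H. (\<Sum>v\<in>S. plog (\<sigma> (h v)) * z v) = 0) \<longrightarrow> (\<forall>v\<in>S. z v = 0)"
  shows "enat (card S) \<le> module_rank (padic_integers p) Mo"
proof -
  obtain N where N: "N > 0" "\<forall>v\<in>S. v ^ N \<in> Y"
    using power_in_Y[OF S] by blast
  define f where "f v = diag_embed \<Gamma> (v ^ N)" for v
  have \<sigma>h: "field_embedding (\<sigma> \<circ> h)" if "h \<in> H" for h
    by (rule embedding_comp_galois[OF \<sigma>]) (use H(1) that in blast)
  \<comment> \<open>The rank counts elements of a set, so distinct units must have distinct images:
    v^N = w^N would make the columns of \<open>v\<close> and \<open>w\<close> equal.\<close>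
  have inj: "inj_on f S"
  proof (rule inj_onI, rule ccontr)
    fix v w assume v: "v \<in> S" and w: "w \<in> S" and eq: "f v = f w" and "v \<noteq> w"
    \<comment> \<open>Without rows, \<open>indep\<close> would force even the constant vector 1 to
      vanish at \<open>v\<close>.\<close>
    have "H \<noteq> {}"
      using indep[rule_format, of "\<lambda>_. 1" v] v by auto
    then obtain P where P: "P \<in> \<Gamma>"
      using H(2) by blast
    interpret e: field_embedding "E P" by (rule embedding_E[OF P])
    have vY: "v ^ N \<in> Y"
      using N(2) v by blast
    have "class_family (\<lambda>P. E P (v ^ N)) = class_family (\<lambda>P. E P (w ^ N))"
      using eq unfolding f_def diag_embed_eq .
    then have "E P (v ^ N) = E P (w ^ N)"
      using P by (simp only: class_family_eq_iff[OF Y_KE[OF vY]])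
    then have pow: "v ^ N = w ^ N"
      by simp
    define z :: "'m \<Rightarrow> 'c" where "z x = (if x = v then 1 else if x = w then - 1 else 0)" for x
    have "(\<Sum>x\<in>S. plog (\<sigma> (h x)) * z x) = 0" if h: "h \<in> H" for h
    proof -
      interpret s: field_embedding "\<sigma> \<circ> h" by (rule \<sigma>h[OF h])
      have nz: "(\<sigma> \<circ> h) v \<noteq> 0" "(\<sigma> \<circ> h) w \<noteq> 0"
        using OU_nonzero[OF subsetD[OF S(2) v]] OU_nonzero[OF subsetD[OF S(2) w]] by (simp_all only: s.hom_eq_0 not_False_eq_True)
      have "of_nat N * plog ((\<sigma> \<circ> h) v) = of_nat N * plog ((\<sigma> \<circ> h) w)"
        unfolding plog_power[OF nz(1), symmetric] plog_power[OF nz(2), symmetric] s.hom_power[symmetric] pow ..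
      then have eq: "plog (\<sigma> (h v)) = plog (\<sigma> (h w))"
        using N(1) by simp
      have "(\<Sum>x\<in>S. plog (\<sigma> (h x)) * z x) = (\<Sum>x\<in>{v, w}. plog (\<sigma> (h x)) * z x)"
        using S(1) v w by (intro sum.mono_neutral_right) (auto simp: z_def)
      also have "\<dots> = 0"
        using \<open>v \<noteq> w\<close> eq by (simp add: z_def)
      finally show ?thesis .
    qed
    then have "\<forall>x\<in>S. z x = 0"
      using indep by blast
    with v show False
      by (auto simp: z_def)
  qed
  have "indep_subset (padic_integers p) Mo (f ` S)"
    unfolding indep_subset_def
  proof (intro conjI ballI impI)
    show "finite (f ` S)"
      using S(1) by simp
    show "f ` S \<subseteq> carrier Mo"
      using N(2) diag_embed_in_diag_closure by (auto simp: f_def Mo_simps(1))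
    fix a x
    assume a: "a \<in> f ` S \<rightarrow> carrier (padic_integers p)" and zero: "(\<Oplus>\<^bsub>Mo\<^esub>x\<in>f ` S. a x \<odot>\<^bsub>Mo\<^esub> x) = \<zero>\<^bsub>Mo\<^esub>"
      and x: "x \<in> f ` S"
    have "\<forall>v\<in>S. \<exists>\<zeta> :: 'c. \<zeta> \<in> closure \<rat> \<and> nm \<zeta> \<le> 1 \<and> a (f v) = cls of_rat \<zeta>"
      using a unfolding padic_integers_carrier by (auto simp: Pi_iff image_iff)
    from bchoice[OF this] obtain \<zeta> :: "'m \<Rightarrow> 'c" where
      \<zeta>: "\<forall>v\<in>S. \<zeta> v \<in> closure \<rat> \<and> nm (\<zeta> v) \<le> 1 \<and> a (f v) = cls of_rat (\<zeta> v)" ..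
    define l where "l = (\<lambda>v P. upow (E P (v ^ N)) (\<zeta> v))"
    have l: "a (f v) \<odot>\<^bsub>Mo\<^esub> f v = class_family (l v)" "l v \<in> KE" "class_family (l v) \<in> diag_closure \<Gamma>"
      if "v \<in> S" for v
    proof -
      have *: "v ^ N \<in> Y" "\<zeta> v \<in> closure \<rat>" "nm (\<zeta> v) \<le> 1" "a (f v) = cls of_rat (\<zeta> v)"
        using that N(2) \<zeta> by auto
      show "a (f v) \<odot>\<^bsub>Mo\<^esub> f v = class_family (l v)"
        unfolding *(4) unfolding f_def l_def by (rule smult_Mo(1)[OF *(1-3)])
      show "l v \<in> KE"
        unfolding l_def by (rule smult_Mo(2)[OF *(1-3)])
      show "class_family (l v) \<in> diag_closure \<Gamma>"
        unfolding l_def by (rule smult_Mo(3)[OF *(1-3)])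
    qed
    interpret abelian_monoid Mo by (rule abelian_monoid_Mo)
    have "(\<Oplus>\<^bsub>Mo\<^esub>x\<in>f ` S. a x \<odot>\<^bsub>Mo\<^esub> x) = (\<Oplus>\<^bsub>Mo\<^esub>v\<in>S. a (f v) \<odot>\<^bsub>Mo\<^esub> f v)"
    proof (rule add.finprod_reindex[OF _ inj])
      show "(\<lambda>x. a x \<odot>\<^bsub>Mo\<^esub> x) \<in> f ` S \<rightarrow> carrier Mo"
        using l(1,3) by (auto simp: Mo_simps(1))
    qed
    also have "\<dots> = (\<Oplus>\<^bsub>Mo\<^esub>v\<in>S. class_family (l v))"
      using l by (intro finsum_cong') (auto simp: Mo_simps(1))
    also have "\<dots> = class_family (\<lambda>P. \<Prod>v\<in>S. l v P)"
      using finsum_Mo[OF S(1), of l] l by blast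
    finally have "class_family (\<lambda>_. 1) = class_family (\<lambda>P. \<Prod>v\<in>S. l v P)"
      using zero Mo_zero by simp
    then have rel: "\<forall>P\<in>\<Gamma>. 1 = (\<Prod>v\<in>S. l v P)"
      by (simp only: class_family_eq_iff[OF KE_1])
    have "(\<Sum>v\<in>S. plog (\<sigma> (h v)) * \<zeta> v) = 0" if h: "h \<in> H" for h
    proof -
      have P: "val_ideal (\<sigma> \<circ> h) \<in> \<Gamma>"
        using H(2) h by blast
      have "(\<Prod>v\<in>S. upow (E (val_ideal (\<sigma> \<circ> h)) (v ^ N)) (\<zeta> v)) = 1"
        using rel P unfolding l_def by simp
      from plog_relation[OF S N(2,1) _ P \<sigma>h[OF h] refl this] show ?thesis
        using \<zeta> by simp
    qed
    then have "\<forall>v\<in>S. \<zeta> v = 0"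
      using indep by blast
    then show "a x = \<zero>\<^bsub>padic_integers p\<^esub>"
      using x \<zeta> padic_integers_zero by auto
  qed
  then have "enat (card (f ` S)) \<le> module_rank (padic_integers p) Mo"
    unfolding module_rank_def by (intro SUP_upper) simp
  then show ?thesis
    by (simp add: card_image[OF inj])
qed

end

section \<open>The module of global units and the rank inequality\<close>

lemma abelian_monoid_units_module: "abelian_monoid (units_module :: (int, 'a::field_char_0) module)"
  by (rule abelian_monoidI) (auto simp: units_module_def OU_1 OU_mult mult_ac)

lemma finsum_units_module:
  fixes f :: "'i \<Rightarrow> 'a::field_char_0"
  assumes "finite A" "\<forall>i\<in>A. f i \<in> OU"
  shows "finsum units_module f A = prod f A"
  using assms
proof (induction A rule: finite_induct)
  case empty
  interpret abelian_monoid "units_module :: (int, 'a) module" by (rule abelian_monoid_units_module)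
  show ?case
    unfolding finsum_empty by (simp add: units_module_def)
next
  case (insert i A)
  interpret abelian_monoid "units_module :: (int, 'a) module" by (rule abelian_monoid_units_module)
  have "finsum units_module f (insert i A) = f i \<oplus>\<^bsub>units_module\<^esub> finsum units_module f A"
    using insert by (intro finsum_insert) (auto simp: units_module_def)
  then show ?case
    using insert by (simp add: units_module_def)
qed

lemma indep_subset_units_module:
  assumes "indep_subset \<Z> (units_module :: (int, 'a::field_char_0) module) W"
  shows "finite W" "W \<subseteq> OU" "mult_indep W"
proof -
  show W: "finite W" "W \<subseteq> OU"
    using assms by (auto simp: indep_subset_def units_module_def)
  show "mult_indep W"
    unfolding mult_indep_def
  proof (intro allI impI)
    fix a assume a: "(\<Prod>w\<in>W. w powi a w) = 1"
    have smult: "k \<odot>\<^bsub>units_module\<^esub> w = w powi k" for k and w :: 'a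
      by (simp add: units_module_def)
    have "(\<Oplus>\<^bsub>units_module\<^esub>w\<in>W. a w \<odot>\<^bsub>units_module\<^esub> w) = (\<Prod>w\<in>W. w powi a w)"
      unfolding smult using W by (intro finsum_units_module) (auto intro: OU_powi)
    also have "\<dots> = \<zero>\<^bsub>units_module\<^esub>"
      using a by (simp add: units_module_def)
    finally show "\<forall>w\<in>W. a w = 0"
      using assms unfolding indep_subset_def by simp
  qed
qed

theorem corollary7p8:
  fixes p :: nat
    and \<Gamma> :: "'m::field_char_0 set set"
    and P\<^sub>0 :: "'m set"
    and \<phi> :: "(nat \<Rightarrow> 'm) set \<Rightarrow> 'c::{field_char_0, complete_space}"
    and \<sigma>\<^sub>0 \<sigma> :: "'m \<Rightarrow> 'c"
    and S\<^sub>p :: "('m \<Rightarrow> 'c) set"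
    and r rk :: enat
    and t :: nat
  assumes "galois_number_field TYPE('m)"
    and "\<not> totally_real TYPE('m)"
    and "Factorial_Ring.prime p"
    and "\<Gamma> \<noteq> {}"
    and "\<Gamma> \<subseteq> primes_above p"
    and "padic_complex_field p TYPE('c)"
    and "P\<^sub>0 \<in> \<Gamma>"
    and "\<phi> \<in> ring_hom (local_field P\<^sub>0) ring_of_type_algebra"
    and "continuous_map
           (Metric_space.mtopology (carrier (local_field P\<^sub>0)) (local_dist P\<^sub>0)) euclidean \<phi>"
    and "\<sigma>\<^sub>0 = \<phi> \<circ> local_embed P\<^sub>0"
    and "S\<^sub>p = embeddings_over \<Gamma> P\<^sub>0 \<sigma>\<^sub>0"
    and "\<sigma> \<in> embeddings"
    and "t = min_coset_count (complement_indices S\<^sub>p \<sigma>)"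
    and "r = module_rank \<Z> (units_module :: (int, 'm) module)"
    and "rk = module_rank (padic_integers p) (diag_closure_module p \<Gamma>)"
    and "padic_schanuel p TYPE('c)"
  shows "ereal_of_enat rk \<ge> ereal_of_enat r - ereal (max (real t - 1) 0)"
proof -
  interpret galois_padic p "TYPE('c)" "TYPE('m)"
    using assms(1,3,6) by unfold_locales
  have \<sigma>: "field_embedding \<sigma>"
    using assms(12) by (simp add: embeddings_iff)
  have P0: "P\<^sub>0 \<in> primes_above p"
    using assms(5,7) by blast
  have \<sigma>0: "P\<^sub>0 = val_ideal \<sigma>\<^sub>0"
    using continuous_embedding_val_ideal(2)[OF P0 \<sigma> assms(8,9)] assms(10) by simp
  have "\<forall>P\<in>\<Gamma>. \<exists>\<tau> :: 'm \<Rightarrow> 'c. field_embedding \<tau> \<and> val_ideal \<tau> = P"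
  proof
    fix P assume "P \<in> \<Gamma>"
    then obtain g where "g \<in> G" "P = val_ideal (\<sigma> \<circ> g)"
      using prime_eq_val_ideal[OF subsetD[OF assms(5)] \<sigma>] by blast
    then show "\<exists>\<tau> :: 'm \<Rightarrow> 'c. field_embedding \<tau> \<and> val_ideal \<tau> = P"
      using embedding_comp_galois[OF \<sigma>] by blast
  qed
  from bchoice[OF this] obtain E :: "'m set \<Rightarrow> 'm \<Rightarrow> 'c" where
    E: "\<forall>P\<in>\<Gamma>. field_embedding (E P) \<and> val_ideal (E P) = P" ..
  interpret diagonal_closure p "TYPE('c)" "TYPE('m)" \<Gamma> E
  proof (intro diagonal_closure.intro diagonal_closure_axioms.intro galois_padic_axioms)
    show "finite \<Gamma>"
      using finite_primes_above[OF \<sigma>] assms(5) by (rule finite_subset[rotated])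
  qed (use E in blast)+
  define J where "J = complement_indices S\<^sub>p \<sigma>"
  have H: "val_ideal (\<sigma> \<circ> h) \<in> \<Gamma>" if h: "h \<in> G - J" for h
  proof -
    have "\<sigma> \<circ> h \<in> S\<^sub>p"
      using h embedding_comp_galois[OF \<sigma>, of h] by (auto simp: J_def complement_indices_def embeddings_iff)
    then obtain g where g: "\<sigma> \<circ> h = \<sigma>\<^sub>0 \<circ> g" "g \<in> G" "g -` P\<^sub>0 \<in> \<Gamma>"
      unfolding assms(11) embeddings_over_def by blast
    then show ?thesis
      using vimage_val_ideal[OF g(2), of \<sigma>\<^sub>0] \<sigma>0 by simp
  qed
  \<comment> \<open>A complex embedding makes the set of conjugations nonempty, so the minimum
    defining \<open>t\<close> is attained.\<close>
  obtain \<tau> :: "'m \<Rightarrow> complex" where "\<tau> \<in> embeddings"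
    using assms(2) unfolding totally_real_def by auto
  then have \<tau>: "field_embedding \<tau>"
    unfolding embeddings_iff .
  have "t \<in> coset_count J ` complex_conjugations"
    unfolding assms(13) min_coset_count_def J_def[symmetric]
    using finite_complex_conjugations complex_conjugations_nonempty[OF \<tau>] by (intro Min_in) auto
  then obtain c where c: "c \<in> complex_conjugations" "t = coset_count J c"
    by blast
  have "enat (card W) \<le> rk + enat (t - 1)" if W: "indep_subset \<Z> (units_module :: (int, 'm) module) W" for W
  proof -
    obtain S where S: "S \<subseteq> W" "card W \<le> card S + (coset_count J c - 1)"
      "\<forall>z :: 'm \<Rightarrow> 'c. (\<forall>h\<in>G - J. (\<Sum>v\<in>S. plog (\<sigma> (h v)) * z v) = 0) \<longrightarrow> (\<forall>v\<in>S. z v = 0)"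
      by (rule independent_plog_columns[OF \<sigma> assms(16) c(1) indep_subset_units_module[OF W]])
    have "finite S" "S \<subseteq> OU"
      by (rule finite_subset[OF S(1) indep_subset_units_module(1)[OF W]],
          rule order.trans[OF S(1) indep_subset_units_module(2)[OF W]])
    then have "enat (card S) \<le> rk"
      unfolding assms(15) using H by (intro card_le_rank_diag_closure_module[OF \<sigma> _ _ _ _ S(3)] Diff_subset ballI)
    have "enat (card W) \<le> enat (card S) + enat (t - 1)"
      using S(2) c(2) by simp
    also have "\<dots> \<le> rk + enat (t - 1)"
      using \<open>enat (card S) \<le> rk\<close> by (rule add_right_mono)
    finally show ?thesis .
  qed
  then have "r \<le> rk + enat (t - 1)"
    unfolding assms(14) module_rank_def by (intro SUP_least) auto
  \<comment> \<open>Truncated subtraction on the naturals is the positive part of t - 1.\<close>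
  moreover have "max (real t - 1) 0 = real (t - 1)"
    by (cases t) auto
  ultimately show ?thesis
    by (cases r; cases rk) auto
qed

end
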